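(* Let $P(z)=a_0(z-\alpha_1)(z-\alpha_2)\cdots(z-\alpha_n)$ be a complex polynomial of degree $n$ (so $a_0\neq 0$), where $\alpha_i\neq\alpha_j$ for $1\le i,j\le n$ with $i\ne j$, and let $S=\{\alpha_1,\alpha_2,\ldots,\alpha_n\}$ be the set of all distinct zeros of $P$. Let $k$ be the number of distinct zeros of the derivative $P'(z)$. If $n\ge 2k+7$ (resp. $n\ge 2k+3$), then the following two statements are equivalent: (a) $S$ is a $URSM_{3)}$ (resp. $URSE_{3)}$). (b) $S$ is a $URSM$ (resp. $URSE$).
   Context: Meromorphic (resp. entire) functions are meromorphic (resp. holomorphic) in the whole complex plane $\mathbb{C}$. For $S\subset\mathbb{C}\cup\{\infty\}$ and $f$ non-constant meromorphic, $E_f(S)=\bigcup_{a\in S}\{z: f(z)-a=0\}$, regarded as a multiset in which an $a$-point of $f$ ($a\in S$) of multiplicity $m$ is counted $m$ times. For $l$ a non-negative integer or $\infty$, $E_{l)}(a;f)$ is the multiset of all $a$-points of $f$ whose multiplicities are not greater than $l$, each counted according to its multiplicity. Set $E_{l)}(S,f)=\bigcup_{a\in S}E_{l)}(a;f)$ (as multisets). $S$ is a $URSM$ (resp. $URSE$), i.e. a unique range set for meromorphic (resp. entire) functions, if for any two non-constant meromorphic (resp. entire) functions $f,g$, $E_f(S)=E_g(S)$ implies $f\equiv g$. $S$ is a $URSM_{l)}$ (resp. $URSE_{l)}$) if for any two non-constant meromorphic (resp. entire) functions $f,g$, $E_{l)}(S,f)=E_{l)}(S,g)$ implies $f\equiv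 g$. The statement with "resp." is two statements: one for meromorphic functions with $n\ge 2k+7$, and one for entire functions with $n\ge 2k+3$. *)

theory Defs
  imports "HOL-Complex_Analysis.Complex_Analysis" "HOL-Library.Extended_Nat"
begin

text \<open>
  A meromorphic function on the plane is represented by its normal form: a function with
  \<^prop>\<open>f nicely_meromorphic_on UNIV\<close>, i.e. with no removable singularities left and with the
  dummy value 0 at its poles. In this form the identity of two meromorphic functions is plain
  equality, but a pole must not be mistaken for a zero; hence the exclusion of poles
  in \<open>point_mult\<close>.
\<close>

definition nonconst_meromorphic :: "(complex \<Rightarrow> complex) \<Rightarrow> bool" where
  "nonconst_meromorphic f \<longleftrightarrow> f nicely_meromorphic_on UNIV \<and> \<not> f constant_on UNIV"

definition nonconst_entire :: "(complex \<Rightarrow> complex) \<Rightarrow> bool" where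
  "nonconst_entire f \<longleftrightarrow> f holomorphic_on UNIV \<and> \<not> f constant_on UNIV"

text \<open>The multiplicity of \<open>z\<close> as an \<open>a\<close>-point of \<open>f\<close>; it is 0 if \<open>z\<close> is not an \<open>a\<close>-point.\<close>

definition point_mult :: "complex \<Rightarrow> (complex \<Rightarrow> complex) \<Rightarrow> complex \<Rightarrow> nat" where
  "point_mult a f z =
     (if \<not> is_pole f z \<and> f z = a then nat (zorder (\<lambda>w. f w - a) z) else 0)"

text \<open>
  Multisets of points are represented by their counting functions \<^typ>\<open>complex \<Rightarrow> nat\<close>, because
  they may be infinite. \<open>points_upto l a f\<close> is $E_{l)}(a;f)$, with \<^term>\<open>l = \<infinity>\<close> allowed.
\<close>

definition points_upto :: "enat \<Rightarrow> complex \<Rightarrow> (complex \<Rightarrow> complex) \<Rightarrow> complex \<Rightarrow> nat" where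
  "points_upto l a f z =
     (if enat (point_mult a f z) \<le> l then point_mult a f z else 0)"

text \<open>
  $E_f(S)$ and $E_{l)}(S,f)$. The multisets for different \<open>a\<close> are disjoint, so at
  each \<open>z\<close> at most one \<open>a\<close> contributes; restricting the index set to values actually taken
  at \<open>z\<close> keeps the sum meaningful for infinite \<open>S\<close> as well.
\<close>

definition preimage_mset ::
    "complex set \<Rightarrow> (complex \<Rightarrow> complex) \<Rightarrow> complex \<Rightarrow> nat" where
  "preimage_mset S f z = (\<Sum>a | a \<in> S \<and> f z = a. point_mult a f z)"

definition preimage_mset_upto ::
    "enat \<Rightarrow> complex set \<Rightarrow> (complex \<Rightarrow> complex) \<Rightarrow> complex \<Rightarrow> nat" where
  "preimage_mset_upto l S f z = (\<Sum>a | a \<in> S \<and> f z = a. points_upto l a f z)"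

definition URSM :: "complex set \<Rightarrow> bool" where
  "URSM S \<longleftrightarrow> (\<forall>f g. nonconst_meromorphic f \<longrightarrow> nonconst_meromorphic g \<longrightarrow>
     preimage_mset S f = preimage_mset S g \<longrightarrow> f = g)"

definition URSE :: "complex set \<Rightarrow> bool" where
  "URSE S \<longleftrightarrow> (\<forall>f g. nonconst_entire f \<longrightarrow> nonconst_entire g \<longrightarrow>
     preimage_mset S f = preimage_mset S g \<longrightarrow> f = g)"

definition URSM_upto :: "enat \<Rightarrow> complex set \<Rightarrow> bool" where
  "URSM_upto l S \<longleftrightarrow> (\<forall>f g. nonconst_meromorphic f \<longrightarrow> nonconst_meromorphic g \<longrightarrow>
     preimage_mset_upto l S f = preimage_mset_upto l S g \<longrightarrow> f = g)"

definition URSE_upto :: "enat \<Rightarrow> complex set \<Rightarrow> bool" where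
  "URSE_upto l S \<longleftrightarrow> (\<forall>f g. nonconst_entire f \<longrightarrow> nonconst_entire g \<longrightarrow>
     preimage_mset_upto l S f = preimage_mset_upto l S g \<longrightarrow> f = g)"

end

theory Submission
  imports Defs "HOL-Computational_Algebra.Fundamental_Theorem_Algebra"
begin

text \<open>
  Only the passage from \<open>URSM S\<close> to \<open>URSM_upto 3 S\<close> is hard. Let \<open>f\<close> and \<open>g\<close> have the same $E_{3)}(S,\cdot)$,
  put \<open>F = 1 / P \<circ> f\<close>, \<open>G = 1 / P \<circ> g\<close> and $H = F''/F' - G''/G'$. If \<open>H = 0\<close>, then \<open>F'\<close> and \<open>G'\<close>
  have the same order at every point. This order is \<open>- m - 1\<close> at an \<open>S\<close>-point of multiplicity \<open>m\<close> and
  nonnegative elsewhere, so \<open>f\<close> and \<open>g\<close> have the same \<open>S\<close>-points with the same multiplicities and the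
  hypothesis on \<open>S\<close> gives \<open>f = g\<close>.

  If \<open>H \<noteq> 0\<close>, write \<open>f = f1/f0\<close> and \<open>g = g1/g0\<close> with entire functions, let \<open>W\<close> be the Wronskian and write
  \<open>St\<close> and \<open>Bt\<close> for the products of \<open>f1 - a f0\<close> over the zeros \<open>a\<close> of \<open>P\<close> and of \<open>P'\<close>, respectively. Since
  \<open>H\<close> has only simple poles and vanishes at common simple \<open>S\<close>-points, the truncated sharing makes
  $X = W_f^2 W_g^2 H^2 (Bt_f Bt_g f_0 g_0)^2 / (St_f St_g)$ entire. By Jensen's formula the circle means of
  \<open>ln \<bar>X\<bar>\<close> are bounded below, while the lemma on the logarithmic derivative bounds them above by
  \<open>- (n - 2k - 2 - 4d) T\<close> up to an error logarithmic in \<open>T\<close>. Here \<open>T\<close> is the sum of the Cartan characteristics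
  of \<open>f\<close> and \<open>g\<close>, with \<open>d = 1\<close> in the meromorphic case and \<open>d = 0\<close> (\<open>f0 = g0 = 1\<close>) in the entire case.
  As \<open>T\<close> is unbounded, this is impossible.
\<close>

section \<open>Means over circles\<close>

text \<open>Counting functions never appear. What truncated multiplicities would contribute is
  stored in the orders of vanishing of the single entire function \<open>X\<close>, and the only
  fact about its zeros that is used is the easy half of Jensen's formula:
  \<open>ln \<bar>X\<bar>\<close> at the centre is at most its mean. The level 3 comes from an
  \<open>S\<close>-point of multiplicity \<mu> of \<open>f\<close> that is not an
  \<open>S\<close>-point of \<open>g\<close>: there $W_f^2 H^2$ supplies order 2 (\<mu> - 1) - 2,
  division by \<open>St_f\<close> costs \<mu>, and \<mu> - 4 must not be negative. The obstacle on
  the analytic side is that the error at radius \<open>r\<close> involves \<open>T\<close> at larger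
  radii, usually handled by exceptional sets of radii. Here the ratio 1 + \<open>h\<close> of
  consecutive radii is kept explicit in the error; a growth argument then shows that
  \<open>T\<close> would be bounded. Logarithms are integrated only over circles that miss all zeros
  of the functions involved, so that every integrand is continuous, and \<open>T\<close> becomes a
  supremum over such circles.\<close>

definition circle_mean :: "complex \<Rightarrow> real \<Rightarrow> (complex \<Rightarrow> real) \<Rightarrow> real" where
  "circle_mean p r \<phi> = integral {0..1} (\<lambda>t. \<phi> (circlepath p r t))"

lemma circlepath_in_sphere: "r \<ge> 0 \<Longrightarrow> circlepath p r t \<in> sphere p r"
  by (simp add: circlepath dist_norm norm_mult)

lemma circle_integrable:
  fixes \<phi> :: "complex \<Rightarrow> 'a::banach"
  assumes "r \<ge> 0" "continuous_on (sphere p r) \<phi>"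
  shows "(\<lambda>t. \<phi> (circlepath p r t)) integrable_on {0..1}"
proof (rule integrable_continuous_real)
  have "continuous_on {0..1} (circlepath p r)"
    unfolding circlepath by (intro continuous_intros)
  moreover have "circlepath p r ` {0..1} \<subseteq> sphere p r"
    using assms(1) circlepath_in_sphere by blast
  ultimately show "continuous_on {0..1} (\<lambda>t. \<phi> (circlepath p r t))"
    using continuous_on_compose2[OF assms(2)] by blast
qed

lemma circle_mean_mono:
  assumes "r \<ge> 0" "continuous_on (sphere p r) \<phi>" "continuous_on (sphere p r) \<psi>"
    and "\<And>z. z \<in> sphere p r \<Longrightarrow> \<phi> z \<le> \<psi> z"
  shows "circle_mean p r \<phi> \<le> circle_mean p r \<psi>"
  unfolding circle_mean_def
  by (intro integral_le circle_integrable assms circlepath_in_sphere)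

lemma circle_mean_cong:
  assumes "r \<ge> 0" "\<And>z. z \<in> sphere p r \<Longrightarrow> \<phi> z = \<psi> z"
  shows "circle_mean p r \<phi> = circle_mean p r \<psi>"
  unfolding circle_mean_def
  by (intro integral_cong assms(2) circlepath_in_sphere assms(1))

lemma circle_mean_const [simp]: "circle_mean p r (\<lambda>_. c) = c"
  by (simp add: circle_mean_def)

lemma circle_mean_add:
  assumes "r \<ge> 0" "continuous_on (sphere p r) \<phi>" "continuous_on (sphere p r) \<psi>"
  shows "circle_mean p r (\<lambda>z. \<phi> z + \<psi> z) = circle_mean p r \<phi> + circle_mean p r \<psi>"
  unfolding circle_mean_def by (intro integral_add circle_integrable assms)

lemma circle_mean_diff:
  assumes "r \<ge> 0" "continuous_on (sphere p r) \<phi>" "continuous_on (sphere p r) \<psi>"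
  shows "circle_mean p r (\<lambda>z. \<phi> z - \<psi> z) = circle_mean p r \<phi> - circle_mean p r \<psi>"
  unfolding circle_mean_def by (intro integral_diff circle_integrable assms)

lemma circle_mean_cmult:
  "circle_mean p r (\<lambda>z. c * \<phi> z) = c * circle_mean p r \<phi>"
  unfolding circle_mean_def by (rule integral_mult_right)

lemma circle_mean_sum:
  assumes "r \<ge> 0" "\<And>i. i \<in> I \<Longrightarrow> continuous_on (sphere p r) (\<phi> i)" "finite I"
  shows "circle_mean p r (\<lambda>z. \<Sum>i\<in>I. \<phi> i z) = (\<Sum>i\<in>I. circle_mean p r (\<phi> i))"
  unfolding circle_mean_def by (intro integral_sum circle_integrable assms)

lemma circle_mean_sum_list:
  assumes "r \<ge> 0" "\<And>i. i \<in> set xs \<Longrightarrow> continuous_on (sphere p r) (\<phi> i)"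
  shows "continuous_on (sphere p r) (\<lambda>z. \<Sum>i\<leftarrow>xs. \<phi> i z)"
    and "circle_mean p r (\<lambda>z. \<Sum>i\<leftarrow>xs. \<phi> i z) = (\<Sum>i\<leftarrow>xs. circle_mean p r (\<phi> i))"
proof -
  have "continuous_on (sphere p r) (\<lambda>z. \<Sum>i\<leftarrow>xs. \<phi> i z) \<and>
    circle_mean p r (\<lambda>z. \<Sum>i\<leftarrow>xs. \<phi> i z) = (\<Sum>i\<leftarrow>xs. circle_mean p r (\<phi> i))"
    using assms(2) by (induction xs) (auto intro!: continuous_intros simp: circle_mean_add assms(1))
  then show "continuous_on (sphere p r) (\<lambda>z. \<Sum>i\<leftarrow>xs. \<phi> i z)"
    and "circle_mean p r (\<lambda>z. \<Sum>i\<leftarrow>xs. \<phi> i z) = (\<Sum>i\<leftarrow>xs. circle_mean p r (\<phi> i))" by auto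
qed

lemma circle_mean_shift: "circle_mean p r \<phi> = circle_mean 0 r (\<lambda>z. \<phi> (p + z))"
  by (simp add: circle_mean_def circlepath)

text \<open>Jensen's inequality for the concave logarithm: \<open>ln\<close> lies below its tangent
  at \<open>\<mu>\<close>, and the mean of the tangent is at most \<open>ln \<mu>\<close>.\<close>

lemma circle_mean_ln_le:
  assumes "r \<ge> 0" "continuous_on (sphere p r) \<phi>" "\<And>z. z \<in> sphere p r \<Longrightarrow> \<phi> z > 0"
    and "circle_mean p r \<phi> \<le> \<mu>" "\<mu> > 0"
  shows "circle_mean p r (\<lambda>z. ln (\<phi> z)) \<le> ln \<mu>"
proof -
  have "circle_mean p r (\<lambda>z. ln (\<phi> z)) \<le> circle_mean p r (\<lambda>z. (ln \<mu> - 1) + (1/\<mu>) * \<phi> z)"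
  proof (rule circle_mean_mono)
    fix z assume "z \<in> sphere p r"
    then have "\<phi> z > 0" using assms(3) by auto
    then have "ln (\<phi> z / \<mu>) \<le> \<phi> z / \<mu> - 1" using assms(5) by (intro ln_le_minus_one) auto
    then show "ln (\<phi> z) \<le> (ln \<mu> - 1) + (1/\<mu>) * \<phi> z"
      using \<open>\<phi> z > 0\<close> assms(5) by (simp add: ln_div)
  qed (use assms in \<open>auto intro!: continuous_intros simp: less_imp_neq[symmetric]\<close>, (metis less_irrefl assms(3) mem_sphere)?)
  also have "\<dots> = (ln \<mu> - 1) + (1/\<mu>) * circle_mean p r \<phi>"
    using assms by (subst circle_mean_add) (auto intro!: continuous_intros simp only: circle_mean_const circle_mean_cmult)
  also have "\<dots> \<le> ln \<mu>" using assms by (simp add: field_simps)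
  finally show ?thesis .
qed

section \<open>Cauchy's integral formulas as means over circles\<close>

lemma has_contour_integral_circlepath_imp_has_integral:
  assumes "(F has_contour_integral I) (circlepath 0 R)"
  shows "((\<lambda>t. F (circlepath 0 R t) * circlepath 0 R t) has_integral I / (2 * of_real pi * \<i>)) {0..1}"
proof -
  have "((\<lambda>x. F (circlepath 0 R x) * vector_derivative (circlepath 0 R) (at x within {0..1}))
      has_integral I) {0..1}"
    using assms by (simp add: has_contour_integral_def)
  then have "((\<lambda>x. F (circlepath 0 R x) * (2 * of_real pi * \<i> * circlepath 0 R x))
      has_integral I) {0..1}"
  proof (rule has_integral_eq[rotated])
    fix x :: real assume "x \<in> {0..1}"
    then have "vector_derivative (circlepath 0 R) (at x within {0..1}) = 2 * of_real pi * \<i> * circlepath 0 R x"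
      using vector_derivative_circlepath01[of x 0 R] by (simp add: circlepath mult_ac)
    then show "F (circlepath 0 R x) * vector_derivative (circlepath 0 R) (at x within {0..1})
        = F (circlepath 0 R x) * (2 * of_real pi * \<i> * circlepath 0 R x)" by simp
  qed
  then have "((\<lambda>x. (1 / (2 * of_real pi * \<i>)) * (F (circlepath 0 R x) * (2 * of_real pi * \<i> * circlepath 0 R x)))
      has_integral (1 / (2 * of_real pi * \<i>)) * I) {0..1}"
    by (rule has_integral_mult_right)
  then show ?thesis
    by (simp add: field_simps)
qed

lemma circle_mean_Re_holomorphic:
  assumes q: "q holomorphic_on ball 0 R'" and R: "0 < R" "R < R'"
  shows "circle_mean 0 R (\<lambda>z. Re (q z)) = Re (q 0)"
proof -
  have qc: "q holomorphic_on cball 0 R" by (rule holomorphic_on_subset[OF q]) (use R in auto)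
  have "((\<lambda>u. q u / (u - 0)) has_contour_integral 2 * of_real pi * \<i> * q 0) (circlepath 0 R)"
    using Cauchy_integral_circlepath[of 0 R q 0] R
      holomorphic_on_imp_continuous_on[OF qc] holomorphic_on_subset[OF qc ball_subset_cball] by simp
  from has_contour_integral_circlepath_imp_has_integral[OF this]
  have "((\<lambda>t. q (circlepath 0 R t) / circlepath 0 R t * circlepath 0 R t) has_integral q 0) {0..1}"
    by simp
  moreover have "circlepath 0 R t \<noteq> 0" for t using R by (simp add: circlepath)
  ultimately have "((\<lambda>t. q (circlepath 0 R t)) has_integral q 0) {0..1}" by simp
  then have "((\<lambda>t. Re (q (circlepath 0 R t))) has_integral Re (q 0)) {0..1}"
    by (rule has_integral_Re)
  then show ?thesis unfolding circle_mean_def by (rule integral_unique)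
qed

text \<open>The differentiated Schwarz formula: \<open>deriv q z\<close> is the mean of
  \<open>2 * Re (q \<zeta>) * \<zeta> / (\<zeta> - z)^2\<close>. Only the real part of
  \<open>q\<close> enters, which for a holomorphic logarithm is the logarithm of a modulus.\<close>

lemma norm_deriv_le_circle_mean_Re:
  assumes q: "q holomorphic_on ball 0 R'" and R: "0 < R" "R < R'" and z: "norm z < R"
  shows "norm (deriv q z) \<le> 2 * R / (R - norm z)^2 * circle_mean 0 R (\<lambda>\<zeta>. \<bar>Re (q \<zeta>)\<bar>)"
proof -
  let ?c = "circlepath 0 R"
  have qc: "q holomorphic_on cball 0 R" by (rule holomorphic_on_subset[OF q]) (use R in auto)
  have c0: "?c t \<noteq> 0" for t using R by (simp add: circlepath)
  have nc: "norm (?c t) = R" for t using R by (simp add: circlepath norm_mult)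
  have cc: "cnj (?c t) = of_real (R^2) / ?c t" for t
    using complex_norm_square[of "?c t"] c0[of t] by (simp add: nc field_simps)
  have "((\<lambda>u. q u / (u - z) ^ Suc 1) has_contour_integral
      ((2 * of_real pi * \<i>) / fact 1 * (deriv ^^ 1) q z)) (circlepath 0 R)"
    using Cauchy_has_contour_integral_higher_derivative_circlepath[of 0 R q z 1] z
      holomorphic_on_imp_continuous_on[OF qc] holomorphic_on_subset[OF qc ball_subset_cball] by simp
  from has_contour_integral_circlepath_imp_has_integral[OF this]
  have 1: "((\<lambda>t. q (?c t) / (?c t - z)^2 * ?c t) has_integral deriv q z) {0..1}"
    by (simp add: power2_eq_square)
  have nz: "of_real (R^2) - cnj z * u \<noteq> 0" if "norm u \<le> R" for u
  proof
    assume "of_real (R^2) - cnj z * u = 0"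
    then have "norm (of_real (R^2) :: complex) = norm z * norm u" by (metis eq_iff_diff_eq_0 norm_mult complex_mod_cnj)
    moreover have "norm z * norm u < R * R" using z that R
      by (metis mult_le_cancel_left_pos mult_less_cancel_right_pos norm_ge_zero order_le_less_trans order_less_le_trans mult_le_less_imp_less mult_left_mono)
    ultimately show False using R by (simp add: power2_eq_square norm_mult)
  qed
  \<comment> \<open>Holomorphic on the closed disc, as \<open>norm (cnj z * u) < R^2\<close>. On the
    circle \<open>cnj u = R^2 / u\<close>, so conjugation turns this vanishing integral into
    Cauchy's integral for the derivative with \<open>cnj (q u)\<close> in place of
    \<open>q u\<close>; adding the two leaves \<open>2 * Re (q u)\<close>.\<close>
  have "((\<lambda>u. q u * of_real (R^2) / (of_real (R^2) - cnj z * u)^2) has_contour_integral 0) (circlepath 0 R)"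
  proof (rule Cauchy_theorem_convex_simple[where S = "cball 0 R"])
    show "(\<lambda>u. q u * of_real (R^2) / (of_real (R^2) - cnj z * u)^2) holomorphic_on cball 0 R"
      using nz by (intro holomorphic_intros qc) auto
    show "path_image (circlepath 0 R) \<subseteq> cball 0 R" using R by (simp add: path_image_circlepath_nonneg)
  qed auto
  from has_contour_integral_circlepath_imp_has_integral[OF this]
  have "((\<lambda>t. q (?c t) * of_real (R^2) / (of_real (R^2) - cnj z * ?c t)^2 * ?c t) has_integral 0) {0..1}" by simp
  then have "(cnj \<circ> (\<lambda>t. q (?c t) * of_real (R^2) / (of_real (R^2) - cnj z * ?c t)^2 * ?c t) has_integral cnj 0) {0..1}"
    by (simp only: has_integral_cnj)
  then have "((\<lambda>t. cnj (q (?c t) * of_real (R^2) / (of_real (R^2) - cnj z * ?c t)^2 * ?c t)) has_integral cnj 0) {0..1}"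
    by (simp only: o_def)
  moreover have "cnj (q (?c t) * of_real (R^2) / (of_real (R^2) - cnj z * ?c t)^2 * ?c t)
     = cnj (q (?c t)) / (?c t - z)^2 * ?c t" for t
  proof -
    have ne: "?c t - z \<noteq> 0" using nc[of t] z by auto
    have "cnj (q (?c t) * of_real (R^2) / (of_real (R^2) - cnj z * ?c t)^2 * ?c t)
      = cnj (q (?c t)) * (of_real (R^2) / (of_real (R^2) - z * cnj (?c t))^2 * cnj (?c t))" by simp
    also have "of_real (R^2) / (of_real (R^2) - z * cnj (?c t))^2 * cnj (?c t) = ?c t / (?c t - z)^2"
    proof -
      have "of_real (R^2) - z * cnj (?c t) = of_real (R^2) * (?c t - z) / ?c t"
        unfolding cc using c0[of t] by (simp add: field_simps)
      moreover have "\<rho> / (\<rho> * d / c)^2 * (\<rho> / c) = c / d^2" if "\<rho> \<noteq> 0" "c \<noteq> 0" "d \<noteq> 0" for \<rho> c d :: complex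
        using that by (simp add: power2_eq_square)
      moreover have "(of_real (R^2) :: complex) \<noteq> 0" using R by simp
      ultimately show ?thesis using ne c0[of t] unfolding cc by (simp only: not_False_eq_True)
    qed
    finally show ?thesis by simp
  qed
  ultimately have 2: "((\<lambda>t. cnj (q (?c t)) / (?c t - z)^2 * ?c t) has_integral 0) {0..1}" by simp
  have "((\<lambda>t. q (?c t) / (?c t - z)^2 * ?c t + cnj (q (?c t)) / (?c t - z)^2 * ?c t) has_integral (deriv q z + 0)) {0..1}"
    by (rule has_integral_add[OF 1 2])
  moreover have "q (?c t) / (?c t - z)^2 * ?c t + cnj (q (?c t)) / (?c t - z)^2 * ?c t
     = 2 * of_real (Re (q (?c t))) * ?c t / (?c t - z)^2" for t
    using complex_add_cnj[of "q (?c t)"] by (metis (no_types, opaque_lifting) add_divide_distrib distrib_right times_divide_eq_left of_real_mult of_real_numeral)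
  ultimately have 3: "((\<lambda>t. 2 * of_real (Re (q (?c t))) * ?c t / (?c t - z)^2) has_integral deriv q z) {0..1}"
    by simp
  have cont: "continuous_on (sphere 0 R) (\<lambda>u. \<bar>Re (q u)\<bar>)"
    by (intro continuous_intros continuous_on_subset[OF holomorphic_on_imp_continuous_on[OF qc]]) auto
  have "norm (integral {0..1} (\<lambda>t. 2 * of_real (Re (q (?c t))) * ?c t / (?c t - z)^2))
     \<le> integral {0..1} (\<lambda>t. 2 * R / (R - norm z)^2 * \<bar>Re (q (?c t))\<bar>)"
  proof (rule integral_norm_bound_integral)
    show "(\<lambda>t. 2 * of_real (Re (q (?c t))) * ?c t / (?c t - z)^2) integrable_on {0..1}" using 3 by blast
    show "(\<lambda>t. 2 * R / (R - norm z)^2 * \<bar>Re (q (?c t))\<bar>) integrable_on {0..1}"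
      using circle_integrable[OF _ cont] R by (intro integrable_on_mult_right) auto
    fix t :: real assume "t \<in> {0..1}"
    have "R - norm z \<le> norm (?c t - z)" using norm_triangle_ineq2[of "?c t" z] nc by simp
    then have "(R - norm z)^2 \<le> (norm (?c t - z))^2" using z by (intro power_mono) auto
    then have "2 * \<bar>Re (q (?c t))\<bar> * R / (norm (?c t - z))^2 \<le> 2 * \<bar>Re (q (?c t))\<bar> * R / (R - norm z)^2"
      using z R by (intro divide_left_mono mult_nonneg_nonneg mult_pos_pos) (auto simp: nc intro!: zero_less_power)
    then show "norm (2 * of_real (Re (q (?c t))) * ?c t / (?c t - z)^2) \<le> 2 * R / (R - norm z)^2 * \<bar>Re (q (?c t))\<bar>"
      by (simp add: norm_mult norm_divide norm_power nc mult_ac)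
  qed
  then show ?thesis using 3 by (simp add: integral_unique circle_mean_def)
qed

section \<open>The singular means of \<open>1 / sqrt \<bar>z - a\<bar>\<close>\<close>

lemma abs_sin_ge_half:
  fixes y :: real assumes "\<bar>y\<bar> \<le> pi / 2" shows "\<bar>sin y\<bar> \<ge> \<bar>y\<bar> / 2"
proof -
  have *: "\<bar>sin y - (\<Sum>m<3. sin_coeff m * y ^ m)\<bar> \<le> inverse (fact 3) * \<bar>y\<bar> ^ 3"
    by (rule Maclaurin_sin_bound)
  have 1: "\<bar>sin y - y\<bar> \<le> \<bar>y\<bar> ^ 3 / 6"
  proof -
    have "(\<Sum>m<3. sin_coeff m * y ^ m) = y" by (simp add: eval_nat_numeral sin_coeff_def)
    moreover have "fact 3 = (6::real)" by (simp add: eval_nat_numeral)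
    ultimately show ?thesis
      using * by (simp only: divide_inverse mult.commute)
  qed
  \<comment> \<open>As \<open>1.6^2 < 3\<close>, the cubic Taylor error is at most half of
    \<open>\<bar>y\<bar>\<close>.\<close>
  have "\<bar>y\<bar> \<le> 1.6" using assms pi_less_4 pi_approx by simp
  then have "\<bar>y\<bar>^2 \<le> 1.6^2" by (intro power_mono) auto
  then have "\<bar>y\<bar>^3 \<le> \<bar>y\<bar> * 3" 
    using mult_left_mono[of "\<bar>y\<bar>^2" 3 "\<bar>y\<bar>"] by (simp add: power2_eq_square power3_eq_cube)
  then show ?thesis using 1 by linarith
qed

text \<open>The antiderivative \<open>2 * sgn (t - c) * sqrt \<bar>t - c\<bar>\<close> is continuous
  across the singularity, so the fundamental theorem applies with one exceptional point. Since
  \<open>\<bar>t - c\<bar> \<le> 5 < 9\<close>, each boundary value is at most 6.\<close>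

lemma integral_inverse_sqrt_le:
  fixes c :: real assumes "\<bar>c\<bar> \<le> 4"
  shows "(\<lambda>t. 1 / sqrt \<bar>t - c\<bar>) integrable_on {0..1}"
    and "integral {0..1} (\<lambda>t. 1 / sqrt \<bar>t - c\<bar>) \<le> 12"
proof -
  define G where "G = (\<lambda>t. 2 * sgn (t - c) * sqrt \<bar>t - c\<bar>)"
  have G: "G t = (if t \<ge> c then 2 * sqrt (t - c) else - 2 * sqrt (c - t))" for t
    by (auto simp: G_def sgn_if)
  have "((\<lambda>t. 1 / sqrt \<bar>t - c\<bar>) has_integral (G 1 - G 0)) {0..1}"
  proof (rule fundamental_theorem_of_calculus_strong[of "{c}"])
    show "continuous_on {0..1} G"
    proof -
      have "continuous_on ({c..} \<union> {..c}) G"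
        unfolding G
        by (intro continuous_on_cases) (auto intro!: continuous_intros)
      then show ?thesis by (rule continuous_on_subset) auto
    qed
    fix t assume "t \<in> {0..1} - {c}"
    then consider "t > c" | "t < c" by force
    then have "(G has_real_derivative 1 / sqrt \<bar>t - c\<bar>) (at t)"
    proof cases
      case 1
      have "((\<lambda>t. 2 * sqrt (t - c)) has_real_derivative 1 / sqrt \<bar>t - c\<bar>) (at t)"
        using 1 by (auto intro!: derivative_eq_intros simp: field_simps)
      then show ?thesis
        by (rule has_field_derivative_transform_within_open[where S="{c<..}"]) (use 1 in \<open>auto simp: G\<close>)
    next
      case 2
      have "((\<lambda>t. - 2 * sqrt (c - t)) has_real_derivative 1 / sqrt \<bar>t - c\<bar>) (at t)"
        using 2 by (auto intro!: derivative_eq_intros simp: field_simps)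
      then show ?thesis
        by (rule has_field_derivative_transform_within_open[where S="{..<c}"]) (use 2 in \<open>auto simp: G\<close>)
    qed
    then show "(G has_vector_derivative 1 / sqrt \<bar>t - c\<bar>) (at t)"
      by (simp add: has_real_derivative_iff_has_vector_derivative)
  qed auto
  moreover have "\<bar>G t\<bar> \<le> 6" if "\<bar>t\<bar> \<le> 1" for t
  proof -
    have "\<bar>G t\<bar> = 2 * sqrt \<bar>t - c\<bar> \<or> G t = 0" by (auto simp: G_def abs_mult sgn_if)
    moreover have "sqrt \<bar>t - c\<bar> \<le> 3" using that assms by (intro real_le_lsqrt) auto
    ultimately show ?thesis by auto
  qed
  from this[of 1] this[of 0] have "G 1 - G 0 \<le> 12" by auto
  ultimately show "(\<lambda>t. 1 / sqrt \<bar>t - c\<bar>) integrable_on {0..1}"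
    and "integral {0..1} (\<lambda>t. 1 / sqrt \<bar>t - c\<bar>) \<le> 12" by (auto simp: integral_unique)
qed

text \<open>The bound does not depend on \<open>a\<close>, however close \<open>a\<close> is to the
  circle. For \<open>1 / norm (z - a)\<close> this would be false, which is why the lemma on the
  logarithmic derivative works with square roots. The 60 is five singular points times 12.\<close>

lemma circle_mean_inverse_sqrt_le:
  assumes r: "r \<ge> 1" and a: "norm a \<noteq> r"
  shows "circle_mean 0 r (\<lambda>z. 1 / sqrt (norm (z - a))) \<le> 60"
proof -
  define \<phi> where "\<phi> = Arg2pi a / (2 * pi)"
  have \<phi>: "0 \<le> \<phi>" "\<phi> < 1" using Arg2pi_ge_0[of a] Arg2pi_lt_2pi[of a] by (auto simp: \<phi>_def)
  have a': "a = of_real (norm a) * exp (\<i> * of_real (2 * pi * \<phi>))"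
    using Arg2pi_eq[of a] by (simp add: \<phi>_def)
  \<comment> \<open>Rotate \<open>a\<close> onto the nonnegative real axis and drop the real
    part.\<close>
  have lb: "norm (circlepath 0 r t - a) \<ge> \<bar>sin (2 * pi * (t - \<phi>))\<bar>" for t
  proof -
    have "norm (circlepath 0 r t - a) = norm ((circlepath 0 r t - a) * exp (- \<i> * of_real (2 * pi * \<phi>)))"
      by (simp add: norm_mult)
    also have "(circlepath 0 r t - a) * exp (- \<i> * of_real (2 * pi * \<phi>))
       = of_real r * exp (\<i> * of_real (2 * pi * (t - \<phi>))) - of_real (norm a)"
    proof -
      have 1: "exp (2 * of_real pi * \<i> * of_real t) * exp (- \<i> * of_real (2 * pi * \<phi>)) = exp (\<i> * of_real (2 * pi * (t - \<phi>)))"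
        unfolding exp_add[symmetric] by (simp add: algebra_simps)
      have "a * exp (- \<i> * of_real (2 * pi * \<phi>)) = of_real (norm a) * (exp (\<i> * of_real (2 * pi * \<phi>)) * exp (- (\<i> * of_real (2 * pi * \<phi>))))"
        unfolding mult.assoc[symmetric] a'[symmetric] by simp
      then have 2: "a * exp (- \<i> * of_real (2 * pi * \<phi>)) = of_real (norm a)"
        by (simp add: exp_minus_inverse)
      show ?thesis unfolding left_diff_distrib 2 circlepath 1[symmetric] by simp
    qed
    also have "norm \<dots> \<ge> \<bar>Im (of_real r * exp (\<i> * of_real (2 * pi * (t - \<phi>))) - of_real (norm a))\<bar>"
      by (rule abs_Im_le_cmod)
    also have "Im (of_real r * exp (\<i> * of_real (2 * pi * (t - \<phi>))) - of_real (norm a)) = r * sin (2 * pi * (t - \<phi>))"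
      by (simp add: Im_exp)
    finally show ?thesis using r mult_right_mono[of 1 r "\<bar>sin (2 * pi * (t - \<phi>))\<bar>"] by (simp add: abs_mult)
  qed
  \<comment> \<open>The sine vanishes at \<open>t = \<phi> + k / 2\<close>. As
    \<open>t - \<phi>\<close> lies between -1 and 1, the nearest of these points has
    \<open>\<bar>k\<bar> \<le> 2\<close>.\<close>
  define K where "K = {-2..2::int}"
  have exk: "\<exists>k\<in>K. norm (circlepath 0 r t - a) \<ge> \<bar>t - (\<phi> + of_int k / 2)\<bar>" if "t \<in> {0..1}" for t
  proof -
    define k where "k = round (2 * (t - \<phi>))"
    have k1: "\<bar>2 * (t - \<phi>) - of_int k\<bar> \<le> 1/2"
      unfolding k_def using of_int_round_abs_le[of "2 * (t - \<phi>)"] by (simp only: abs_minus_commute)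
    have "\<bar>of_int k\<bar> \<le> (2 + 1/2 :: real)" 
    proof -
      have "of_int k \<le> 2 * (t - \<phi>) + 1 / 2" "of_int k \<ge> 2 * (t - \<phi>) - 1 / 2" using k1 by (simp_all only: abs_le_iff) linarith+
      moreover have "t \<le> 1" "t \<ge> 0" using that by auto
      ultimately have "2 * (t - \<phi>) \<le> 2" "2 * (t - \<phi>) \<ge> -2" "of_int k \<le> 2 * (t - \<phi>) + 1 / 2" "of_int k \<ge> 2 * (t - \<phi>) - 1 / 2"
        using \<phi> by auto
      then show ?thesis by (intro abs_leI) auto
    qed
    then have "k < 3" "k > -3" by linarith+
    then have "k \<in> K" unfolding K_def by auto
    have e: "2 * pi * (t - \<phi>) = pi * (2 * (t - \<phi>) - of_int k) + of_int k * pi" by (simp add: algebra_simps)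
    have "\<bar>sin (2 * pi * (t - \<phi>))\<bar> = \<bar>sin (pi * (2 * (t - \<phi>) - of_int k))\<bar>"
    proof -
      have "sin (of_int k * pi) = 0" using sin_zero_iff_int2 by blast
      moreover from this have "\<bar>cos (of_int k * pi)\<bar> = 1" by (rule sin_zero_abs_cos_one)
      ultimately show ?thesis unfolding e sin_add by (simp only: abs_mult mult_zero_right add_0_right mult_1_right)
    qed
    also have "\<dots> \<ge> \<bar>pi * (2 * (t - \<phi>) - of_int k)\<bar> / 2"
      using k1 by (intro abs_sin_ge_half) (simp add: abs_mult)
    also have "\<bar>pi * (2 * (t - \<phi>) - of_int k)\<bar> / 2 = pi * \<bar>t - (\<phi> + of_int k / 2)\<bar>"
    proof -
      have "2 * (t - \<phi>) - of_int k = 2 * (t - (\<phi> + of_int k / 2))" by simp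
      then have "\<bar>pi * (2 * (t - \<phi>) - of_int k)\<bar> = pi * (2 * \<bar>t - (\<phi> + of_int k / 2)\<bar>)"
        by (simp only: abs_mult) (simp only: abs_numeral abs_of_pos[OF pi_gt_zero])
      then show ?thesis by (simp only: mult.left_commute[of pi 2])
    qed
    also have "\<dots> \<ge> 1 * \<bar>t - (\<phi> + of_int k / 2)\<bar>" using pi_gt3 by (intro mult_right_mono) auto
    finally have "\<bar>t - (\<phi> + of_int k / 2)\<bar> \<le> norm (circlepath 0 r t - a)" using lb[of t] by simp
    then show ?thesis using \<open>k \<in> K\<close> by blast
  qed
  define Z where "Z = (\<lambda>k. \<phi> + of_int k / 2) ` K"
  define B where "B = (\<lambda>t. \<Sum>k\<in>K. 1 / sqrt \<bar>t - (\<phi> + of_int k / 2)\<bar>)"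
  \<comment> \<open>On the finite set \<open>Z\<close> a summand of \<open>B\<close> is
    \<open>1 / sqrt 0 = 0\<close>, so that \<open>B\<close> may fail to be a majorant there. Setting
    the integrand to 0 on \<open>Z\<close> does not change the integral.\<close>
  define f where "f = (\<lambda>t. if t \<in> Z then 0 else 1 / sqrt (norm (circlepath 0 r t - a)))"
  have cont: "continuous_on (sphere 0 r) (\<lambda>z. 1 / sqrt (norm (z - a)))"
    using a by (auto intro!: continuous_intros)
  have int1: "(\<lambda>t. 1 / sqrt (norm (circlepath 0 r t - a))) integrable_on {0..1}"
    using circle_integrable[OF _ cont] r by auto
  have finZ: "finite Z" by (auto simp: Z_def K_def)
  have f_int: "f integrable_on {0..1}"
    by (rule integrable_spike_finite[OF finZ _ int1]) (auto simp: f_def)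
  have kb: "\<bar>\<phi> + of_int k / 2\<bar> \<le> 4" if "k \<in> K" for k
  proof -
    have "of_int k \<le> (2::real)" "of_int k \<ge> (-2::real)" using that by (auto simp: K_def)
    then show ?thesis using \<phi> by linarith
  qed
  have "circle_mean 0 r (\<lambda>z. 1 / sqrt (norm (z - a))) = integral {0..1} f"
    unfolding circle_mean_def by (rule integral_spike[where S = Z]) (auto simp: f_def finZ intro!: negligible_finite)
  also have "\<dots> \<le> integral {0..1} B"
  proof (rule integral_le[OF f_int])
    show "B integrable_on {0..1}" unfolding B_def
      by (intro integrable_sum integral_inverse_sqrt_le kb) (auto simp: K_def)
    fix t :: real assume t: "t \<in> {0..1}"
    show "f t \<le> B t"
    proof (cases "t \<in> Z")
      case True then show ?thesis by (simp add: f_def B_def sum_nonneg)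
    next
      case False
      from exk[OF t] obtain k where k: "k \<in> K" "norm (circlepath 0 r t - a) \<ge> \<bar>t - (\<phi> + of_int k / 2)\<bar>" by auto
      have "t - (\<phi> + of_int k / 2) \<noteq> 0" using False k by (auto simp: Z_def)
      then have "1 / sqrt (norm (circlepath 0 r t - a)) \<le> 1 / sqrt \<bar>t - (\<phi> + of_int k / 2)\<bar>"
        using k by (intro divide_left_mono mult_pos_pos) auto
      also have "\<dots> \<le> B t" unfolding B_def by (rule member_le_sum) (use k in \<open>auto simp: K_def\<close>)
      finally show ?thesis using False by (simp add: f_def)
    qed
  qed
  also have "integral {0..1} B = (\<Sum>k\<in>K. integral {0..1} (\<lambda>t. 1 / sqrt \<bar>t - (\<phi> + of_int k / 2)\<bar>))"
    unfolding B_def by (intro integral_sum integral_inverse_sqrt_le kb) (auto simp: K_def)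
  also have "\<dots> \<le> (\<Sum>k\<in>K. 12)"
    by (intro sum_mono integral_inverse_sqrt_le kb)
  also have "\<dots> = 60" by (simp add: K_def)
  finally show ?thesis .
qed

section \<open>Jensen's formula\<close>

lemma entire_order_factorization:
  assumes u: "u holomorphic_on UNIV" and nz: "u w \<noteq> 0"
  obtains m g where "g holomorphic_on UNIV" "\<And>z. u z = (z - z0) ^ m * g z" "g z0 \<noteq> 0"
    "m = nat (zorder u z0)"
proof -
  define n where "n = zorder u z0"
  have "(if u z0 = 0 then 0 < zorder u z0 else zorder u z0 = 0) \<and>
      (\<exists>r>0. cball z0 r \<subseteq> UNIV \<and> zor_poly u z0 holomorphic_on cball z0 r \<and>
        (\<forall>w\<in>cball z0 r. u w = zor_poly u z0 w * (w - z0) ^ nat (zorder u z0) \<and> zor_poly u z0 w \<noteq> 0))"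
    by (rule zorder_exist_zero) (use u nz in auto)
  then obtain r where r: "r > 0" "zor_poly u z0 holomorphic_on cball z0 r"
      "\<And>w. w \<in> cball z0 r \<Longrightarrow> u w = zor_poly u z0 w * (w - z0) ^ nat n"
      "\<And>w. w \<in> cball z0 r \<Longrightarrow> zor_poly u z0 w \<noteq> 0"
    unfolding n_def by blast
  \<comment> \<open>The local cofactor near \<open>z0\<close> and the quotient elsewhere agree on
    the overlap, which makes \<open>g\<close> entire.\<close>
  define g where "g = (\<lambda>z. if z \<in> ball z0 r then zor_poly u z0 z else u z / (z - z0) ^ nat n)"
  have eq: "g z = u z / (z - z0) ^ nat n" if "z \<noteq> z0" for z
    using r(3)[of z] that by (simp add: g_def)
  have "g holomorphic_on (ball z0 r \<union> - {z0})"
  proof (rule holomorphic_on_Un)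
    show "g holomorphic_on ball z0 r"
      by (rule holomorphic_transform[OF holomorphic_on_subset[OF r(2) ball_subset_cball]])
        (simp add: g_def)
    have "(\<lambda>z. u z / (z - z0) ^ nat n) holomorphic_on - {z0}"
      by (intro holomorphic_intros holomorphic_on_subset[OF u]) auto
    then show "g holomorphic_on - {z0}"
      by (rule holomorphic_transform) (use eq in \<open>metis ComplD singletonI\<close>)
  qed auto
  moreover have "ball z0 r \<union> - {z0} = UNIV" using r by auto
  ultimately have "g holomorphic_on UNIV" by simp
  moreover have "u z = (z - z0) ^ nat n * g z" for z
    using eq[of z] r(1) r(3)[of z] by (cases "z = z0") (simp_all add: g_def)
  moreover have "g z0 \<noteq> 0" using r(1) r(4)[of z0] by (simp add: g_def)
  ultimately show ?thesis using that unfolding n_def by blast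
qed

lemma entire_finite_zeros:
  assumes u: "u holomorphic_on UNIV" and nz: "u w \<noteq> 0" and K: "compact K"
  shows "finite {z \<in> K. u z = 0}"
proof (rule ccontr)
  assume "infinite {z \<in> K. u z = 0}"
  then obtain x where "x islimpt {z \<in> K. u z = 0}"
    using K by (metis (no_types, lifting) compact_eq_Bolzano_Weierstrass mem_Collect_eq subsetI)
  then have "u w = 0"
    using analytic_continuation[OF u open_UNIV connected_UNIV subset_UNIV UNIV_I _ _ UNIV_I, of x "{z \<in> K. u z = 0}" w] by blast
  then show False using nz by simp
qed

text \<open>A compact set contains finitely many zeros, which are divided out one after another; the
  list \<open>as\<close> repeats a zero according to its multiplicity.\<close>

lemma entire_factor_zeros:
  assumes u: "u holomorphic_on UNIV" and nz: "u w \<noteq> 0" and K: "compact K"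
  obtains as h where "h holomorphic_on UNIV" "\<And>z. u z = (\<Prod>a\<leftarrow>as. z - a) * h z"
    "\<And>a. a \<in> set as \<Longrightarrow> a \<in> K \<and> u a = 0" "\<And>z. z \<in> K \<Longrightarrow> h z \<noteq> 0"
proof -
  have "\<exists>as h. h holomorphic_on UNIV \<and> (\<forall>z. u z = (\<Prod>a\<leftarrow>as. z - a) * h z) \<and> set as \<subseteq> Z \<and> (\<forall>z\<in>Z. h z \<noteq> 0)"
    if "finite Z" "Z \<subseteq> {z \<in> K. u z = 0}" for Z
    using that
  proof (induction Z rule: finite_induct)
    case empty
    then show ?case using u by (intro exI[of _ "[]"] exI[of _ u]) auto
  next
    case (insert z1 Z)
    then obtain as h where h: "h holomorphic_on UNIV" "\<And>z. u z = (\<Prod>a\<leftarrow>as. z - a) * h z" "set as \<subseteq> Z" "\<forall>z\<in>Z. h z \<noteq> 0"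
      by auto
    have "h w \<noteq> 0" using h(2)[of w] nz by auto
    then obtain m g where g: "g holomorphic_on UNIV" "\<And>z. h z = (z - z1) ^ m * g z" "g z1 \<noteq> 0"
      using entire_order_factorization[OF h(1)] by metis
    have "u z = (\<Prod>a\<leftarrow>as @ replicate m z1. z - a) * g z" for z
      using h(2)[of z] g(2)[of z] by simp
    moreover have "set (as @ replicate m z1) \<subseteq> insert z1 Z" using h(3) by auto
    moreover have "\<forall>z\<in>insert z1 Z. g z \<noteq> 0" using g h(4) by auto
    ultimately show ?case using g(1) by blast
  qed
  from this[OF entire_finite_zeros[OF u nz K]] obtain as h where
    h: "h holomorphic_on UNIV" "\<And>z. u z = (\<Prod>a\<leftarrow>as. z - a) * h z" "set as \<subseteq> {z \<in> K. u z = 0}"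
      "\<forall>z\<in>{z \<in> K. u z = 0}. h z \<noteq> 0" by blast
  show ?thesis
  proof (rule that[OF h(1,2)])
    show "a \<in> K \<and> u a = 0" if "a \<in> set as" for a using h(3) that by blast
    show "h z \<noteq> 0" if "z \<in> K" for z
      using h(4) that h(2)[of z] by (cases "u z = 0") auto
  qed
qed

section \<open>Logarithmic derivatives and holomorphic logarithms\<close>

definition logderiv :: "(complex \<Rightarrow> complex) \<Rightarrow> complex \<Rightarrow> complex" where
  "logderiv u z = deriv u z / u z"

lemma logderiv_cong:
  "eventually (\<lambda>w. u w = v w) (nhds z) \<Longrightarrow> logderiv u z = logderiv v z"
  unfolding logderiv_def using deriv_cong_ev[of u v z z] eventually_nhds_x_imp_x by fastforce

lemma logderiv_mult:
  assumes "u field_differentiable (at z)" "v field_differentiable (at z)" "u z \<noteq> 0" "v z \<noteq> 0"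
  shows "logderiv (\<lambda>z. u z * v z) z = logderiv u z + logderiv v z"
  using assms by (simp add: logderiv_def field_simps)

lemma logderiv_prod_list:
  assumes "\<And>a. a \<in> set as \<Longrightarrow> u a field_differentiable (at z)" "\<And>a. a \<in> set as \<Longrightarrow> u a z \<noteq> 0"
  shows "(\<lambda>z. \<Prod>a\<leftarrow>as. u a z) field_differentiable (at z)"
    "logderiv (\<lambda>z. \<Prod>a\<leftarrow>as. u a z) z = (\<Sum>a\<leftarrow>as. logderiv (u a) z)"
proof -
  have "(\<lambda>z. \<Prod>a\<leftarrow>as. u a z) field_differentiable (at z) \<and>
    logderiv (\<lambda>z. \<Prod>a\<leftarrow>as. u a z) z = (\<Sum>a\<leftarrow>as. logderiv (u a) z)"
    using assms
  proof (induction as)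
    case Nil
    then show ?case by (simp add: logderiv_def)
  next
    case (Cons a as)
    have "(\<Prod>a\<leftarrow>as. u a z) \<noteq> 0" using Cons.prems by (force simp: prod_list_zero_iff)
    moreover have "(\<lambda>z. \<Prod>a\<leftarrow>as. u a z) field_differentiable (at z)"
      "logderiv (\<lambda>z. \<Prod>a\<leftarrow>as. u a z) z = (\<Sum>a\<leftarrow>as. logderiv (u a) z)" using Cons by auto
    moreover have "u a field_differentiable (at z)" "u a z \<noteq> 0" using Cons.prems by auto
    ultimately show ?case
      by (simp add: logderiv_mult field_differentiable_mult)
  qed
  then show "(\<lambda>z. \<Prod>a\<leftarrow>as. u a z) field_differentiable (at z)"
    "logderiv (\<lambda>z. \<Prod>a\<leftarrow>as. u a z) z = (\<Sum>a\<leftarrow>as. logderiv (u a) z)" by auto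
qed

text \<open>By compactness the zero-free closed disc extends to a zero-free larger ball. The
  logarithm is thus holomorphic across the circle, as Cauchy's formula on it requires.\<close>

lemma entire_log_on_disc:
  assumes H: "H holomorphic_on UNIV" and nz: "\<And>z. z \<in> cball 0 R \<Longrightarrow> H z \<noteq> 0" and R: "R > 0"
  obtains q R' where "R' > R" "q holomorphic_on ball 0 R'" "\<And>z. z \<in> ball 0 R' \<Longrightarrow> H z = exp (q z)"
proof -
  have op: "open {z. H z \<noteq> 0}"
    by (intro open_Collect_neq holomorphic_on_imp_continuous_on H continuous_intros)
  have "cball 0 R \<subseteq> {z. H z \<noteq> 0}" using nz by auto
  then obtain e where e: "e > 0" "(\<Union>x\<in>cball 0 R. ball x e) \<subseteq> {z. H z \<noteq> 0}"
    using compact_subset_open_imp_ball_epsilon_subset[OF compact_cball op] by metis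
  have sub: "ball 0 (R + e/2) \<subseteq> {z. H z \<noteq> 0}"
  proof
    fix z :: complex assume z: "z \<in> ball 0 (R + e/2)"
    show "z \<in> {z. H z \<noteq> 0}"
    proof (cases "norm z \<le> R")
      case True then show ?thesis using nz by auto
    next
      case False
      \<comment> \<open>Radial projection of \<open>z\<close> to the circle of radius
        \<open>R\<close>.\<close>
      define x where "x = of_real (R / norm z) * z"
      have "z - x = of_real (1 - R / norm z) * z" by (simp add: x_def algebra_simps)
      then have "norm (z - x) = \<bar>1 - R / norm z\<bar> * norm z" by (simp only: norm_mult norm_of_real)
      also have "\<dots> = norm z - R"
      proof -
        have "R / norm z < 1" "norm z > 0" using False R by (auto simp: divide_less_eq)
        then show ?thesis by (simp add: field_simps)
      qed
      finally have "dist x z < e" using z e by (simp add: dist_norm norm_minus_commute)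
      moreover have "x \<in> cball 0 R" using False R by (auto simp: x_def norm_mult norm_divide)
      ultimately have "z \<in> (\<Union>x\<in>cball 0 R. ball x e)" unfolding UN_iff mem_ball by blast
      then show ?thesis using e(2) by blast
    qed
  qed
  obtain q where "q holomorphic_on ball 0 (R + e/2)" "\<And>z. z \<in> ball 0 (R + e/2) \<Longrightarrow> H z = exp (q z)"
    by (rule contractible_imp_holomorphic_log[of H "ball 0 (R + e/2)"])
      (use sub H in \<open>auto intro: holomorphic_on_subset convex_imp_contractible\<close>)
  then show ?thesis using that[of "R + e/2" q] e by auto
qed

lemma circle_mean_ln_nonvanishing:
  assumes H: "H holomorphic_on UNIV" and nz: "\<And>z. z \<in> cball 0 R \<Longrightarrow> H z \<noteq> 0" and R: "R > 0"
  shows "circle_mean 0 R (\<lambda>z. ln (norm (H z))) = ln (norm (H 0))"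
proof -
  obtain q R' where q: "R' > R" "q holomorphic_on ball 0 R'" "\<And>z. z \<in> ball 0 R' \<Longrightarrow> H z = exp (q z)"
    using entire_log_on_disc[OF assms] by blast
  have "circle_mean 0 R (\<lambda>z. ln (norm (H z))) = circle_mean 0 R (\<lambda>z. Re (q z))"
    using R q by (intro circle_mean_cong) auto
  also have "\<dots> = Re (q 0)" using circle_mean_Re_holomorphic[OF q(2) R q(1)] .
  finally show ?thesis using q R by auto
qed

text \<open>The factors $(R^2-\overline a z)/R$ have modulus \<open>\<bar>z - a\<bar>\<close> on the circle \<open>\<bar>z\<bar> = R\<close>, so
  replacing every zero \<open>a\<close> by such a factor removes the zeros without changing the modulus there.\<close>

definition reflected_factor :: "real \<Rightarrow> complex \<Rightarrow> complex \<Rightarrow> complex" where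
  "reflected_factor R a z = (of_real (R^2) - cnj a * z) / of_real R"

lemma reflected_factor_norm:
  assumes "norm z = R" "R > 0"
  shows "norm (reflected_factor R a z) = norm (z - a)"
proof -
  have "of_real (R^2) - cnj a * z = z * cnj (z - a)"
    using assms complex_norm_square[of z] by (simp add: algebra_simps)
  then have "norm (of_real (R^2) - cnj a * z) = R * norm (z - a)"
    using assms by (simp only: norm_mult complex_mod_cnj)
  then show ?thesis using assms by (simp only: reflected_factor_def norm_divide norm_of_real) simp
qed

lemma reflected_factor_nonzero:
  assumes "norm z \<le> R" "norm a < R"
  shows "reflected_factor R a z \<noteq> 0"
proof
  assume "reflected_factor R a z = 0"
  moreover have R: "R > 0" using assms norm_ge_zero[of a] by linarith
  ultimately have "of_real (R^2) = cnj a * z" by (simp add: reflected_factor_def)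
  then have "norm (of_real (R^2) :: complex) = norm a * norm z" by (metis norm_mult complex_mod_cnj)
  moreover have "norm a * norm z \<le> norm a * R" using assms by (intro mult_left_mono) auto
  moreover have "norm a * R < R * R" using assms R by simp
  ultimately show False using R by (simp add: power2_eq_square norm_mult)
qed

lemma reflected_factor_holomorphic: "reflected_factor R a holomorphic_on A"
  unfolding reflected_factor_def by (cases "R = 0") (auto intro!: holomorphic_intros)

text \<open>The zero of the reflected factor, if there is one, lies outside the circle of radius
  \<open>R\<close>, hence at distance at least \<open>R - r\<close> from \<open>z\<close>.\<close>

lemma norm_logderiv_reflected_factor_le:
  assumes "norm z \<le> r" "r < R" "norm a < R"
  shows "norm (logderiv (reflected_factor R a) z) \<le> 1 / (R - r)"
proof -
  have r: "0 \<le> r" using assms norm_ge_zero[of z] by linarith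
  then have R: "R > 0" using assms by linarith
  have "(reflected_factor R a has_field_derivative (- cnj a / of_real R)) (at z)"
    unfolding reflected_factor_def using R by (auto intro!: derivative_eq_intros)
  then have "logderiv (reflected_factor R a) z = - cnj a / (of_real (R^2) - cnj a * z)"
    using R by (simp add: logderiv_def DERIV_imp_deriv reflected_factor_def)
  moreover have "norm (of_real (R^2) - cnj a * z) \<ge> R * (R - r)"
  proof -
    have "norm a * norm z \<le> R * r" using assms r by (intro mult_mono) auto
    moreover have "norm (of_real (R^2) :: complex) = R^2" by (simp only: norm_of_real) simp
    ultimately show ?thesis
      using norm_triangle_ineq2[of "of_real (R^2)" "cnj a * z"] by (simp only: norm_mult complex_mod_cnj) (simp add: algebra_simps power2_eq_square)
  qed
  moreover have "0 < R * (R - r)" using R assms by simp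
  ultimately have "norm (logderiv (reflected_factor R a) z) \<le> R / (R * (R - r))"
    using assms by (simp only: norm_divide norm_minus_cancel complex_mod_cnj) (intro frac_le; use R in simp)
  then show ?thesis using R by simp
qed

lemma prod_list_holomorphic:
  "(\<And>a. a \<in> set as \<Longrightarrow> u a holomorphic_on A) \<Longrightarrow> (\<lambda>z. \<Prod>a\<leftarrow>as. u a z) holomorphic_on A"
  by (induction as) (auto intro!: holomorphic_intros)

lemma norm_prod_list: "norm (\<Prod>a\<leftarrow>as. f a :: complex) = (\<Prod>a\<leftarrow>as. norm (f a))"
  by (induction as) (auto simp: norm_mult)

lemma ln_prod_list:
  "(\<And>a. a \<in> set as \<Longrightarrow> f a > 0) \<Longrightarrow> ln (\<Prod>a\<leftarrow>as. f a :: real) = (\<Sum>a\<leftarrow>as. ln (f a))"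
proof (induction as)
  case (Cons a as)
  have "(\<Prod>a\<leftarrow>as. f a) > 0" using Cons.prems(1)[OF list.set_intros(2)] by (induction as) auto
  then show ?case using Cons by (simp add: ln_mult_pos)
qed auto

text \<open>The reflected product \<open>H\<close> has the modulus of \<open>u\<close> on the circle
  and no zeros in the disc, so the mean is \<open>ln (norm (H 0))\<close>. At 0 a reflected factor
  equals \<open>R\<close>, whereas the factor \<open>z - a\<close> that it replaces has modulus
  \<open>norm a\<close>.\<close>

lemma jensen_formula:
  assumes h: "h holomorphic_on UNIV" "\<And>z. z \<in> cball 0 R \<Longrightarrow> h z \<noteq> 0"
    and as: "\<And>a. a \<in> set as \<Longrightarrow> 0 < norm a \<and> norm a < R" and R: "R > 0"
    and u: "\<And>z. u z = (\<Prod>a\<leftarrow>as. z - a) * h z"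
  shows "circle_mean 0 R (\<lambda>z. ln (norm (u z))) = ln (norm (u 0)) + (\<Sum>a\<leftarrow>as. ln (R / norm a))"
proof -
  define H where "H = (\<lambda>z. (\<Prod>a\<leftarrow>as. reflected_factor R a z) * h z)"
  have H: "H holomorphic_on UNIV" unfolding H_def
    by (intro holomorphic_intros prod_list_holomorphic reflected_factor_holomorphic h)
  have Hnz: "H z \<noteq> 0" if "z \<in> cball 0 R" for z
    using h(2)[OF that] that as by (auto simp: H_def prod_list_zero_iff reflected_factor_nonzero)
  have "norm (u z) = norm (H z)" if "z \<in> sphere 0 R" for z
  proof -
    have "(\<Prod>a\<leftarrow>as. norm (z - a)) = (\<Prod>a\<leftarrow>as. norm (reflected_factor R a z))"
      using that R by (intro arg_cong[where f = prod_list] map_cong) (auto simp: reflected_factor_norm)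
    then show ?thesis by (simp add: u H_def norm_mult norm_prod_list)
  qed
  then have "circle_mean 0 R (\<lambda>z. ln (norm (u z))) = circle_mean 0 R (\<lambda>z. ln (norm (H z)))"
    using R by (intro circle_mean_cong) auto
  also have "\<dots> = ln (norm (H 0))" by (rule circle_mean_ln_nonvanishing[OF H Hnz R])
  also have "norm (H 0) = norm (u 0) * (\<Prod>a\<leftarrow>as. R / norm a)"
  proof -
    have "(\<Prod>a\<leftarrow>as. norm (reflected_factor R a 0)) = (\<Prod>a\<leftarrow>as. norm (0 - a)) * (\<Prod>a\<leftarrow>as. R / norm a)"
      using as by (induction as) (use R in \<open>auto simp: reflected_factor_def norm_divide norm_mult power2_eq_square\<close>)
    then show ?thesis by (simp add: u H_def norm_mult norm_prod_list mult_ac)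
  qed
  also have "ln \<dots> = ln (norm (u 0)) + ln (\<Prod>a\<leftarrow>as. R / norm a)"
  proof (rule ln_mult_pos)
    have "(\<Prod>a\<leftarrow>as. 0 - a) \<noteq> 0" using as by (force simp: prod_list_zero_iff)
    then show "norm (u 0) > 0" unfolding u using h(2)[of 0] R by (simp only: mult_eq_0_iff zero_less_norm_iff) auto
    show "(\<Prod>a\<leftarrow>as. R / norm a) > 0" using as R by (induction as) auto
  qed
  also have "ln (\<Prod>a\<leftarrow>as. R / norm a) = (\<Sum>a\<leftarrow>as. ln (R / norm a))"
    by (rule ln_prod_list) (use as R in auto)
  finally show ?thesis .
qed

lemma entire_disc_factorization:
  assumes u: "u holomorphic_on UNIV" and u0: "u 0 \<noteq> 0" and R: "R > 0"
    and nz: "\<And>z. z \<in> sphere 0 R \<Longrightarrow> u z \<noteq> 0"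
  obtains as h where "h holomorphic_on UNIV" "\<And>z. u z = (\<Prod>a\<leftarrow>as. z - a) * h z"
    "\<And>a. a \<in> set as \<Longrightarrow> 0 < norm a \<and> norm a < R \<and> u a = 0" "\<And>z. z \<in> cball 0 R \<Longrightarrow> h z \<noteq> 0"
proof -
  obtain h as where h: "h holomorphic_on UNIV" "\<And>z. u z = (\<Prod>a\<leftarrow>as. z - a) * h z"
    "\<And>a. a \<in> set as \<Longrightarrow> a \<in> cball 0 R \<and> u a = 0" "\<And>z. z \<in> cball 0 R \<Longrightarrow> h z \<noteq> 0"
    by (rule entire_factor_zeros[OF u u0 compact_cball, of 0 R], rule that)
  have "0 < norm a \<and> norm a < R \<and> u a = 0" if "a \<in> set as" for a
    using h(3)[OF that] u0 nz[of a] by (cases "a = 0"; cases "norm a = R") auto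
  then show ?thesis by (rule that[OF h(1,2) _ h(4)])
qed

lemma sum_list_map_nonneg: "(\<And>x. x \<in> set xs \<Longrightarrow> f x \<ge> (0::real)) \<Longrightarrow> (\<Sum>x\<leftarrow>xs. f x) \<ge> 0"
  by (induction xs) auto

lemma member_le_sum_list_map:
  "(\<And>x. x \<in> set xs \<Longrightarrow> f x \<ge> (0::real)) \<Longrightarrow> y \<in> set xs \<Longrightarrow> f y \<le> (\<Sum>x\<leftarrow>xs. f x)"
proof (induction xs)
  case (Cons a xs)
  then show ?case using sum_list_map_nonneg[of xs f] by force
qed auto

text \<open>Every zero in the disc contributes a nonnegative term to Jensen's formula. Keeping none
  of them gives the first bound, keeping that of \<open>w\<close> the second.\<close>

lemma ln_le_circle_mean:
  assumes u: "u holomorphic_on UNIV" and u0: "u 0 \<noteq> 0" and R: "R > 0"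
    and nz: "\<And>z. z \<in> sphere 0 R \<Longrightarrow> u z \<noteq> 0"
  shows "ln (norm (u 0)) \<le> circle_mean 0 R (\<lambda>z. ln (norm (u z)))"
    and "u w = 0 \<Longrightarrow> norm w < R \<Longrightarrow> ln (norm (u 0)) + ln (R / norm w) \<le> circle_mean 0 R (\<lambda>z. ln (norm (u z)))"
proof -
  obtain h as where h: "h holomorphic_on UNIV" "\<And>z. u z = (\<Prod>a\<leftarrow>as. z - a) * h z"
    "\<And>a. a \<in> set as \<Longrightarrow> 0 < norm a \<and> norm a < R \<and> u a = 0" "\<And>z. z \<in> cball 0 R \<Longrightarrow> h z \<noteq> 0"
    by (rule entire_disc_factorization[OF assms], assumption, rule that)
  have eq: "circle_mean 0 R (\<lambda>z. ln (norm (u z))) = ln (norm (u 0)) + (\<Sum>a\<leftarrow>as. ln (R / norm a))"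
    by (rule jensen_formula[OF h(1,4) _ R h(2)]) (use h(3) in auto)
  have pos: "ln (R / norm a) \<ge> 0" if "a \<in> set as" for a
    using h(3)[OF that] R by (intro ln_ge_zero) (auto simp: le_divide_eq)
  show "ln (norm (u 0)) \<le> circle_mean 0 R (\<lambda>z. ln (norm (u z)))"
    unfolding eq using sum_list_map_nonneg[of as "\<lambda>a. ln (R / norm a)"] pos by auto
  assume w: "u w = 0" "norm w < R"
  then have "(\<Prod>a\<leftarrow>as. w - a) = 0" using h(2)[of w] h(4)[of w] by auto
  then have "w \<in> set as" by (auto simp: prod_list_zero_iff)
  then show "ln (norm (u 0)) + ln (R / norm w) \<le> circle_mean 0 R (\<lambda>z. ln (norm (u z)))"
    unfolding eq using member_le_sum_list_map[of as "\<lambda>a. ln (R / norm a)" w] pos by auto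
qed

text \<open>The listed zeros are reflected in the larger circle, and each then contributes at least
  \<open>ln (R2 / R)\<close>. The cofactor \<open>h\<close> may still vanish in the larger disc, so
  for \<open>H\<close> only the inequality form of Jensen's formula is available.\<close>

lemma number_of_zeros_le:
  assumes h: "h holomorphic_on UNIV"
    and as: "\<And>a. a \<in> set as \<Longrightarrow> 0 < norm a \<and> norm a < R" and R: "0 < R" "R < R2"
    and u: "\<And>z. u z = (\<Prod>a\<leftarrow>as. z - a) * h z" and u0: "u 0 \<noteq> 0"
    and nz: "\<And>z. z \<in> sphere 0 R2 \<Longrightarrow> u z \<noteq> 0"
  shows "real (length as) * ln (R2 / R) \<le> circle_mean 0 R2 (\<lambda>z. ln (norm (u z))) - ln (norm (u 0))"
proof -
  define H where "H = (\<lambda>z. (\<Prod>a\<leftarrow>as. reflected_factor R2 a z) * h z)"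
  have H: "H holomorphic_on UNIV" unfolding H_def
    by (intro holomorphic_intros prod_list_holomorphic reflected_factor_holomorphic h)
  have eq: "norm (u z) = norm (H z)" if "z \<in> sphere 0 R2" for z
  proof -
    have "(\<Prod>a\<leftarrow>as. norm (z - a)) = (\<Prod>a\<leftarrow>as. norm (reflected_factor R2 a z))"
      using that R by (intro arg_cong[where f = prod_list] map_cong) (auto simp: reflected_factor_norm)
    then show ?thesis by (simp add: u H_def norm_mult norm_prod_list)
  qed
  have n0: "norm (H 0) = norm (u 0) * (\<Prod>a\<leftarrow>as. R2 / norm a)"
  proof -
    have "(\<Prod>a\<leftarrow>as. norm (reflected_factor R2 a 0)) = (\<Prod>a\<leftarrow>as. norm (0 - a)) * (\<Prod>a\<leftarrow>as. R2 / norm a)"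
      using as by (induction as) (use R in \<open>auto simp: reflected_factor_def norm_divide norm_mult power2_eq_square\<close>)
    then show ?thesis by (simp add: u H_def norm_mult norm_prod_list mult_ac)
  qed
  have pos: "(\<Prod>a\<leftarrow>as. R2 / norm a) > 0" using as R by (induction as) auto
  have "real (length as) * ln (R2 / R) = (\<Sum>a\<leftarrow>as. ln (R2 / R))" by (simp add: sum_list_triv)
  also have "\<dots> \<le> (\<Sum>a\<leftarrow>as. ln (R2 / norm a))"
  proof (rule sum_list_mono)
    fix a assume "a \<in> set as"
    then have "0 < norm a" "norm a < R" using as by auto
    then have "R2 / R \<le> R2 / norm a" "R2 / R > 0" using R by (auto intro!: divide_left_mono)
    then show "ln (R2 / R) \<le> ln (R2 / norm a)" by (subst ln_le_cancel_iff) auto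
  qed
  also have "\<dots> = ln (\<Prod>a\<leftarrow>as. R2 / norm a)"
    by (rule ln_prod_list[symmetric]) (use as R in auto)
  also have "\<dots> = ln (norm (H 0)) - ln (norm (u 0))"
    unfolding n0 using pos u0 by (subst ln_mult_pos) auto
  also have "ln (norm (H 0)) \<le> circle_mean 0 R2 (\<lambda>z. ln (norm (H z)))"
  proof (rule ln_le_circle_mean(1)[OF H])
    show "H 0 \<noteq> 0" using n0 pos u0 by auto
    show "H z \<noteq> 0" if "z \<in> sphere 0 R2" for z using eq[OF that] nz[OF that] by auto
  qed (use R in auto)
  also have "\<dots> = circle_mean 0 R2 (\<lambda>z. ln (norm (u z)))"
    using R eq by (intro circle_mean_cong) auto
  finally show ?thesis by simp
qed

section \<open>The lemma on the logarithmic derivative\<close>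

lemma logderiv_div_exp:
  assumes "U field_differentiable (at z)" "V field_differentiable (at z)" "U z \<noteq> 0" "V z \<noteq> 0"
    and "eventually (\<lambda>w. U w / V w = exp (q w)) (nhds z)" "q field_differentiable (at z)"
  shows "logderiv U z - logderiv V z = deriv q z"
proof -
  have "logderiv (\<lambda>w. exp (q w)) z = logderiv (\<lambda>w. U w / V w) z"
    by (rule logderiv_cong) (use assms(5) in \<open>auto elim: eventually_mono\<close>)
  also have "\<dots> = logderiv U z - logderiv V z"
    unfolding logderiv_def using assms(1-4) by (subst deriv_divide) (auto simp: field_simps power2_eq_square)
  finally have "logderiv U z - logderiv V z = logderiv (\<lambda>w. exp (q w)) z" by simp
  moreover have "deriv (\<lambda>w. exp (q w)) z = deriv q z * exp (q z)"
    using DERIV_imp_deriv[OF DERIV_fun_exp[OF field_differentiable_derivI[OF assms(6)]]] by (simp add: mult.commute)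
  ultimately show ?thesis by (simp add: logderiv_def)
qed

lemma entire_field_differentiable: "u holomorphic_on UNIV \<Longrightarrow> u field_differentiable (at z)"
  by (meson UNIV_I holomorphic_on_imp_differentiable_at open_UNIV)

lemma norm_sum_list_le: "norm (\<Sum>x\<leftarrow>xs. f x) \<le> (\<Sum>x\<leftarrow>xs. norm (f x))" for f :: "'a \<Rightarrow> 'b::real_normed_vector"
  by (induction xs) (auto intro: order_trans[OF norm_triangle_ineq])

text \<open>Three parts with different estimates: the poles at the zeros of \<open>u\<close>, the
  bounded terms of the reflected factors, and \<open>H\<close>, which has a holomorphic logarithm
  once \<open>h\<close> is zero-free on the disc.\<close>

lemma logderiv_factored:
  assumes h: "h holomorphic_on UNIV" "h z \<noteq> 0" and u: "\<And>z. u z = (\<Prod>a\<leftarrow>as. z - a) * h z"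
    and uz: "u z \<noteq> 0" and as: "\<And>a. a \<in> set as \<Longrightarrow> norm a < R" and z: "norm z < R"
  defines "H \<equiv> (\<lambda>z. (\<Prod>a\<leftarrow>as. reflected_factor R a z) * h z)"
  shows "logderiv u z = (\<Sum>a\<leftarrow>as. 1 / (z - a)) - (\<Sum>a\<leftarrow>as. logderiv (reflected_factor R a) z) + logderiv H z"
proof -
  have az: "z - a \<noteq> 0" if "a \<in> set as" for a
    using uz that by (auto simp: u prod_list_zero_iff)
  have rz: "reflected_factor R a z \<noteq> 0" if "a \<in> set as" for a
    using that as z by (intro reflected_factor_nonzero) auto
  have hd: "h field_differentiable (at z)" by (rule entire_field_differentiable[OF h(1)])
  have pz: "(\<Prod>a\<leftarrow>as. z - a) \<noteq> 0" using uz by (simp add: u)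
  have qz: "(\<Prod>a\<leftarrow>as. reflected_factor R a z) \<noteq> 0" using rz by (force simp: prod_list_zero_iff)
  have ld: "logderiv (\<lambda>z. z - a) z = 1 / (z - a)" for a :: complex
  proof -
    have "deriv (\<lambda>z. z - a) z = 1" by (rule DERIV_imp_deriv) (auto intro!: derivative_eq_intros)
    then show ?thesis by (simp add: logderiv_def)
  qed
  have fd: "(\<lambda>z. z - a) field_differentiable (at z)" for a :: complex by (intro derivative_intros)
  have rd: "reflected_factor R a field_differentiable (at z)" for a
    by (rule entire_field_differentiable[OF reflected_factor_holomorphic])
  have "u = (\<lambda>z. (\<Prod>a\<leftarrow>as. z - a) * h z)" using u by auto
  then have "logderiv u z = logderiv (\<lambda>z. \<Prod>a\<leftarrow>as. z - a) z + logderiv h z"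
    using logderiv_mult[OF logderiv_prod_list(1)[of as "\<lambda>a z. z - a" z] hd pz h(2)] fd az by simp
  also have "logderiv (\<lambda>z. \<Prod>a\<leftarrow>as. z - a) z = (\<Sum>a\<leftarrow>as. 1 / (z - a))"
    using logderiv_prod_list(2)[of as "\<lambda>a z. z - a" z] fd az by (simp add: ld)
  finally have 1: "logderiv u z = (\<Sum>a\<leftarrow>as. 1 / (z - a)) + logderiv h z" .
  have "logderiv H z = (\<Sum>a\<leftarrow>as. logderiv (reflected_factor R a) z) + logderiv h z"
    unfolding H_def
    using logderiv_mult[OF logderiv_prod_list(1)[of as "reflected_factor R" z] hd qz h(2)]
      logderiv_prod_list(2)[of as "reflected_factor R" z] rd rz by simp
  then show ?thesis using 1 by simp
qed

lemma sqrt_sum_list_le: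
  "(\<And>x. x \<in> set xs \<Longrightarrow> f x \<ge> (0::real)) \<Longrightarrow> sqrt (\<Sum>x\<leftarrow>xs. f x) \<le> (\<Sum>x\<leftarrow>xs. sqrt (f x))"
proof (induction xs)
  case (Cons a xs)
  have "sqrt (f a + (\<Sum>x\<leftarrow>xs. f x)) \<le> sqrt (f a) + sqrt (\<Sum>x\<leftarrow>xs. f x)"
    using Cons.prems by (intro sqrt_add_le_add_sqrt sum_list_map_nonneg) auto
  then show ?case using Cons by force
qed auto

text \<open>The values of the characteristic on both auxiliary circles enter the bound, so that its monotonicity
  need not be proved.\<close>

lemma logderiv_mean_le_at_0:
  assumes u: "u holomorphic_on UNIV" "u 0 \<noteq> 0" and v: "v holomorphic_on UNIV" "v 0 \<noteq> 0"
    and r: "1 \<le> r" and h: "0 < h" "h \<le> 1" and R: "r * (1 + h) \<le> R" "R * (1 + h) \<le> R2"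
    and nz: "\<And>z. norm z \<in> {r, R, R2} \<Longrightarrow> u z \<noteq> 0 \<and> v z \<noteq> 0"
    and \<tau>: "circle_mean 0 R (\<lambda>z. max (ln (norm (u z))) (ln (norm (v z)))) \<le> \<tau>"
      "circle_mean 0 R2 (\<lambda>z. max (ln (norm (u z))) (ln (norm (v z)))) \<le> \<tau>"
    and \<kappa>: "2 * \<tau> - ln (norm (u 0)) - ln (norm (v 0)) \<le> \<kappa>"
  shows "circle_mean 0 r (\<lambda>z. ln (1 + norm (logderiv u z - logderiv v z))) \<le> 2 * ln (130 * (1 + \<kappa>) / h)"
proof -
  have r0: "r > 0" using r by simp
  have Rr: "R \<ge> r + h" using R(1) mult_right_mono[OF r, of h] h by (simp only: distrib_left mult_1_right) linarith
  have R0: "R > 0" "r < R" using Rr r0 h by auto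
  have R2R: "R < R2" using R(2) mult_pos_pos[OF R0(1) h(1)] by (simp only: distrib_left mult_1_right)
  have R20: "R2 > 0" using R2R R0 by simp
  obtain hu as where hu: "hu holomorphic_on UNIV" "\<And>z. u z = (\<Prod>a\<leftarrow>as. z - a) * hu z"
    "\<And>a. a \<in> set as \<Longrightarrow> 0 < norm a \<and> norm a < R \<and> u a = 0" "\<And>z. z \<in> cball 0 R \<Longrightarrow> hu z \<noteq> 0"
    by (rule entire_disc_factorization[OF u R0(1)], use nz in force, rule that)
  obtain hv bs where hv: "hv holomorphic_on UNIV" "\<And>z. v z = (\<Prod>a\<leftarrow>bs. z - a) * hv z"
    "\<And>a. a \<in> set bs \<Longrightarrow> 0 < norm a \<and> norm a < R \<and> v a = 0" "\<And>z. z \<in> cball 0 R \<Longrightarrow> hv z \<noteq> 0"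
    by (rule entire_disc_factorization[OF v R0(1)], use nz in force, rule that)
  define U where "U = (\<lambda>z. (\<Prod>a\<leftarrow>as. reflected_factor R a z) * hu z)"
  define V where "V = (\<lambda>z. (\<Prod>a\<leftarrow>bs. reflected_factor R a z) * hv z)"
  have U: "U holomorphic_on UNIV" and V: "V holomorphic_on UNIV" unfolding U_def V_def
    by (intro holomorphic_intros prod_list_holomorphic reflected_factor_holomorphic hu hv)+
  have Unz: "U z \<noteq> 0" if "z \<in> cball 0 R" for z
    using hu(4)[OF that] that hu(3) by (auto simp: U_def prod_list_zero_iff reflected_factor_nonzero)
  have Vnz: "V z \<noteq> 0" if "z \<in> cball 0 R" for z
    using hv(4)[OF that] that hv(3) by (auto simp: V_def prod_list_zero_iff reflected_factor_nonzero)
  have refl_prod: "(\<Prod>a\<leftarrow>cs. norm (z - a)) = (\<Prod>a\<leftarrow>cs. norm (reflected_factor R a z))" if "z \<in> sphere 0 R" for z cs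
    using that R0 by (intro arg_cong[where f = prod_list] map_cong) (auto simp: reflected_factor_norm)
  have nU: "norm (u z) = norm (U z)" and nV: "norm (v z) = norm (V z)" if "z \<in> sphere 0 R" for z
    using refl_prod[OF that, of as] refl_prod[OF that, of bs]
    by (simp_all add: hu(2) hv(2) U_def V_def norm_mult norm_prod_list)
  obtain qu Ru where qu: "Ru > R" "qu holomorphic_on ball 0 Ru" "\<And>z. z \<in> ball 0 Ru \<Longrightarrow> U z = exp (qu z)"
    by (rule entire_log_on_disc[OF U Unz R0(1)], assumption, rule that)
  obtain qv Rv where qv: "Rv > R" "qv holomorphic_on ball 0 Rv" "\<And>z. z \<in> ball 0 Rv \<Longrightarrow> V z = exp (qv z)"
    by (rule entire_log_on_disc[OF V Vnz R0(1)], assumption, rule that)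
  define R' where "R' = min Ru Rv"
  define q where "q = (\<lambda>z. qu z - qv z)"
  have R': "R' > R" using qu qv by (simp add: R'_def)
  have q: "q holomorphic_on ball 0 R'"
    unfolding q_def R'_def
    by (intro holomorphic_intros holomorphic_on_subset[OF qu(2)] holomorphic_on_subset[OF qv(2)]) auto
  have exq: "U z / V z = exp (q z)" if "z \<in> ball 0 R'" for z
    using qu(3)[of z] qv(3)[of z] that by (simp add: q_def R'_def exp_diff)
  \<comment> \<open>\<open>Re q\<close> is the difference of the two logarithms, and
    \<open>\<bar>x - y\<bar> = 2 * max x y - x - y\<close>. Hence an upper bound for the mean of the
    maximum suffices: the subtracted means are bounded below by the values at 0.\<close>
  have Req: "\<bar>Re (q z)\<bar> = 2 * max (ln (norm (u z))) (ln (norm (v z))) - ln (norm (u z)) - ln (norm (v z))"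
    if "z \<in> sphere 0 R" for z
  proof -
    have "U z \<noteq> 0" "V z \<noteq> 0" using Unz Vnz that by auto
    have "Re (q z) = ln (norm (U z / V z))" using exq[of z] that R' by auto
    also have "\<dots> = ln (norm (U z)) - ln (norm (V z))"
      using \<open>U z \<noteq> 0\<close> \<open>V z \<noteq> 0\<close> by (simp add: norm_divide ln_div)
    finally show ?thesis using nU[OF that] nV[OF that] by (auto simp: max_def)
  qed
  have cu: "continuous_on (sphere 0 \<rho>) (\<lambda>z. ln (norm (u z)))" and cv: "continuous_on (sphere 0 \<rho>) (\<lambda>z. ln (norm (v z)))"
    if "\<rho> \<in> {r, R, R2}" for \<rho>
    using that nz by (auto intro!: continuous_intros holomorphic_on_imp_continuous_on holomorphic_on_subset[OF u(1)] holomorphic_on_subset[OF v(1)])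
  have cm: "continuous_on (sphere 0 \<rho>) (\<lambda>z. max (ln (norm (u z))) (ln (norm (v z))))"
    if "\<rho> \<in> {r, R, R2}" for \<rho>
    using cu[OF that] cv[OF that] by (rule continuous_on_max)
  define N where "N = real (length as) + real (length bs)"
  have mean_q: "circle_mean 0 R (\<lambda>z. \<bar>Re (q z)\<bar>) \<le> \<kappa>"
  proof -
    have "circle_mean 0 R (\<lambda>z. \<bar>Re (q z)\<bar>) = circle_mean 0 R (\<lambda>z. 2 * max (ln (norm (u z))) (ln (norm (v z))) - ln (norm (u z)) - ln (norm (v z)))"
      by (rule circle_mean_cong) (use R0 Req in auto)
    also have "\<dots> = 2 * circle_mean 0 R (\<lambda>z. max (ln (norm (u z))) (ln (norm (v z)))) - circle_mean 0 R (\<lambda>z. ln (norm (u z))) - circle_mean 0 R (\<lambda>z. ln (norm (v z)))"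
      using R0 cu[of R] cv[of R] cm[of R]
      by (simp add: circle_mean_diff circle_mean_cmult continuous_on_diff continuous_on_mult_left)
    also have "\<dots> \<le> \<kappa>"
      using \<tau>(1) \<kappa> ln_le_circle_mean(1)[OF u R0(1)] ln_le_circle_mean(1)[OF v R0(1)] nz by simp
    finally show ?thesis .
  qed
  have \<kappa>0: "\<kappa> \<ge> 0"
  proof -
    have "0 \<le> circle_mean 0 R (\<lambda>z. \<bar>Re (q z)\<bar>)"
      unfolding circle_mean_def by (intro integral_nonneg circle_integrable)
        (use R0 R' in \<open>auto intro!: continuous_intros holomorphic_on_imp_continuous_on holomorphic_on_subset[OF q]\<close>)
    then show ?thesis using mean_q by simp
  qed
  have lnh: "ln (1 + h) \<ge> h / 2"
  proof -
    have "ln (1 / (1 + h)) \<le> 1 / (1 + h) - 1" using h by (intro ln_le_minus_one) auto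
    then have "ln (1 + h) \<ge> 1 - 1 / (1 + h)" using h by (simp add: ln_div)
    also have "1 - 1 / (1 + h) = h / (1 + h)" using h by (simp add: field_simps)
    also have "h / (1 + h) \<ge> h / 2" using h by (intro divide_left_mono) auto
    finally show ?thesis .
  qed
  \<comment> \<open>\<open>N\<close> counts the zeros of \<open>u\<close> and \<open>v\<close> in
    the disc of radius \<open>R\<close>. The circle of radius \<open>R2\<close> serves this count,
    in which every zero weighs \<open>ln (R2 / R) \<ge> h / 2\<close>.\<close>
  have N_le: "N \<le> 2 * \<kappa> / h"
  proof -
    have "ln (R2 / R) \<ge> ln (1 + h)" using R(2) R0 R20 h by (subst ln_le_cancel_iff) (auto simp: field_simps)
    then have "N * (h / 2) \<le> N * ln (R2 / R)" using lnh by (intro mult_left_mono) (auto simp: N_def)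
    also have "\<dots> = real (length as) * ln (R2 / R) + real (length bs) * ln (R2 / R)" by (simp add: N_def distrib_right)
    also have "\<dots> \<le> (circle_mean 0 R2 (\<lambda>z. ln (norm (u z))) - ln (norm (u 0))) + (circle_mean 0 R2 (\<lambda>z. ln (norm (v z))) - ln (norm (v 0)))"
      by (intro add_mono number_of_zeros_le[OF hu(1) _ R0(1) R2R hu(2) u(2)] number_of_zeros_le[OF hv(1) _ R0(1) R2R hv(2) v(2)])
        (use hu(3) hv(3) nz in auto)
    also have "circle_mean 0 R2 (\<lambda>z. ln (norm (u z))) \<le> \<tau>"
      using \<tau>(2) by (rule order_trans[rotated], intro circle_mean_mono) (use R20 cu cm in auto)
    also have "circle_mean 0 R2 (\<lambda>z. ln (norm (v z))) \<le> \<tau>"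
      using \<tau>(2) by (rule order_trans[rotated], intro circle_mean_mono) (use R20 cv cm in auto)
    finally have "N * (h / 2) \<le> \<kappa>" using \<kappa> by simp
    then show ?thesis using h by (simp add: field_simps)
  qed
  define Y where "Y = (\<lambda>z. (\<Sum>a\<leftarrow>as @ bs. 1 / norm (z - a)))"
  have bound: "norm (logderiv u z - logderiv v z) \<le> Y z + N / h + 4 * \<kappa> / h^2" if z: "z \<in> sphere 0 r" for z
  proof -
    have zR: "norm z < R" "norm z = r" using z R0 by auto
    have uv: "u z \<noteq> 0" "v z \<noteq> 0" using nz z by auto
    have lu: "logderiv u z = (\<Sum>a\<leftarrow>as. 1 / (z - a)) - (\<Sum>a\<leftarrow>as. logderiv (reflected_factor R a) z) + logderiv U z"
      unfolding U_def by (rule logderiv_factored[OF hu(1) _ hu(2) uv(1)]) (use hu zR in auto)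
    have lv: "logderiv v z = (\<Sum>a\<leftarrow>bs. 1 / (z - a)) - (\<Sum>a\<leftarrow>bs. logderiv (reflected_factor R a) z) + logderiv V z"
      unfolding V_def by (rule logderiv_factored[OF hv(1) _ hv(2) uv(2)]) (use hv zR in auto)
    have lq: "logderiv U z - logderiv V z = deriv q z"
    proof (rule logderiv_div_exp)
      show "U field_differentiable at z" "V field_differentiable at z" using entire_field_differentiable U V by auto
      show "U z \<noteq> 0" "V z \<noteq> 0" using Unz Vnz zR by auto
      have "z \<in> ball 0 R'" using zR R' by simp
      then show "eventually (\<lambda>w. U w / V w = exp (q w)) (nhds z)"
        using exq by (intro eventually_nhds_in_open[THEN eventually_mono, of "ball 0 R'"]) auto
      show "q field_differentiable at z"
        using \<open>z \<in> ball 0 R'\<close> q holomorphic_on_imp_differentiable_at open_ball by blast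
    qed
    have inv: "norm (\<Sum>a\<leftarrow>cs. 1 / (z - a)) \<le> (\<Sum>a\<leftarrow>cs. 1 / norm (z - a))" for cs
      by (rule order_trans[OF norm_sum_list_le]) (simp add: norm_divide)
    have Rrinv: "1 / (R - r) \<le> 1 / h" using Rr h R0 by (intro divide_left_mono) auto
    have refl: "norm (\<Sum>a\<leftarrow>cs. logderiv (reflected_factor R a) z) \<le> real (length cs) / h"
      if "\<And>a. a \<in> set cs \<Longrightarrow> norm a < R" for cs
    proof -
      have "norm (\<Sum>a\<leftarrow>cs. logderiv (reflected_factor R a) z) \<le> (\<Sum>a\<leftarrow>cs. norm (logderiv (reflected_factor R a) z))"
        by (rule norm_sum_list_le)
      also have "\<dots> \<le> (\<Sum>a\<leftarrow>cs. 1 / h)"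
        using norm_logderiv_reflected_factor_le[of z r R] zR R0 that Rrinv
        by (intro sum_list_mono) (meson order_refl order_trans)
      finally show ?thesis by (simp add: sum_list_triv)
    qed
    have dq: "norm (deriv q z) \<le> 4 * \<kappa> / h^2"
    proof -
      have "norm (deriv q z) \<le> 2 * R / (R - norm z)^2 * circle_mean 0 R (\<lambda>\<zeta>. \<bar>Re (q \<zeta>)\<bar>)"
        by (rule norm_deriv_le_circle_mean_Re[OF q R0(1) R' zR(1)])
      also have "\<dots> \<le> 2 * R / (R - norm z)^2 * \<kappa>"
        using mean_q R0 by (intro mult_left_mono) auto
      also have "\<dots> \<le> 4 / h^2 * \<kappa>"
      proof (intro mult_right_mono \<kappa>0)
        \<comment> \<open>Follows from \<open>r * h \<le> R - r\<close> and
          \<open>h \<le> 1\<close>. Together with \<open>h \<le> R - r\<close> it eliminates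
          \<open>R\<close> from the bound, which would otherwise grow with the radius.\<close>
        have "R * h \<le> 2 * (R - r)"
        proof -
          have "r * (1 + h) \<le> R" by fact
          then have "r + r * h \<le> R" by (simp add: algebra_simps)
          moreover have "(R - r) * h \<le> (R - r) * 1" using R0 h by (intro mult_left_mono) auto
          ultimately show ?thesis by (simp add: algebra_simps)
        qed
        moreover have "h \<le> R - r" using Rr by simp
        ultimately have "(R * h) * h \<le> (2 * (R - r)) * (R - r)"
          using mult_mono[of "R * h" "2 * (R - r)" h "R - r"] R0 h by simp
        then have "2 * R * h^2 \<le> 4 * (R - r)^2" by (simp add: power2_eq_square algebra_simps)
        moreover have "h^2 > 0" "(R - r)^2 > 0" using h R0 by auto
        ultimately have "2 * R \<le> 4 / h^2 * (R - r)^2" by (simp add: pos_le_divide_eq)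
        then show "2 * R / (R - norm z)^2 \<le> 4 / h^2"
          using \<open>(R - r)^2 > 0\<close> zR by (simp add: pos_divide_le_eq)
      qed
      finally show ?thesis by simp
    qed
    have "logderiv u z - logderiv v z = (\<Sum>a\<leftarrow>as. 1 / (z - a)) - (\<Sum>a\<leftarrow>bs. 1 / (z - a))
       - (\<Sum>a\<leftarrow>as. logderiv (reflected_factor R a) z) + (\<Sum>a\<leftarrow>bs. logderiv (reflected_factor R a) z) + deriv q z"
      unfolding lu lv lq[symmetric] by simp
    moreover have "norm (a - b - c + d + e) \<le> norm a + norm b + norm c + norm d + norm e" for a b c d e :: complex
      using norm_triangle_ineq[of "a - b - c + d" e] norm_triangle_ineq[of "a - b - c" d]
        norm_triangle_ineq4[of "a - b" c] norm_triangle_ineq4[of a b] by linarith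
    ultimately have "norm (logderiv u z - logderiv v z) \<le> norm (\<Sum>a\<leftarrow>as. 1 / (z - a)) + norm (\<Sum>a\<leftarrow>bs. 1 / (z - a))
       + norm (\<Sum>a\<leftarrow>as. logderiv (reflected_factor R a) z) + norm (\<Sum>a\<leftarrow>bs. logderiv (reflected_factor R a) z) + norm (deriv q z)"
      by (simp only:)
    also have "\<dots> \<le> (\<Sum>a\<leftarrow>as. 1 / norm (z - a)) + (\<Sum>a\<leftarrow>bs. 1 / norm (z - a)) + real (length as) / h + real (length bs) / h + 4 * \<kappa> / h^2"
    proof -
      have "norm (\<Sum>a\<leftarrow>as. logderiv (reflected_factor R a) z) \<le> real (length as) / h"
        using hu(3) by (intro refl) blast
      moreover have "norm (\<Sum>a\<leftarrow>bs. logderiv (reflected_factor R a) z) \<le> real (length bs) / h"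
        using hv(3) by (intro refl) blast
      ultimately show ?thesis using inv[of as] inv[of bs] dq by linarith
    qed
    also have "\<dots> = Y z + N / h + 4 * \<kappa> / h^2" by (simp add: Y_def N_def add_divide_distrib)
    finally show ?thesis .
  qed
  \<comment> \<open>A majorant of \<open>sqrt (1 + norm (logderiv u z - logderiv v z))\<close>. The
    square root is subadditive and turns the poles \<open>1 / norm (z - a)\<close> into
    singularities with uniformly bounded means; under the logarithm it costs only a factor
    2.\<close>
  define \<phi> where "\<phi> = (\<lambda>z. (1 + sqrt (N / h) + 2 * sqrt \<kappa> / h) + (\<Sum>a\<leftarrow>as @ bs. 1 / sqrt (norm (z - a))))"
  have ra: "norm a \<noteq> r" if "a \<in> set (as @ bs)" for a using that hu(3)[of a] hv(3)[of a] nz[of a] by auto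
  have c1: "continuous_on (sphere 0 r) (\<lambda>z. 1 / sqrt (norm (z - a)))" if "a \<in> set (as @ bs)" for a
    using ra[OF that] by (auto intro!: continuous_intros)
  have c\<phi>: "continuous_on (sphere 0 r) \<phi>"
    unfolding \<phi>_def by (intro continuous_on_add continuous_on_const circle_mean_sum_list(1) c1) (use r0 in simp)
  have \<phi>1: "\<phi> z \<ge> 1" for z
  proof -
    have "(\<Sum>a\<leftarrow>as @ bs. 1 / sqrt (norm (z - a))) \<ge> 0" by (rule sum_list_map_nonneg) simp
    moreover have "N \<ge> 0" by (simp add: N_def)
    ultimately show ?thesis unfolding \<phi>_def using h \<kappa>0 by (simp add: add_nonneg_nonneg)
  qed
  have mean\<phi>: "circle_mean 0 r \<phi> \<le> 130 * (1 + \<kappa>) / h"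
  proof -
    have "circle_mean 0 r \<phi> = (1 + sqrt (N / h) + 2 * sqrt \<kappa> / h) + (\<Sum>a\<leftarrow>as @ bs. circle_mean 0 r (\<lambda>z. 1 / sqrt (norm (z - a))))"
      unfolding \<phi>_def using r0 c1 circle_mean_sum_list[of r "as @ bs" 0 "\<lambda>a z. 1 / sqrt (norm (z - a))"]
      by (subst circle_mean_add) (auto simp del: map_append sum_list_append set_append)
    also have "(\<Sum>a\<leftarrow>as @ bs. circle_mean 0 r (\<lambda>z. 1 / sqrt (norm (z - a)))) \<le> (\<Sum>a\<leftarrow>as @ bs. 60)"
      by (intro sum_list_mono circle_mean_inverse_sqrt_le r ra)
    also have "(\<Sum>a\<leftarrow>as @ bs. 60) = 60 * N" by (simp add: N_def sum_list_triv)
    also have "sqrt (N / h) \<le> N + 1 / h"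
    proof (rule real_le_lsqrt)
      have "N / h \<le> (2 * N) / h" using h by (intro divide_right_mono) (auto simp: N_def)
      then have "N / h \<le> 2 * N * (1/h)" by simp
      also have "\<dots> \<le> (N + 1 / h)^2" by (simp add: power2_sum)
      finally show "N / h \<le> (N + 1 / h)^2" .
    qed (use h in \<open>auto simp: N_def\<close>)
    also have "sqrt \<kappa> \<le> 1 + \<kappa>"
      using \<kappa>0 by (intro real_le_lsqrt) (auto simp: power2_sum)
    also have "1 + (N + 1 / h) + 2 * (1 + \<kappa>) / h + 60 * N \<le> 1 / h + 1 / h + 2 * (1 + \<kappa>) / h + 61 * (2 * \<kappa> / h)"
    proof -
      have "1 \<le> 1 / h" using h by simp
      then show ?thesis using N_le by linarith
    qed
    \<comment> \<open>The four terms add up to \<open>(4 + 124 * \<kappa>) / h\<close>.\<close>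
    also have "\<dots> \<le> 130 * (1 + \<kappa>) / h" using h \<kappa>0 by (simp add: field_simps)
    finally show ?thesis using h by (simp add: divide_right_mono)
  qed
  have "circle_mean 0 r (\<lambda>z. ln (1 + norm (logderiv u z - logderiv v z))) \<le> circle_mean 0 r (\<lambda>z. 2 * ln (\<phi> z))"
  proof (rule circle_mean_mono)
    have ne: "1 + norm (logderiv u z - logderiv v z) \<noteq> 0" for z using norm_ge_zero[of "logderiv u z - logderiv v z"] by linarith
    have "u z \<noteq> 0" "v z \<noteq> 0" if "z \<in> sphere 0 r" for z using that nz by auto
    then show "continuous_on (sphere 0 r) (\<lambda>z. ln (1 + norm (logderiv u z - logderiv v z)))"
      using ne unfolding logderiv_def
      by (intro continuous_intros holomorphic_on_imp_continuous_on holomorphic_on_subset[OF u(1)]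
            holomorphic_on_subset[OF v(1)] holomorphic_on_subset[OF holomorphic_deriv[OF u(1)]]
            holomorphic_on_subset[OF holomorphic_deriv[OF v(1)]]) auto
    show "continuous_on (sphere 0 r) (\<lambda>z. 2 * ln (\<phi> z))"
      using \<phi>1 by (intro continuous_intros c\<phi>) (metis not_one_le_zero)
    fix z :: complex assume z: "z \<in> sphere 0 r"
    have Y0: "Y z \<ge> 0" unfolding Y_def by (rule sum_list_map_nonneg) simp
    have N0: "N \<ge> 0" by (simp add: N_def)
    have "sqrt (1 + norm (logderiv u z - logderiv v z)) \<le> sqrt (1 + (Y z + N / h + 4 * \<kappa> / h^2))"
      using bound[OF z] by simp
    also have "\<dots> \<le> sqrt 1 + (sqrt (Y z) + sqrt (N / h) + sqrt (4 * \<kappa> / h^2))"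
      using Y0 N0 h \<kappa>0 by (intro order_trans[OF sqrt_add_le_add_sqrt] add_mono order_refl add_nonneg_nonneg divide_nonneg_nonneg) auto
    also have "sqrt (4 * \<kappa> / h^2) = 2 * sqrt \<kappa> / h" using h by (simp add: real_sqrt_divide real_sqrt_mult)
    also have "sqrt (Y z) \<le> (\<Sum>a\<leftarrow>as @ bs. 1 / sqrt (norm (z - a)))"
      unfolding Y_def using sqrt_sum_list_le[of "as @ bs" "\<lambda>a. 1 / norm (z - a)"]
      by (simp add: real_sqrt_divide)
    finally have "sqrt (1 + norm (logderiv u z - logderiv v z)) \<le> \<phi> z" by (simp add: \<phi>_def algebra_simps)
    then have "1 + norm (logderiv u z - logderiv v z) \<le> (\<phi> z)^2"
      by (rule sqrt_le_D)
    then have "ln (1 + norm (logderiv u z - logderiv v z)) \<le> ln ((\<phi> z)^2)"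
      using \<phi>1[of z] by (subst ln_le_cancel_iff) (auto intro!: zero_less_power add_pos_nonneg)
    also have "\<dots> = 2 * ln (\<phi> z)" using \<phi>1[of z] by (subst ln_realpow) auto
    finally show "ln (1 + norm (logderiv u z - logderiv v z)) \<le> 2 * ln (\<phi> z)" .
  qed (use r0 in auto)
  also have "\<dots> = 2 * circle_mean 0 r (\<lambda>z. ln (\<phi> z))" by (rule circle_mean_cmult)
  also have "circle_mean 0 r (\<lambda>z. ln (\<phi> z)) \<le> ln (130 * (1 + \<kappa>) / h)"
    using c\<phi> \<phi>1 mean\<phi> \<kappa>0 h r0 by (intro circle_mean_ln_le) (auto intro: less_le_trans[OF zero_less_one])
  finally show ?thesis by simp
qed

lemma shift_holomorphic: "u holomorphic_on UNIV \<Longrightarrow> (\<lambda>z. u (p + z)) holomorphic_on UNIV"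
  using holomorphic_on_compose[of "\<lambda>z. p + z" UNIV u]
  by (simp add: o_def holomorphic_on_subset holomorphic_intros)

lemma logderiv_shift:
  assumes "u holomorphic_on UNIV"
  shows "logderiv (\<lambda>z. u (p + z)) z = logderiv u (p + z)"
proof -
  have "(u has_field_derivative deriv u (p + z)) (at (p + z))"
    using entire_field_differentiable[OF assms] by (rule field_differentiable_derivI)
  then have "((\<lambda>z. u (p + z)) has_field_derivative deriv u (p + z)) (at z)"
    using DERIV_shift[of u "deriv u (p + z)" z p] by (simp add: add.commute)
  then show ?thesis by (simp add: logderiv_def DERIV_imp_deriv)
qed

text \<open>The centre has to be movable, because 0 may be a zero of one of the functions, while
  \<open>\<kappa>\<close> contains their logarithms at the centre.\<close>

lemma logderiv_mean_le:
  assumes u: "u holomorphic_on UNIV" "u p \<noteq> 0" and v: "v holomorphic_on UNIV" "v p \<noteq> 0"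
    and r: "1 \<le> r" and h: "0 < h" "h \<le> 1" and R: "r * (1 + h) \<le> R" "R * (1 + h) \<le> R2"
    and nz: "\<And>z. dist p z \<in> {r, R, R2} \<Longrightarrow> u z \<noteq> 0 \<and> v z \<noteq> 0"
    and \<tau>: "circle_mean p R (\<lambda>z. max (ln (norm (u z))) (ln (norm (v z)))) \<le> \<tau>"
      "circle_mean p R2 (\<lambda>z. max (ln (norm (u z))) (ln (norm (v z)))) \<le> \<tau>"
    and \<kappa>: "2 * \<tau> - ln (norm (u p)) - ln (norm (v p)) \<le> \<kappa>"
  shows "circle_mean p r (\<lambda>z. ln (1 + norm (logderiv u z - logderiv v z))) \<le> 2 * ln (130 * (1 + \<kappa>) / h)"
proof -
  have "circle_mean 0 r (\<lambda>z. ln (1 + norm (logderiv (\<lambda>z. u (p + z)) z - logderiv (\<lambda>z. v (p + z)) z)))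
      \<le> 2 * ln (130 * (1 + \<kappa>) / h)"
  proof (rule logderiv_mean_le_at_0[OF shift_holomorphic[OF u(1)] _ shift_holomorphic[OF v(1)] _ r h R])
    show "u (p + z) \<noteq> 0 \<and> v (p + z) \<noteq> 0" if "norm z \<in> {r, R, R2}" for z
      using nz[of "p + z"] that by (simp add: dist_norm)
  qed (use u v \<tau> \<kappa> in \<open>simp_all add: circle_mean_shift[of p]\<close>)
  then show ?thesis by (simp add: circle_mean_shift[of p] logderiv_shift u v)
qed

lemma ln_le_circle_mean_center:
  assumes u: "u holomorphic_on UNIV" and u0: "u p \<noteq> 0" and R: "R > 0"
    and nz: "\<And>z. z \<in> sphere p R \<Longrightarrow> u z \<noteq> 0"
  shows "ln (norm (u p)) \<le> circle_mean p R (\<lambda>z. ln (norm (u z)))"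
    and "u w = 0 \<Longrightarrow> dist p w < R \<Longrightarrow> ln (norm (u p)) + ln (R / dist p w) \<le> circle_mean p R (\<lambda>z. ln (norm (u z)))"
proof -
  have nz': "u (p + z) \<noteq> 0" if "z \<in> sphere 0 R" for z
    using nz[of "p + z"] that by (simp add: dist_norm)
  note * = ln_le_circle_mean[OF shift_holomorphic[OF u] _ R nz']
  show "ln (norm (u p)) \<le> circle_mean p R (\<lambda>z. ln (norm (u z)))"
    using *(1) u0 by (simp add: circle_mean_shift[of p])
  show "ln (norm (u p)) + ln (R / dist p w) \<le> circle_mean p R (\<lambda>z. ln (norm (u z)))"
    if "u w = 0" "dist p w < R"
    using *(2)[of "w - p"] u0 that by (simp add: circle_mean_shift[of p] dist_norm norm_minus_commute)
qed

text \<open>The radii $r_{k+1} = r_k (1 + 2^{-k})^8$ stay bounded, but along them an unbounded \<open>T\<close> would have to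
  tend to infinity.\<close>

lemma growth_bounded:
  fixes T :: "real \<Rightarrow> real" and C :: real
  assumes mono: "\<And>x y. 1 \<le> x \<Longrightarrow> x \<le> y \<Longrightarrow> T x \<le> T y" and T0: "\<And>x. T x \<ge> 0" and C: "C > 0"
    and growth: "\<And>r h. 1 \<le> r \<Longrightarrow> 0 < h \<Longrightarrow> h \<le> 1 \<Longrightarrow> T r \<le> C * (1 + ln (1 / h) + ln (1 + T (r * (1 + h) ^ 8)))"
  shows "\<exists>b. \<forall>r\<ge>1. T r \<le> b"
proof (rule ccontr)
  assume unb: "\<not> ?thesis"
  \<comment> \<open>If \<open>T (r k) \<ge> K * x\<close> with \<open>x = m + k\<close>, the growth
    hypothesis for \<open>h = (1/2) ^ k\<close> gives
    \<open>2 * x - 1 - k * ln 2 \<le> ln (1 + T (r (Suc k)))\<close>. Beyond \<open>x0\<close> the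
    resulting exponential lower bound exceeds \<open>K * (x + 1)\<close>, which lets the induction
    continue.\<close>
  define K where "K = 2 * C"
  define x0 where "x0 = 2 * K + 3"
  have x0: "exp (2 * x - 1) * (1/2) powr x \<ge> K * (x + 1) + 1" if x: "x \<ge> x0" for x
  proof -
    define y where "y = x - 1"
    have y: "y \<ge> 2 * K + 2" "y \<ge> 0" using x C by (auto simp: y_def x0_def K_def)
    have "y * (2 * K + 2) \<le> y * y" using y by (intro mult_left_mono) auto
    then have "K * (x + 1) + 1 \<le> 1 + y + y^2 / 2"
      using y C by (simp add: y_def K_def power2_eq_square algebra_simps add_divide_distrib diff_divide_distrib)
    also have "\<dots> \<le> exp y" using y by (intro exp_lower_Taylor_quadratic)
    also have "exp y \<le> exp (2 * x - 1) * exp (- x)" by (simp add: y_def flip: exp_add)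
    also have "exp (- x) \<le> (1/2) powr x"
    proof -
      have "ln 2 \<le> (1::real)" using ln_le_minus_one[of 2] by simp
      then have "x * ln 2 \<le> x * 1" using y by (intro mult_left_mono) (auto simp: y_def)
      then show ?thesis by (simp add: powr_def ln_div)
    qed
    finally show ?thesis by simp
  qed
  define m where "m = nat \<lceil>max 0 x0\<rceil>"
  have m: "real m \<ge> x0" unfolding m_def by linarith
  obtain r0 where r0: "r0 \<ge> 1" "T r0 > K * real m" using unb by (meson not_le)
  define r where "r = rec_nat r0 (\<lambda>k x. x * (1 + (1/2) ^ k) ^ 8)"
  have r_simps: "r 0 = r0" "r (Suc k) = r k * (1 + (1/2) ^ k) ^ 8" for k by (simp_all add: r_def)
  have r1: "r k \<ge> 1" for k
  proof (induction k)
    case (Suc k)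
    have "(1::real) \<le> (1 + (1/2) ^ k) ^ 8" by (rule one_le_power) simp
    then have "1 * 1 \<le> r k * (1 + (1/2) ^ k) ^ 8" using Suc by (intro mult_mono) auto
    then show ?case by (simp add: r_simps)
  qed (use r0 r_simps in auto)
  \<comment> \<open>By \<open>1 + x \<le> exp x\<close> the exponents add up to partial sums of 8 (1
    + 1/2 + 1/4 + ...) = 16.\<close>
  have r_le: "r k \<le> r0 * exp (8 * (2 - 2 * (1/2) ^ k))" for k
  proof (induction k)
    case (Suc k)
    have "(1 + (1/2) ^ k) ^ 8 \<le> exp ((1/2::real) ^ k) ^ 8" by (intro power_mono exp_ge_add_one_self) auto
    also have "\<dots> = exp (8 * (1/2) ^ k)" by (simp add: exp_of_nat_mult[symmetric])
    finally have "r k * (1 + (1/2) ^ k) ^ 8 \<le> (r0 * exp (8 * (2 - 2 * (1/2) ^ k))) * exp (8 * (1/2) ^ k)"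
      using Suc r0 r1[of k] by (intro mult_mono) auto
    also have "\<dots> = r0 * exp (8 * (2 - 2 * (1/2) ^ k) + 8 * (1/2) ^ k)" by (simp only: exp_add mult.assoc)
    also have "8 * (2 - 2 * (1/2::real) ^ k) + 8 * (1/2) ^ k = 8 * (2 - 2 * (1/2) ^ Suc k)" by simp
    finally show ?case by (simp add: r_simps)
  qed (simp add: r_simps)
  have big: "T (r k) \<ge> K * (real m + real k)" for k
  proof (induction k)
    case 0 then show ?case using r0 by (simp add: r_simps)
  next
    case (Suc k)
    define x where "x = real m + real k"
    define T' where "T' = T (r (Suc k))"
    have "T (r k) \<le> C * (1 + ln (1 / ((1/2) ^ k)) + ln (1 + T'))"
      unfolding T'_def r_simps by (rule growth) (use r1 in \<open>auto intro: power_le_one\<close>)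
    then have "2 * x * C \<le> C * (1 + ln (1 / ((1/2) ^ k)) + ln (1 + T'))"
      using Suc by (simp add: K_def x_def mult_ac)
    then have "2 * x \<le> 1 + ln (1 / ((1/2) ^ k)) + ln (1 + T')" using C by (simp add: mult.commute)
    moreover have "ln (1 / ((1/2::real) ^ k)) = - ln ((1/2) powr real k)"
      by (simp add: ln_div powr_realpow)
    ultimately have "2 * x - 1 + ln ((1/2) powr real k) \<le> ln (1 + T')" by simp
    then have "exp (2 * x - 1 + ln ((1/2) powr real k)) \<le> exp (ln (1 + T'))" by (simp only: exp_le_cancel_iff)
    then have 1: "exp (2 * x - 1) * (1/2) powr real k \<le> 1 + T'"
      using T0[of "r (Suc k)"] by (simp only: exp_add T'_def exp_ln_iff powr_def) (simp add: T'_def powr_def)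
    have "(1/2::real) powr x \<le> (1/2) powr real k" by (rule powr_mono') (auto simp: x_def)
    then have "exp (2 * x - 1) * (1/2) powr x \<le> exp (2 * x - 1) * (1/2) powr real k" by simp
    moreover have "K * (x + 1) + 1 \<le> exp (2 * x - 1) * (1/2) powr x" by (rule x0) (use m in \<open>simp add: x_def\<close>)
    ultimately have "K * (x + 1) \<le> T'" using 1 by linarith
    then show ?case by (simp add: T'_def x_def add_ac)
  qed
  have "K * (real m + real k) \<le> T (r0 * exp 16)" for k
  proof -
    have "r k \<le> r0 * exp 16"
      by (rule order_trans[OF r_le[of k]]) (use r0 in simp)
    then show ?thesis using big[of k] mono[OF r1[of k]] by force
  qed
  then have "real k \<le> T (r0 * exp 16) / K" for k
    using C by (simp add: K_def field_simps) (smt (verit) mult_nonneg_nonneg of_nat_0_le_iff C)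
  then show False using reals_Archimedean2[of "T (r0 * exp 16) / K"] by (meson not_le)
qed

text \<open>\<open>ln (1 + x)\<close> takes the place of the positive part of the logarithm: it is
  subadditive without an additive constant, and continuous.\<close>

lemma ln_one_plus_add_le:
  fixes x y :: real assumes "x \<ge> 0" "y \<ge> 0"
  shows "ln (1 + (x + y)) \<le> ln (1 + x) + ln (1 + y)"
proof -
  have "1 + (x + y) \<le> (1 + x) * (1 + y)" using assms by (simp add: algebra_simps)
  then have "ln (1 + (x + y)) \<le> ln ((1 + x) * (1 + y))" using assms by (subst ln_le_cancel_iff) (auto simp: add_pos_nonneg)
  then show ?thesis using assms by (simp add: ln_mult_pos add_pos_nonneg)
qed

lemma ln_one_plus_norm_add_le:
  "ln (1 + norm (x + y)) \<le> ln (1 + norm x) + ln (1 + norm y)"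
proof -
  have "ln (1 + norm (x + y)) \<le> ln (1 + (norm x + norm y))"
    using norm_triangle_ineq[of x y] by (subst ln_le_cancel_iff) (auto simp: add_pos_nonneg)
  also have "\<dots> \<le> ln (1 + norm x) + ln (1 + norm y)" by (rule ln_one_plus_add_le) auto
  finally show ?thesis .
qed

lemma ln_one_plus_norm_diff_le:
  "ln (1 + norm (x - y)) \<le> ln (1 + norm x) + ln (1 + norm y)"
  using ln_one_plus_norm_add_le[of x "-y"] by simp

lemma ln_one_plus_norm_sum_le:
  "finite I \<Longrightarrow> ln (1 + norm (\<Sum>i\<in>I. x i)) \<le> (\<Sum>i\<in>I. ln (1 + norm (x i)))"
proof (induction I rule: finite_induct)
  case (insert i I)
  then show ?case using ln_one_plus_norm_add_le[of "x i" "sum x I"] by auto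
qed auto

lemma ln_one_plus_norm_mult_le:
  "ln (1 + norm (of_nat k * x :: complex)) \<le> real k * ln (1 + norm x)"
proof -
  have "1 + real k * norm x \<le> (1 + norm x) ^ k"
    by (rule Bernoulli_inequality) (use norm_ge_zero[of x] in linarith)
  then have "ln (1 + norm (of_nat k * x)) \<le> ln ((1 + norm x) ^ k)"
    by (subst ln_le_cancel_iff) (auto simp: norm_mult add_pos_nonneg)
  then show ?thesis by (simp add: ln_realpow add_pos_nonneg)
qed

section \<open>Value distribution of a quotient of entire functions\<close>

text \<open>The derivative of \<open>f1 / f0\<close> is
  \<open>wronskian f0 f1 / f0^2\<close>.\<close>

definition wronskian :: "(complex \<Rightarrow> complex) \<Rightarrow> (complex \<Rightarrow> complex) \<Rightarrow> complex \<Rightarrow> complex" where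
  "wronskian f0 f1 z = deriv f1 z * f0 z - f1 z * deriv f0 z"

lemma logderiv_power:
  assumes "u field_differentiable (at z)" "u z \<noteq> 0"
  shows "logderiv (\<lambda>z. u z ^ n) z = of_nat n * logderiv u z"
proof (induction n)
  case 0
  then show ?case by (simp add: logderiv_def)
next
  case (Suc n)
  have "(\<lambda>z. u z ^ n) field_differentiable (at z)" using assms by (intro derivative_intros)
  then have "logderiv (\<lambda>z. u z * u z ^ n) z = logderiv u z + logderiv (\<lambda>z. u z ^ n) z"
    using assms by (intro logderiv_mult) auto
  then show ?case using Suc by (simp add: algebra_simps)
qed

text \<open>A meromorphic function \<open>f = f1/f0\<close> with \<open>f0\<close> and \<open>f1\<close> entire without common zeros. The sets \<open>A\<close>
  and \<open>B\<close> are the zeros of \<open>P\<close> and of \<open>P'\<close>, the numbers \<open>m b\<close> are the multiplicities of the latter.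
  Then \<open>lam\<close> is the logarithmic derivative of the derivative of \<open>1 / P \<circ> f\<close>.\<close>

locale entire_pair =
  fixes f0 f1 :: "complex \<Rightarrow> complex" and A B :: "complex set" and m :: "complex \<Rightarrow> nat"
  assumes f0: "f0 holomorphic_on UNIV" and f1: "f1 holomorphic_on UNIV"
    and coprime: "f0 z \<noteq> 0 \<or> f1 z \<noteq> 0"
    and finA: "finite A" and finB: "finite B" and disj: "A \<inter> B = {}" and A_ne: "A \<noteq> {}"
    and m_sum: "(\<Sum>b\<in>B. m b) + 1 = card A"
    and wronskian_nz: "\<exists>z. wronskian f0 f1 z \<noteq> 0"
begin

definition lin :: "complex \<Rightarrow> complex \<Rightarrow> complex" where "lin a z = f1 z - a * f0 z"

abbreviation W :: "complex \<Rightarrow> complex" where "W \<equiv> wronskian f0 f1"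

text \<open>The logarithmic derivative of \<open>f - a\<close>, since
  \<open>f - a = lin a / f0\<close>.\<close>

definition D :: "complex \<Rightarrow> complex \<Rightarrow> complex" where "D a z = logderiv (lin a) z - logderiv f0 z"

definition St :: "complex \<Rightarrow> complex" where "St z = (\<Prod>a\<in>A. lin a z)"

definition Bt :: "complex \<Rightarrow> complex" where "Bt z = (\<Prod>b\<in>B. lin b z)"

text \<open>The mean of \<open>ln M\<close> is, up to an additive constant, Cartan's form of the
  characteristic of \<open>f\<close>.\<close>

definition M :: "complex \<Rightarrow> real" where "M z = max (norm (f0 z)) (norm (f1 z))"

text \<open>The weight of \<open>f0\<close>, with n = \<open>card A\<close>: $P(f)^2$ has the
  denominator \<open>f0 ^ (2 * n)\<close>, while $P'(f)$ has \<open>f0 ^ (n - 1)\<close> and $f'$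
  has \<open>f0 ^ 2\<close>; this leaves 2n - (n - 1) - 2 = n - 1.\<close>

definition lam :: "complex \<Rightarrow> complex" where
  "lam z = (\<Sum>b\<in>B. of_nat (m b) * logderiv (lin b) z) + logderiv W z + of_nat (card A - 1) * logderiv f0 z
     - 2 * (\<Sum>a\<in>A. logderiv (lin a) z)"

text \<open>The logarithmic derivative of $f'$, since $f' = W / f_0^2$.\<close>

definition LW :: "complex \<Rightarrow> complex" where "LW z = logderiv W z - logderiv (\<lambda>z. f0 z ^ 2) z"

definition E :: "complex \<Rightarrow> real" where
  "E z = (\<Sum>c\<in>A\<union>B. ln (1 + norm (D c z))) + ln (1 + norm (LW z))"

text \<open>Its zeros are the points where one of the logarithmic derivatives in use is singular;
  all estimates are made away from them.\<close>

definition \<Phi> :: "complex \<Rightarrow> complex" where "\<Phi> z = f0 z * W z * (\<Prod>c\<in>A\<union>B. lin c z)"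

lemma lin_holomorphic: "lin a holomorphic_on UNIV"
  unfolding lin_def by (intro holomorphic_intros f0 f1)

lemma W_holomorphic: "W holomorphic_on UNIV"
  unfolding wronskian_def by (intro holomorphic_intros f0 f1) auto

lemma \<Phi>_holomorphic: "\<Phi> holomorphic_on UNIV"
  unfolding \<Phi>_def by (intro holomorphic_intros f0 W_holomorphic lin_holomorphic)

text \<open>Subtracting a multiple of \<open>f0\<close> from \<open>f1\<close> does not change the
  Wronskian, so one function \<open>W\<close> serves all values \<open>a\<close>.\<close>

lemma W_lin: "W z = deriv (lin a) z * f0 z - lin a z * deriv f0 z"
proof -
  have d: "deriv (lin a) z = deriv f1 z - a * deriv f0 z"
    unfolding lin_def using entire_field_differentiable[OF f0] entire_field_differentiable[OF f1]
    by (subst deriv_diff) (auto intro!: derivative_intros field_differentiable_mult)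
  show ?thesis unfolding wronskian_def d lin_def by (simp add: algebra_simps)
qed

lemma D_eq: "lin a z \<noteq> 0 \<Longrightarrow> f0 z \<noteq> 0 \<Longrightarrow> D a z = W z / (lin a z * f0 z)"
  by (simp add: D_def logderiv_def W_lin[of z a] field_simps)

lemma lin_nz: "\<exists>z. lin a z \<noteq> 0"
proof (rule ccontr)
  assume "\<not> ?thesis"
  then have "lin a = (\<lambda>_. 0)" by auto
  then have "W z = 0" for z using W_lin[of z a] by simp
  then show False using wronskian_nz by auto
qed

lemma f0_nz: "\<exists>z. f0 z \<noteq> 0"
proof (rule ccontr)
  assume "\<not> ?thesis"
  then have "f0 = (\<lambda>_. 0)" by auto
  then have "W z = 0" for z by (simp add: wronskian_def)
  then show False using wronskian_nz by auto
qed

lemma M_pos: "M z > 0"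
  using coprime[of z] by (auto simp: M_def less_max_iff_disj)

lemma M_continuous: "continuous_on S (\<lambda>z. ln (M z))"
  using M_pos unfolding M_def
  by (intro continuous_intros continuous_on_subset[OF holomorphic_on_imp_continuous_on[OF f0]]
      continuous_on_subset[OF holomorphic_on_imp_continuous_on[OF f1]]) (auto simp: M_def less_imp_neq[symmetric])

lemma \<Phi>_nzD:
  assumes "\<Phi> z \<noteq> 0"
  shows "f0 z \<noteq> 0" "W z \<noteq> 0" "c \<in> A \<union> B \<Longrightarrow> lin c z \<noteq> 0" "St z \<noteq> 0" "Bt z \<noteq> 0"
  using assms finA finB by (auto simp: \<Phi>_def St_def Bt_def)

lemma norm_f0_le: "norm (f0 z) \<le> M z" and norm_f1_le: "norm (f1 z) \<le> M z"
  by (auto simp: M_def)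

lemma norm_lin_le: "norm (lin a z) \<le> (1 + norm a) * M z"
proof -
  have "norm (lin a z) \<le> norm (f1 z) + norm a * norm (f0 z)"
    unfolding lin_def using norm_triangle_ineq4[of "f1 z" "a * f0 z"] by (simp add: norm_mult)
  also have "\<dots> \<le> M z + norm a * M z" by (intro add_mono mult_left_mono norm_f0_le norm_f1_le) auto
  finally show ?thesis by (simp add: algebra_simps)
qed

lemma ln_norm_lin_le: "lin a z \<noteq> 0 \<Longrightarrow> ln (norm (lin a z)) \<le> ln (1 + norm a) + ln (M z)"
  using norm_lin_le[of a z] M_pos[of z]
  by (subst ln_mult_pos[symmetric]) (auto simp: add_pos_nonneg)

lemma ln_norm_f0_le: "f0 z \<noteq> 0 \<Longrightarrow> ln (norm (f0 z)) \<le> ln (M z)"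
  using norm_f0_le[of z] M_pos[of z] by simp

text \<open>The terms with \<open>logderiv f0\<close> balance: -(n - 1) - 2 + 2n = n - 1 for n =
  \<open>card A\<close>. What remains are logarithmic derivatives of the meromorphic functions
  \<open>f - c\<close> and $f'$, and these have small means.\<close>

lemma lam_eq:
  assumes "\<Phi> z \<noteq> 0"
  shows "lam z = (\<Sum>b\<in>B. of_nat (m b) * D b z) + LW z - of_nat 2 * (\<Sum>a\<in>A. D a z)"
proof -
  have 1: "logderiv (\<lambda>z. f0 z ^ 2) z = 2 * logderiv f0 z"
    using logderiv_power[OF entire_field_differentiable[OF f0], of z 2] \<Phi>_nzD[OF assms] by simp
  have 2: "(\<Sum>b\<in>B. of_nat (m b) * D b z) = (\<Sum>b\<in>B. of_nat (m b) * logderiv (lin b) z) - of_nat (\<Sum>b\<in>B. m b) * logderiv f0 z"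
    by (simp add: D_def right_diff_distrib sum_subtractf sum_distrib_right)
  have 3: "(\<Sum>a\<in>A. D a z) = (\<Sum>a\<in>A. logderiv (lin a) z) - of_nat (card A) * logderiv f0 z"
    by (simp add: D_def sum_subtractf)
  have 4: "of_nat (\<Sum>b\<in>B. m b) = (of_nat (card A) - 1 :: complex)" "of_nat (card A - 1) = (of_nat (card A) - 1 :: complex)"
    using m_sum by (simp_all flip: m_sum)
  show ?thesis unfolding lam_def LW_def 1 2 3 4 by (simp add: algebra_simps)
qed

text \<open>Subadditivity produces the weights \<open>m b\<close> on \<open>B\<close>, 1 on
  \<open>LW\<close> and 2 on \<open>A\<close>, all at most \<open>card A + 2\<close>.\<close>

lemma ln_lam_le:
  assumes "\<Phi> z \<noteq> 0"
  shows "ln (1 + norm (lam z)) \<le> (real (card A) + 2) * E z"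
proof -
  have pos: "ln (1 + norm (D c z)) \<ge> 0" for c by simp
  have posLW: "ln (1 + norm (LW z)) \<ge> 0" by simp
  have mb: "m b \<le> card A" if "b \<in> B" for b
    using m_sum member_le_sum[of b B m] that finB by simp
  have "ln (1 + norm (lam z)) \<le> ln (1 + norm ((\<Sum>b\<in>B. of_nat (m b) * D b z) + LW z)) + ln (1 + norm (of_nat 2 * (\<Sum>a\<in>A. D a z)))"
    unfolding lam_eq[OF assms] by (rule ln_one_plus_norm_diff_le)
  also have "\<dots> \<le> (ln (1 + norm (\<Sum>b\<in>B. of_nat (m b) * D b z)) + ln (1 + norm (LW z))) + 2 * ln (1 + norm (\<Sum>a\<in>A. D a z))"
    using ln_one_plus_norm_mult_le[of 2 "\<Sum>a\<in>A. D a z"] by (intro add_mono ln_one_plus_norm_add_le) simp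
  also have "\<dots> \<le> ((\<Sum>b\<in>B. ln (1 + norm (of_nat (m b) * D b z))) + ln (1 + norm (LW z))) + 2 * (\<Sum>a\<in>A. ln (1 + norm (D a z)))"
    by (intro add_mono mult_left_mono ln_one_plus_norm_sum_le finA finB) auto
  also have "(\<Sum>b\<in>B. ln (1 + norm (of_nat (m b) * D b z))) \<le> (\<Sum>b\<in>B. real (card A) * ln (1 + norm (D b z)))"
  proof (rule sum_mono)
    fix b assume "b \<in> B"
    have "ln (1 + norm (of_nat (m b) * D b z)) \<le> real (m b) * ln (1 + norm (D b z))"
      by (rule ln_one_plus_norm_mult_le)
    also have "\<dots> \<le> real (card A) * ln (1 + norm (D b z))"
      using mb[OF \<open>b \<in> B\<close>] by (intro mult_right_mono) auto
    finally show "ln (1 + norm (of_nat (m b) * D b z)) \<le> real (card A) * ln (1 + norm (D b z))" .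
  qed
  finally have "ln (1 + norm (lam z)) \<le> real (card A) * (\<Sum>b\<in>B. ln (1 + norm (D b z))) + ln (1 + norm (LW z)) + 2 * (\<Sum>a\<in>A. ln (1 + norm (D a z)))"
    by (simp add: sum_distrib_left)
  also have "\<dots> \<le> (real (card A) + 2) * (\<Sum>b\<in>B. ln (1 + norm (D b z))) + (real (card A) + 2) * ln (1 + norm (LW z)) + (real (card A) + 2) * (\<Sum>a\<in>A. ln (1 + norm (D a z)))"
  proof -
    have "(\<Sum>b\<in>B. ln (1 + norm (D b z))) \<ge> 0" "(\<Sum>a\<in>A. ln (1 + norm (D a z))) \<ge> 0"
      by (simp_all add: sum_nonneg)
    then show ?thesis using posLW by (intro add_mono mult_right_mono) (auto simp: algebra_simps)
  qed
  also have "\<dots> = (real (card A) + 2) * E z"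
    unfolding E_def using finA finB disj by (simp add: sum.union_disjoint algebra_simps)
  finally show ?thesis .
qed

text \<open>At most one of the values \<open>f1 z - c * f0 z\<close> can be small compared with \<open>M z\<close>.\<close>

lemma M_power_le:
  assumes C: "finite C" "C \<noteq> {}"
  obtains K where "K > 0" "\<And>z. M z ^ (card C - 1) \<le> K * (\<Sum>c\<in>C. \<Prod>c'\<in>C - {c}. norm (lin c' z))"
proof -
  obtain \<delta> where \<delta>: "0 < \<delta>" "\<delta> \<le> 1" "\<And>c c'. c \<in> C \<Longrightarrow> c' \<in> C \<Longrightarrow> c \<noteq> c' \<Longrightarrow> \<delta> \<le> norm (c - c')"
  proof -
    define X where "X = insert 1 ((\<lambda>(c, c'). norm (c - c')) ` {(c, c'). c \<in> C \<and> c' \<in> C \<and> c \<noteq> c'})"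
    have "{(c, c'). c \<in> C \<and> c' \<in> C \<and> c \<noteq> c'} \<subseteq> C \<times> C" by auto
    then have "finite X" unfolding X_def using C by (meson finite.insertI finite_SigmaI finite_imageI finite_subset)
    moreover have "X \<noteq> {}" by (simp add: X_def)
    ultimately have "Min X \<in> X" and le: "\<And>x. x \<in> X \<Longrightarrow> Min X \<le> x" by auto
    then have "Min X > 0" by (auto simp: X_def)
    moreover have "Min X \<le> 1" using le by (simp add: X_def)
    moreover have "Min X \<le> norm (c - c')" if "c \<in> C" "c' \<in> C" "c \<noteq> c'" for c c'
      using that by (intro le) (auto simp: X_def)
    ultimately show ?thesis using that by blast
  qed
  obtain \<beta> where \<beta>: "\<beta> \<ge> 0" "\<And>c. c \<in> C \<Longrightarrow> norm c \<le> \<beta>"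
    by (meson C(1) bounded_iff finite_imp_bounded norm_ge_zero order_trans C(2) ex_in_conv)
  \<comment> \<open>If two forms were below \<open>\<epsilon> * M z\<close>, their difference would
    make \<open>norm (f0 z)\<close> small, as \<open>c - c'\<close> has modulus at least
    \<open>\<delta>\<close>, and either form would then make \<open>norm (f1 z)\<close> small. With
    this \<open>\<epsilon>\<close> both fall below their maximum \<open>M z\<close>, a
    contradiction.\<close>
  define \<epsilon> where "\<epsilon> = \<delta> / (4 * (1 + \<beta>))"
  have \<epsilon>: "\<epsilon> > 0" using \<delta> \<beta> by (simp add: \<epsilon>_def)
  have uniq: "c = c'" if "c \<in> C" "c' \<in> C" "norm (lin c z) < \<epsilon> * M z" "norm (lin c' z) < \<epsilon> * M z" for c c' z
  proof (rule ccontr)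
    assume ne: "c \<noteq> c'"
    have "(c' - c) * f0 z = lin c z - lin c' z" by (simp add: lin_def algebra_simps)
    then have "norm (c' - c) * norm (f0 z) = norm (lin c z - lin c' z)" by (simp flip: norm_mult)
    also have "\<dots> < 2 * \<epsilon> * M z" using norm_triangle_ineq4[of "lin c z" "lin c' z"] that by linarith
    finally have "\<delta> * norm (f0 z) < 2 * \<epsilon> * M z"
      using \<delta>(3)[OF that(2,1)] ne mult_right_mono[of \<delta> "norm (c' - c)" "norm (f0 z)"] by fastforce
    also have "2 * \<epsilon> * M z = \<delta> * (M z / (2 * (1 + \<beta>)))" using \<beta> by (simp add: \<epsilon>_def field_simps)
    finally have a: "norm (f0 z) < M z / (2 * (1 + \<beta>))" using \<delta>(1) by (simp only: mult_less_cancel_left_pos)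
    have "norm (f1 z) = norm (lin c z + c * f0 z)" by (simp add: lin_def)
    also have "\<dots> \<le> norm (lin c z) + norm c * norm (f0 z)"
      using norm_triangle_ineq[of "lin c z" "c * f0 z"] by (simp add: norm_mult)
    also have "\<dots> < \<epsilon> * M z + (1 + \<beta>) * (M z / (2 * (1 + \<beta>)))"
    proof (rule add_less_le_mono[OF that(3)])
      show "norm c * norm (f0 z) \<le> (1 + \<beta>) * (M z / (2 * (1 + \<beta>)))"
        using a \<beta>(2)[OF that(1)] \<beta>(1) by (intro mult_mono) auto
    qed
    also have "(1 + \<beta>) * (M z / (2 * (1 + \<beta>))) = M z / 2" using \<beta> by (simp add: field_simps)
    also have "\<epsilon> \<le> 1 / 4" using \<delta> \<beta> by (simp add: \<epsilon>_def field_simps)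
    then have "\<epsilon> * M z + M z / 2 \<le> 1 / 4 * M z + M z / 2" using M_pos[of z] by (intro add_right_mono mult_right_mono) auto
    finally have "norm (f1 z) < M z" using M_pos[of z] by simp
    moreover have "M z / (2 * (1 + \<beta>)) \<le> M z / 1" using M_pos[of z] \<beta> by (intro divide_left_mono) auto
    then have "norm (f0 z) < M z" using a by simp
    ultimately show False by (auto simp: M_def max_def split: if_splits)
  qed
  show ?thesis
  proof (rule that[of "1 / \<epsilon> ^ (card C - 1)"])
    show "1 / \<epsilon> ^ (card C - 1) > 0" using \<epsilon> by simp
    fix z
    obtain c where c: "c \<in> C" "\<And>c'. c' \<in> C - {c} \<Longrightarrow> norm (lin c' z) \<ge> \<epsilon> * M z"
    proof (cases "\<exists>c\<in>C. norm (lin c z) < \<epsilon> * M z")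
      case True
      then obtain c where c: "c \<in> C" "norm (lin c z) < \<epsilon> * M z" by auto
      show ?thesis
      proof (rule that[OF c(1)])
        show "norm (lin c' z) \<ge> \<epsilon> * M z" if "c' \<in> C - {c}" for c'
          using uniq[OF c(1) _ c(2), of c'] that by fastforce
      qed
    next
      case False
      obtain c where "c \<in> C" using C(2) by auto
      then show ?thesis using that[of c] False by (meson Diff_iff not_le)
    qed
    have "(\<epsilon> * M z) ^ (card C - 1) = (\<Prod>c'\<in>C - {c}. \<epsilon> * M z)" using c(1) C by simp
    also have "\<dots> \<le> (\<Prod>c'\<in>C - {c}. norm (lin c' z))"
      using c(2) \<epsilon> M_pos[of z] by (intro prod_mono) (auto simp: less_imp_le)
    also have "\<dots> \<le> (\<Sum>c\<in>C. \<Prod>c'\<in>C - {c}. norm (lin c' z))"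
      by (rule member_le_sum[of c C "\<lambda>c. \<Prod>c'\<in>C - {c}. norm (lin c' z)"]) (use c C in \<open>auto intro: prod_nonneg\<close>)
    finally show "M z ^ (card C - 1) \<le> 1 / \<epsilon> ^ (card C - 1) * (\<Sum>c\<in>C. \<Prod>c'\<in>C - {c}. norm (lin c' z))"
      using \<epsilon> by (simp add: power_mult_distrib field_simps)
  qed
qed

text \<open>A pointwise second main theorem for the values in \<open>A \<union> B\<close>.
  \<open>W\<close> times all forms except \<open>lin c\<close> is \<open>D c * f0\<close> times the
  product of all forms. Summing over \<open>c\<close> allows \<open>M_power_le\<close> to be used,
  and the sum of the \<open>norm (D c z)\<close> is at most \<open>exp (E z)\<close>.\<close>

lemma ln_W_le:
  obtains K where "\<And>z. \<Phi> z \<noteq> 0 \<Longrightarrow>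
    ln (norm (W z)) + real (card (A \<union> B) - 1) * ln (M z) - ln (norm (St z)) - ln (norm (Bt z)) - ln (norm (f0 z)) \<le> K + E z"
proof -
  define C where "C = A \<union> B"
  have C: "finite C" "C \<noteq> {}" using finA finB A_ne by (auto simp: C_def)
  obtain K where K: "K > 0" "\<And>z. M z ^ (card C - 1) \<le> K * (\<Sum>c\<in>C. \<Prod>c'\<in>C - {c}. norm (lin c' z))"
    using M_power_le[OF C] by blast
  show ?thesis
  proof (rule that[of "ln K"])
    fix z assume z: "\<Phi> z \<noteq> 0"
    note nz = \<Phi>_nzD[OF z]
    define p where "p = (\<Prod>c\<in>C. norm (lin c z))"
    have p0: "p > 0" unfolding p_def using nz(3) by (intro prod_pos) (auto simp: C_def)
    have p: "p = norm (St z) * norm (Bt z)"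
      unfolding p_def C_def St_def Bt_def using finA finB disj by (simp add: prod.union_disjoint prod_norm norm_mult)
    have "norm (W z) * M z ^ (card C - 1) \<le> norm (W z) * (K * (\<Sum>c\<in>C. \<Prod>c'\<in>C - {c}. norm (lin c' z)))"
      by (intro mult_left_mono K) auto
    also have "\<dots> = K * (p * norm (f0 z) * (\<Sum>c\<in>C. norm (D c z)))"
    proof -
      have "norm (W z) * (\<Prod>c'\<in>C - {c}. norm (lin c' z)) = p * norm (f0 z) * norm (D c z)" if "c \<in> C" for c
      proof -
        have "p = norm (lin c z) * (\<Prod>c'\<in>C - {c}. norm (lin c' z))"
          unfolding p_def using that C by (intro prod.remove)
        moreover have "lin c z \<noteq> 0" using nz(3) that by (simp add: C_def)
        ultimately show ?thesis using nz(1) by (simp add: D_eq norm_divide norm_mult)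
      qed
      then show ?thesis by (simp add: sum_distrib_left mult.left_commute cong: sum.cong)
    qed
    finally have "norm (W z) * M z ^ (card C - 1) \<le> K * (p * norm (f0 z) * (\<Sum>c\<in>C. norm (D c z)))" .
    also have "\<dots> \<le> K * (p * norm (f0 z) * exp (E z))"
    proof (intro mult_left_mono)
      have "(\<Sum>c\<in>C. norm (D c z)) \<le> (\<Prod>c\<in>C. 1 + norm (D c z))"
        using C(1) 
      proof (induction C rule: finite_induct)
        case (insert c C)
        have "(\<Prod>c\<in>C. 1 + norm (D c z)) \<ge> 1" by (intro prod_ge_1) auto
        then have "norm (D c z) * 1 \<le> norm (D c z) * (\<Prod>c\<in>C. 1 + norm (D c z))" by (intro mult_left_mono) auto
        then show ?case using insert by (simp add: algebra_simps)
      qed auto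
      also have "\<dots> = exp (\<Sum>c\<in>C. ln (1 + norm (D c z)))"
        using C(1) by (simp add: exp_sum add_pos_nonneg)
      also have "\<dots> \<le> exp (E z)" by (simp add: E_def C_def)
      finally show "(\<Sum>c\<in>C. norm (D c z)) \<le> exp (E z)" .
    qed (use K p0 in auto)
    finally have "ln (norm (W z) * M z ^ (card C - 1)) \<le> ln (K * (p * norm (f0 z) * exp (E z)))"
      using nz K p0 M_pos[of z] by (subst ln_le_cancel_iff) auto
    also have "ln (K * (p * norm (f0 z) * exp (E z))) = ln K + (ln (norm (St z)) + ln (norm (Bt z)) + ln (norm (f0 z)) + E z)"
      using K nz unfolding p by (simp add: ln_mult_pos)
    also have "ln (norm (W z) * M z ^ (card C - 1)) = ln (norm (W z)) + real (card C - 1) * ln (M z)"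
      using nz M_pos[of z] by (simp add: ln_mult_pos ln_realpow)
    finally show "ln (norm (W z)) + real (card (A \<union> B) - 1) * ln (M z) - ln (norm (St z)) - ln (norm (Bt z)) - ln (norm (f0 z)) \<le> ln K + E z"
      by (simp add: C_def)
  qed
qed

lemma ln_prod_lin_le:
  assumes "finite C" "\<And>c. c \<in> C \<Longrightarrow> lin c z \<noteq> 0"
  shows "ln (norm (\<Prod>c\<in>C. lin c z)) \<le> (\<Sum>c\<in>C. ln (1 + norm c)) + real (card C) * ln (M z)"
proof -
  have "ln (norm (\<Prod>c\<in>C. lin c z)) = (\<Sum>c\<in>C. ln (norm (lin c z)))"
    using assms by (simp add: ln_prod flip: prod_norm)
  also have "\<dots> \<le> (\<Sum>c\<in>C. ln (1 + norm c) + ln (M z))" using assms by (intro sum_mono ln_norm_lin_le) auto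
  finally show ?thesis by (simp add: sum.distrib)
qed

end

lemma logderiv_continuous_on:
  assumes "u holomorphic_on UNIV" "\<And>z. z \<in> S \<Longrightarrow> u z \<noteq> 0"
  shows "continuous_on S (logderiv u)"
  unfolding logderiv_def using assms
  by (intro continuous_intros continuous_on_subset[OF holomorphic_on_imp_continuous_on[OF assms(1)]]
      continuous_on_subset[OF holomorphic_on_imp_continuous_on[OF holomorphic_deriv[OF assms(1) open_UNIV]]]) auto

lemma ln_norm_continuous_on:
  assumes "u holomorphic_on UNIV" "\<And>z. z \<in> S \<Longrightarrow> u z \<noteq> 0"
  shows "continuous_on S (\<lambda>z. ln (norm (u z)))"
  using assms
  by (intro continuous_intros continuous_on_subset[OF holomorphic_on_imp_continuous_on[OF assms(1)]]) auto

lemma ln_one_plus_norm_continuous_on: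
  fixes D :: "complex \<Rightarrow> complex"
  shows "continuous_on S D \<Longrightarrow> continuous_on S (\<lambda>z. ln (1 + norm (D z)))"
proof (intro continuous_intros)
  show "\<forall>z\<in>S. 1 + norm (D z) \<noteq> 0"
    using norm_ge_zero by (metis add_nonneg_eq_0_iff zero_le_one zero_neq_one)
qed

text \<open>The disc of radius \<open>y\<close> contains finitely many zeros, so only finitely many
  radii are excluded.\<close>

lemma zero_free_circle:
  assumes \<Psi>: "\<Psi> holomorphic_on UNIV" "\<Psi> w \<noteq> 0" and xy: "x < y"
  obtains \<rho> where "x < \<rho>" "\<rho> < y" "\<And>z. z \<in> sphere p \<rho> \<Longrightarrow> \<Psi> z \<noteq> 0"
proof -
  have "finite {z \<in> cball p y. \<Psi> z = 0}" by (rule entire_finite_zeros[OF \<Psi> compact_cball])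
  then have "finite (dist p ` {z \<in> cball p y. \<Psi> z = 0})" by simp
  moreover have "infinite {x<..<y}" using xy by (rule infinite_Ioo)
  ultimately obtain \<rho> where \<rho>: "\<rho> \<in> {x<..<y}" "\<rho> \<notin> dist p ` {z \<in> cball p y. \<Psi> z = 0}"
    by (meson finite_subset subsetI)
  show ?thesis
  proof (rule that[of \<rho>])
    fix z assume "z \<in> sphere p \<rho>"
    then show "\<Psi> z \<noteq> 0" using \<rho> by auto
  qed (use \<rho> in auto)
qed

lemma entire_mult_nz:
  assumes "u holomorphic_on UNIV" "v holomorphic_on UNIV" "\<exists>z. u z \<noteq> 0" "\<exists>z. v z \<noteq> 0"
  shows "\<exists>z. u z * v z \<noteq> (0::complex)"
proof -
  have "finite {z \<in> cball 0 1. u z = 0}" "finite {z \<in> cball 0 1. v z = 0}"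
    using assms entire_finite_zeros[OF _ _ compact_cball] by blast+
  then have "finite ({z \<in> cball 0 1. u z = 0} \<union> {z \<in> cball 0 1. v z = 0})" by simp
  moreover have "infinite (cball (0::complex) 1)"
    using uncountable_cball[of 1 "0::complex"] countable_finite by auto
  ultimately obtain z where "z \<in> cball 0 1" "z \<notin> {z \<in> cball 0 1. u z = 0} \<union> {z \<in> cball 0 1. v z = 0}"
    by (meson finite_subset subsetI)
  then show ?thesis by auto
qed

lemma entire_prod_nz:
  assumes "finite I" "\<And>i. i \<in> I \<Longrightarrow> u i holomorphic_on UNIV" "\<And>i. i \<in> I \<Longrightarrow> \<exists>z. u i z \<noteq> 0"
  shows "\<exists>z. (\<Prod>i\<in>I. u i z) \<noteq> (0::complex)"
  using assms
proof (induction I rule: finite_induct)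
  case (insert i I)
  then have "\<exists>z. u i z * (\<Prod>i\<in>I. u i z) \<noteq> 0" by (intro entire_mult_nz holomorphic_intros) auto
  then show ?case using insert by simp
qed auto

section \<open>Means of the error terms over circles\<close>

definition err :: "real \<Rightarrow> real \<Rightarrow> real" where "err h \<tau> = 1 + ln (1 / h) + ln (1 + \<tau>)"

lemma err_ge_1: "0 < h \<Longrightarrow> h \<le> 1 \<Longrightarrow> 0 \<le> \<tau> \<Longrightarrow> err h \<tau> \<ge> 1"
  unfolding err_def using ln_ge_zero[of "1 / h"] ln_ge_zero[of "1 + \<tau>"] by simp

text \<open>The bound on \<open>\<kappa>\<close> may itself contain \<open>err\<close>: for the
  logarithmic derivative of $f'$, the characteristic that enters is known only up to such an error.
  Under the logarithm this is harmless, as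
  \<open>ln (err h \<tau>) \<le> err h \<tau>\<close>.\<close>

lemma ln_le_err:
  assumes h: "0 < h" "h \<le> 1" and \<tau>: "0 \<le> \<tau>" and k: "0 \<le> k" and \<kappa>: "0 \<le> \<kappa>" "\<kappa> \<le> k * (1 + \<tau>) * err h \<tau>"
  shows "2 * ln (130 * (1 + \<kappa>) / h) \<le> (2 * ln 130 + 2 * ln (1 + k) + 4) * err h \<tau>"
proof -
  have e1: "err h \<tau> \<ge> 1" using h \<tau> by (rule err_ge_1)
  have "1 * 1 \<le> (1 + \<tau>) * err h \<tau>" using e1 \<tau> by (intro mult_mono) auto
  then have "1 + \<kappa> \<le> (1 + k) * ((1 + \<tau>) * err h \<tau>)" using \<kappa>(2) by (simp add: algebra_simps)
  then have "ln (1 + \<kappa>) \<le> ln ((1 + k) * ((1 + \<tau>) * err h \<tau>))"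
    using \<kappa> e1 \<tau> k by (subst ln_le_cancel_iff) (auto intro!: mult_pos_pos)
  also have "\<dots> = ln (1 + k) + (ln (1 + \<tau>) + ln (err h \<tau>))"
    using e1 \<tau> k by (simp add: ln_mult_pos)
  also have "ln (err h \<tau>) \<le> err h \<tau>" using e1 ln_le_minus_one[of "err h \<tau>"] by simp
  finally have 1: "ln (1 + \<kappa>) \<le> ln (1 + k) + (ln (1 + \<tau>) + err h \<tau>)" by simp
  have "ln (130 * (1 + \<kappa>) / h) = ln 130 + ln (1 + \<kappa>) + ln (1 / h)"
    using h \<kappa> by (simp add: ln_mult_pos ln_div del: distrib_left_numeral)
  also have "\<dots> \<le> ln 130 + ln (1 + k) + 2 * err h \<tau>" using 1 by (simp add: err_def)
  also have "ln 130 + ln (1 + k) \<le> (ln 130 + ln (1 + k)) * err h \<tau>"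
    using mult_left_mono[of 1 "err h \<tau>" "ln 130 + ln (1 + k)"] e1 k by simp
  finally show ?thesis by (simp add: algebra_simps)
qed

context entire_pair
begin

lemma D_continuous_on:
  assumes "c \<in> A \<union> B" "\<And>z. z \<in> S \<Longrightarrow> \<Phi> z \<noteq> 0"
  shows "continuous_on S (D c)"
  unfolding D_def
  by (intro continuous_intros logderiv_continuous_on lin_holomorphic f0) (use \<Phi>_nzD assms in blast)+

lemma LW_continuous_on:
  assumes "\<And>z. z \<in> S \<Longrightarrow> \<Phi> z \<noteq> 0"
  shows "continuous_on S LW"
  unfolding LW_def
  by (intro continuous_intros logderiv_continuous_on W_holomorphic holomorphic_intros f0)
    (use \<Phi>_nzD assms in \<open>auto\<close>)

lemma E_continuous_on:
  assumes "\<And>z. z \<in> S \<Longrightarrow> \<Phi> z \<noteq> 0"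
  shows "continuous_on S E"
  unfolding E_def
  by (intro continuous_on_add continuous_on_sum ln_one_plus_norm_continuous_on D_continuous_on LW_continuous_on assms)

text \<open>The shape of one application of the lemma on the logarithmic derivative, with its two
  outer circles. \<open>K\<close> is fixed before all radii, and \<open>\<tau>\<close> has to bound
  the characteristic on the outer circles only.\<close>

definition mean_bound2 :: "complex \<Rightarrow> (complex \<Rightarrow> real) \<Rightarrow> real \<Rightarrow> bool" where
  "mean_bound2 p \<phi> K \<longleftrightarrow> (\<forall>r h R R2 \<tau>. 1 \<le> r \<longrightarrow> 0 < h \<longrightarrow> h \<le> 1 \<longrightarrow> r * (1 + h) \<le> R \<longrightarrow>
     R * (1 + h) \<le> R2 \<longrightarrow> 0 \<le> \<tau> \<longrightarrow> (\<forall>z. dist p z \<in> {r, R, R2} \<longrightarrow> \<Phi> z \<noteq> 0) \<longrightarrow>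
     (\<forall>\<rho>\<in>{R, R2}. circle_mean p \<rho> (\<lambda>z. ln (M z)) \<le> \<tau>) \<longrightarrow> circle_mean p r \<phi> \<le> K * err h \<tau>)"

text \<open>The shape of two nested applications: an estimate on \<open>R1\<close> and
  \<open>R2\<close> comes first, and each of these two circles needs the next two further
  out.\<close>

definition mean_bound4 :: "complex \<Rightarrow> (complex \<Rightarrow> real) \<Rightarrow> real \<Rightarrow> bool" where
  "mean_bound4 p \<phi> K \<longleftrightarrow> (\<forall>r h R1 R2 R3 R4 \<tau>. 1 \<le> r \<longrightarrow> 0 < h \<longrightarrow> h \<le> 1 \<longrightarrow> r * (1 + h) \<le> R1 \<longrightarrow>
     R1 * (1 + h) \<le> R2 \<longrightarrow> R2 * (1 + h) \<le> R3 \<longrightarrow> R3 * (1 + h) \<le> R4 \<longrightarrow> 0 \<le> \<tau> \<longrightarrow>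
     (\<forall>z. dist p z \<in> {r, R1, R2, R3, R4} \<longrightarrow> \<Phi> z \<noteq> 0) \<longrightarrow>
     (\<forall>\<rho>\<in>{R1, R2, R3, R4}. circle_mean p \<rho> (\<lambda>z. ln (M z)) \<le> \<tau>) \<longrightarrow> circle_mean p r \<phi> \<le> K * err h \<tau>)"

text \<open>The lemma on the logarithmic derivative for \<open>lin c\<close> and \<open>f0\<close>,
  both of which are at most \<open>(1 + norm c) * M\<close> in modulus.\<close>

lemma circle_mean_D_le:
  assumes p: "\<Phi> p \<noteq> 0" and c: "c \<in> A \<union> B"
  shows "\<exists>K\<ge>0. mean_bound2 p (\<lambda>z. ln (1 + norm (D c z))) K"
proof -
  define k where "k = 2 + (2 * ln (1 + norm c) + \<bar>ln (norm (lin c p))\<bar> + \<bar>ln (norm (f0 p))\<bar>)"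
  have k: "k \<ge> 0" by (simp add: k_def)
  show ?thesis
  proof (rule exI[of _ "2 * ln 130 + 2 * ln (1 + k) + 4"], intro conjI)
    show "0 \<le> 2 * ln 130 + 2 * ln (1 + k) + 4" using k by simp
    show "mean_bound2 p (\<lambda>z. ln (1 + norm (D c z))) (2 * ln 130 + 2 * ln (1 + k) + 4)"
      unfolding mean_bound2_def
    proof (intro allI impI)
      fix r h R R2 \<tau> :: real
      assume r: "1 \<le> r" and h: "0 < h" "h \<le> 1" and R: "r * (1 + h) \<le> R" "R * (1 + h) \<le> R2" and \<tau>: "0 \<le> \<tau>"
        and nz0: "\<forall>z. dist p z \<in> {r, R, R2} \<longrightarrow> \<Phi> z \<noteq> 0"
        and T0: "\<forall>\<rho>\<in>{R, R2}. circle_mean p \<rho> (\<lambda>z. ln (M z)) \<le> \<tau>"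
      note nz = nz0[rule_format] and T = T0[rule_format]
      have step: "1 \<le> y" if "1 \<le> x" "x * (1 + h) \<le> y" for x y :: real
        using that h mult_mono[of 1 x 1 "1 + h"] by simp
      have "R \<ge> 1" by (rule step[OF r R(1)])
      moreover from this have "R2 \<ge> 1" using R(2) by (rule step)
      ultimately have R0: "R \<ge> 0" "R2 \<ge> 0" by auto
      have mx: "circle_mean p \<rho> (\<lambda>z. max (ln (norm (lin c z))) (ln (norm (f0 z)))) \<le> \<tau> + ln (1 + norm c)"
        if \<rho>: "\<rho> \<in> {R, R2}" for \<rho>
      proof -
        have nz': "\<Phi> z \<noteq> 0" if "z \<in> sphere p \<rho>" for z using nz[of z] \<rho> that by auto
        have \<rho>0: "\<rho> \<ge> 0" using \<rho> R0 by auto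
        have "circle_mean p \<rho> (\<lambda>z. max (ln (norm (lin c z))) (ln (norm (f0 z)))) \<le> circle_mean p \<rho> (\<lambda>z. ln (1 + norm c) + ln (M z))"
        proof (rule circle_mean_mono[OF \<rho>0])
          show "continuous_on (sphere p \<rho>) (\<lambda>z. max (ln (norm (lin c z))) (ln (norm (f0 z))))"
            by (intro continuous_on_max ln_norm_continuous_on lin_holomorphic f0) (use nz' \<Phi>_nzD c in blast)+
          show "continuous_on (sphere p \<rho>) (\<lambda>z. ln (1 + norm c) + ln (M z))"
            by (intro continuous_on_add continuous_on_const M_continuous)
          fix z assume "z \<in> sphere p \<rho>"
          then have "\<Phi> z \<noteq> 0" by (rule nz')
          then have "lin c z \<noteq> 0" "f0 z \<noteq> 0" using \<Phi>_nzD c by blast+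
          moreover have "ln (1 + norm c) \<ge> 0" by simp
          ultimately show "max (ln (norm (lin c z))) (ln (norm (f0 z))) \<le> ln (1 + norm c) + ln (M z)"
            using ln_norm_lin_le[of c z] ln_norm_f0_le[of z] by (intro max.boundedI; linarith)
        qed
        also have "\<dots> = ln (1 + norm c) + circle_mean p \<rho> (\<lambda>z. ln (M z))"
          by (subst circle_mean_add[OF \<rho>0]) (auto intro!: M_continuous)
        finally show ?thesis using T[OF \<rho>] by simp
      qed
      define \<kappa> where "\<kappa> = 2 * (\<tau> + ln (1 + norm c)) + \<bar>ln (norm (lin c p))\<bar> + \<bar>ln (norm (f0 p))\<bar>"
      have \<kappa>0: "\<kappa> \<ge> 0" using \<tau> by (simp add: \<kappa>_def)
      have "circle_mean p r (\<lambda>z. ln (1 + norm (D c z))) \<le> 2 * ln (130 * (1 + \<kappa>) / h)"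
        unfolding D_def
      proof (rule logderiv_mean_le[OF lin_holomorphic _ f0 _ r h R])
        show "lin c p \<noteq> 0" "f0 p \<noteq> 0" using \<Phi>_nzD[OF p] c by auto
        show "lin c z \<noteq> 0 \<and> f0 z \<noteq> 0" if "dist p z \<in> {r, R, R2}" for z using nz[OF that] \<Phi>_nzD c by blast
        show "2 * (\<tau> + ln (1 + norm c)) - ln (norm (lin c p)) - ln (norm (f0 p)) \<le> \<kappa>" by (simp add: \<kappa>_def)
      qed (use mx in auto)
      also have "\<dots> \<le> (2 * ln 130 + 2 * ln (1 + k) + 4) * err h \<tau>"
      proof (rule ln_le_err[OF h \<tau> k \<kappa>0])
        have e: "err h \<tau> \<ge> 1" using h \<tau> by (rule err_ge_1)
        define k' where "k' = 2 * ln (1 + norm c) + \<bar>ln (norm (lin c p))\<bar> + \<bar>ln (norm (f0 p))\<bar>"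
        have "k' \<ge> 0" by (simp add: k'_def)
        have "\<kappa> = 2 * \<tau> + k'" by (simp add: \<kappa>_def k'_def)
        also have "\<dots> \<le> (2 + k') * (1 + \<tau>)" using \<tau> \<open>k' \<ge> 0\<close> by (simp add: algebra_simps)
        also have "2 + k' = k" by (simp add: k_def k'_def)
        also have "k * (1 + \<tau>) \<le> k * (1 + \<tau>) * err h \<tau>"
          using mult_left_mono[OF e, of "k * (1 + \<tau>)"] k \<tau> by simp
        finally show "\<kappa> \<le> k * (1 + \<tau>) * err h \<tau>" .
      qed
      finally show "circle_mean p r (\<lambda>z. ln (1 + norm (D c z))) \<le> (2 * ln 130 + 2 * ln (1 + k) + 4) * err h \<tau>" .
    qed
  qed
qed

text \<open>The lemma on the logarithmic derivative for \<open>W\<close> and \<open>f0^2\<close>.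
  \<open>W\<close> contains derivatives and is not bounded in terms of \<open>M\<close> alone; but
  \<open>W = D a * lin a * f0\<close> for any \<open>a\<close> in \<open>A\<close>, and the mean of
  \<open>ln (1 + norm (D a z))\<close> on \<open>R1\<close> and \<open>R2\<close> is already known
  to be at most a multiple of \<open>err\<close>.\<close>

lemma circle_mean_LW_le:
  assumes p: "\<Phi> p \<noteq> 0"
  shows "\<exists>K\<ge>0. mean_bound4 p (\<lambda>z. ln (1 + norm (LW z))) K"
proof -
  obtain a where a: "a \<in> A" using A_ne by auto
  then have aAB: "a \<in> A \<union> B" by simp
  obtain K where K: "K \<ge> 0" "mean_bound2 p (\<lambda>z. ln (1 + norm (D a z))) K"
    using circle_mean_D_le[OF p aAB] by blast
  define k' where "k' = 2 * ln (1 + norm a) + \<bar>ln (norm (W p))\<bar> + \<bar>ln (norm (f0 p ^ 2))\<bar>"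
  have k'0: "k' \<ge> 0" by (simp add: k'_def)
  define k where "k = 4 + 2 * K + k'"
  have k: "k \<ge> 0" using K k'0 by (simp add: k_def)
  show ?thesis
  proof (rule exI[of _ "2 * ln 130 + 2 * ln (1 + k) + 4"], intro conjI)
    show "0 \<le> 2 * ln 130 + 2 * ln (1 + k) + 4" using k by simp
    show "mean_bound4 p (\<lambda>z. ln (1 + norm (LW z))) (2 * ln 130 + 2 * ln (1 + k) + 4)"
      unfolding mean_bound4_def
    proof (intro allI impI)
      fix r h R1 R2 R3 R4 \<tau> :: real
      assume r: "1 \<le> r" and h: "0 < h" "h \<le> 1" and R: "r * (1 + h) \<le> R1" "R1 * (1 + h) \<le> R2"
         "R2 * (1 + h) \<le> R3" "R3 * (1 + h) \<le> R4" and \<tau>: "0 \<le> \<tau>"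
        and nz0: "\<forall>z. dist p z \<in> {r, R1, R2, R3, R4} \<longrightarrow> \<Phi> z \<noteq> 0"
        and T0: "\<forall>\<rho>\<in>{R1, R2, R3, R4}. circle_mean p \<rho> (\<lambda>z. ln (M z)) \<le> \<tau>"
      note nz = nz0[rule_format] and T = T0[rule_format]
      have step: "1 \<le> y" if "1 \<le> x" "x * (1 + h) \<le> y" for x y :: real
        using that h mult_mono[of 1 x 1 "1 + h"] by simp
      have R0: "R1 \<ge> 1" "R2 \<ge> 1" using step[OF step[OF r R(1)] R(2)] step[OF r R(1)] by auto
      define \<sigma> where "\<sigma> = 2 * \<tau> + ln (1 + norm a) + K * err h \<tau>"
      have mD: "circle_mean p \<rho> (\<lambda>z. ln (1 + norm (D a z))) \<le> K * err h \<tau>" if "\<rho> \<in> {R1, R2}" for \<rho>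
      proof -
        have "\<rho> = R1 \<or> \<rho> = R2" using that by auto
        moreover have "circle_mean p R1 (\<lambda>z. ln (1 + norm (D a z))) \<le> K * err h \<tau>"
          by (rule K(2)[unfolded mean_bound2_def, rule_format, OF R0(1) h R(2,3) \<tau>]) (use nz T in blast)+
        moreover have "circle_mean p R2 (\<lambda>z. ln (1 + norm (D a z))) \<le> K * err h \<tau>"
          by (rule K(2)[unfolded mean_bound2_def, rule_format, OF R0(2) h R(3,4) \<tau>]) (use nz T in blast)+
        ultimately show ?thesis by blast
      qed
      have mx: "circle_mean p \<rho> (\<lambda>z. max (ln (norm (W z))) (ln (norm (f0 z ^ 2)))) \<le> \<sigma>"
        if \<rho>: "\<rho> \<in> {R1, R2}" for \<rho>
      proof -
        have nz': "\<Phi> z \<noteq> 0" if "z \<in> sphere p \<rho>" for z using nz[of z] \<rho> that by auto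
        have \<rho>0: "\<rho> \<ge> 0" using \<rho> R0 by auto
        have cD: "continuous_on (sphere p \<rho>) (\<lambda>z. ln (1 + norm (D a z)))"
          by (intro ln_one_plus_norm_continuous_on D_continuous_on aAB nz')
        have c2: "continuous_on (sphere p \<rho>) (\<lambda>z. ln (1 + norm a) + 2 * ln (M z))"
          by (intro continuous_on_add continuous_on_const continuous_on_mult_left M_continuous)
        have "circle_mean p \<rho> (\<lambda>z. max (ln (norm (W z))) (ln (norm (f0 z ^ 2))))
           \<le> circle_mean p \<rho> (\<lambda>z. (ln (1 + norm a) + 2 * ln (M z)) + ln (1 + norm (D a z)))"
        proof (rule circle_mean_mono[OF \<rho>0])
          show "continuous_on (sphere p \<rho>) (\<lambda>z. max (ln (norm (W z))) (ln (norm (f0 z ^ 2))))"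
            by (intro continuous_on_max ln_norm_continuous_on W_holomorphic holomorphic_on_power f0) (use nz' \<Phi>_nzD in auto)
          show "continuous_on (sphere p \<rho>) (\<lambda>z. (ln (1 + norm a) + 2 * ln (M z)) + ln (1 + norm (D a z)))"
            by (intro continuous_on_add[OF c2] cD)
          fix z assume "z \<in> sphere p \<rho>"
          then have "\<Phi> z \<noteq> 0" by (rule nz')
          note nzz = \<Phi>_nzD[OF this]
          have la: "lin a z \<noteq> 0" using nzz(3) aAB by blast
          have 1: "ln (norm (f0 z ^ 2)) = 2 * ln (norm (f0 z))" using nzz(1) by (simp add: norm_power ln_realpow)
          have "norm (W z) = norm (D a z) * norm (lin a z) * norm (f0 z)"
            using D_eq[OF la nzz(1)] la nzz(1) by (simp add: norm_divide norm_mult)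
          moreover have "D a z \<noteq> 0" using D_eq[OF la nzz(1)] la nzz(1,2) by simp
          ultimately have "ln (norm (W z)) = ln (norm (D a z)) + ln (norm (lin a z)) + ln (norm (f0 z))"
            using la nzz(1) by (simp add: ln_mult_pos)
          moreover have "ln (norm (D a z)) \<le> ln (1 + norm (D a z))" using \<open>D a z \<noteq> 0\<close> by (subst ln_le_cancel_iff) (auto intro: add_pos_nonneg)
          moreover have "ln (1 + norm (D a z)) \<ge> 0" "ln (1 + norm a) \<ge> 0" by simp_all
          ultimately show "max (ln (norm (W z))) (ln (norm (f0 z ^ 2))) \<le> (ln (1 + norm a) + 2 * ln (M z)) + ln (1 + norm (D a z))"
            using ln_norm_lin_le[OF la] ln_norm_f0_le[OF nzz(1)] 1 by (intro max.boundedI; linarith)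
        qed
        also have "\<dots> = ln (1 + norm a) + 2 * circle_mean p \<rho> (\<lambda>z. ln (M z)) + circle_mean p \<rho> (\<lambda>z. ln (1 + norm (D a z)))"
          using \<rho>0 cD c2 by (simp add: circle_mean_add circle_mean_cmult M_continuous continuous_on_mult_left)
        also have "\<dots> \<le> \<sigma>"
          using mD[OF \<rho>] T[of \<rho>] \<rho> by (auto simp: \<sigma>_def)
        finally show ?thesis .
      qed
      define \<kappa> where "\<kappa> = 2 * \<sigma> + \<bar>ln (norm (W p))\<bar> + \<bar>ln (norm (f0 p ^ 2))\<bar>"
      have e: "err h \<tau> \<ge> 1" using h \<tau> by (rule err_ge_1)
      have \<sigma>0: "\<sigma> \<ge> 0" using \<tau> K(1) e by (simp add: \<sigma>_def)
      have \<kappa>0: "\<kappa> \<ge> 0" using \<sigma>0 by (simp add: \<kappa>_def)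
      have "circle_mean p r (\<lambda>z. ln (1 + norm (LW z))) \<le> 2 * ln (130 * (1 + \<kappa>) / h)"
        unfolding LW_def
      proof (rule logderiv_mean_le[OF W_holomorphic _ holomorphic_on_power[OF f0] _ r h R(1,2)])
        show "W p \<noteq> 0" "f0 p ^ 2 \<noteq> 0" using \<Phi>_nzD[OF p] by auto
        show "W z \<noteq> 0 \<and> f0 z ^ 2 \<noteq> 0" if "dist p z \<in> {r, R1, R2}" for z
          using nz[of z] \<Phi>_nzD[of z] that by auto
        show "2 * \<sigma> - ln (norm (W p)) - ln (norm (f0 p ^ 2)) \<le> \<kappa>" by (simp add: \<kappa>_def)
      qed (use mx in auto)
      also have "\<dots> \<le> (2 * ln 130 + 2 * ln (1 + k) + 4) * err h \<tau>"
      proof (rule ln_le_err[OF h \<tau> k \<kappa>0])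
        have "\<kappa> = 4 * \<tau> + k' + 2 * K * err h \<tau>" by (simp add: \<kappa>_def k'_def \<sigma>_def)
        also have "\<dots> \<le> (4 + k') * (1 + \<tau>) + 2 * K * (1 + \<tau>) * err h \<tau>"
        proof (intro add_mono)
          show "4 * \<tau> + k' \<le> (4 + k') * (1 + \<tau>)" using \<tau> k'0 by (simp add: algebra_simps)
          have "1 * (K * err h \<tau>) \<le> (1 + \<tau>) * (K * err h \<tau>)" using \<tau> K(1) e by (intro mult_right_mono) auto
          then show "2 * K * err h \<tau> \<le> 2 * K * (1 + \<tau>) * err h \<tau>" by (simp add: algebra_simps)
        qed
        also have "(4 + k') * (1 + \<tau>) \<le> (4 + k') * (1 + \<tau>) * err h \<tau>"
          using mult_left_mono[OF e, of "(4 + k') * (1 + \<tau>)"] k'0 \<tau> by simp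
        also have "(4 + k') * (1 + \<tau>) * err h \<tau> + 2 * K * (1 + \<tau>) * err h \<tau> = k * (1 + \<tau>) * err h \<tau>"
          by (simp add: k_def algebra_simps)
        finally show "\<kappa> \<le> k * (1 + \<tau>) * err h \<tau>" by simp
      qed
      finally show "circle_mean p r (\<lambda>z. ln (1 + norm (LW z))) \<le> (2 * ln 130 + 2 * ln (1 + k) + 4) * err h \<tau>" .
    qed
  qed
qed

lemma circle_mean_E_le:
  assumes p: "\<Phi> p \<noteq> 0"
  shows "\<exists>K\<ge>0. mean_bound4 p E K"
proof -
  have "\<forall>c\<in>A\<union>B. \<exists>K\<ge>0. mean_bound2 p (\<lambda>z. ln (1 + norm (D c z))) K"
    using circle_mean_D_le[OF p] by blast
  then obtain KD where KD: "\<And>c. c \<in> A \<union> B \<Longrightarrow> KD c \<ge> 0"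
    "\<And>c. c \<in> A \<union> B \<Longrightarrow> mean_bound2 p (\<lambda>z. ln (1 + norm (D c z))) (KD c)" by metis
  obtain KW where KW: "KW \<ge> 0" "mean_bound4 p (\<lambda>z. ln (1 + norm (LW z))) KW"
    using circle_mean_LW_le[OF p] by blast
  have fin: "finite (A \<union> B)" using finA finB by simp
  show ?thesis
  proof (rule exI[of _ "(\<Sum>c\<in>A\<union>B. KD c) + KW"], intro conjI)
    show "0 \<le> (\<Sum>c\<in>A\<union>B. KD c) + KW" using KD(1) KW(1) by (intro add_nonneg_nonneg sum_nonneg)
    show "mean_bound4 p E ((\<Sum>c\<in>A\<union>B. KD c) + KW)"
      unfolding mean_bound4_def
    proof (intro allI impI)
      fix r h R1 R2 R3 R4 \<tau> :: real
      assume r: "1 \<le> r" and h: "0 < h" "h \<le> 1" and R: "r * (1 + h) \<le> R1" "R1 * (1 + h) \<le> R2"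
         "R2 * (1 + h) \<le> R3" "R3 * (1 + h) \<le> R4" and \<tau>: "0 \<le> \<tau>"
        and nz0: "\<forall>z. dist p z \<in> {r, R1, R2, R3, R4} \<longrightarrow> \<Phi> z \<noteq> 0"
        and T0: "\<forall>\<rho>\<in>{R1, R2, R3, R4}. circle_mean p \<rho> (\<lambda>z. ln (M z)) \<le> \<tau>"
      note nz = nz0[rule_format] and T = T0[rule_format]
      have nz': "\<Phi> z \<noteq> 0" if "z \<in> sphere p r" for z using nz[of z] that by auto
      have cD: "continuous_on (sphere p r) (\<lambda>z. ln (1 + norm (D c z)))" if "c \<in> A \<union> B" for c
        by (intro ln_one_plus_norm_continuous_on D_continuous_on nz' that)
      have cW: "continuous_on (sphere p r) (\<lambda>z. ln (1 + norm (LW z)))"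
        by (intro ln_one_plus_norm_continuous_on LW_continuous_on nz')
      have cS: "continuous_on (sphere p r) (\<lambda>z. \<Sum>c\<in>A\<union>B. ln (1 + norm (D c z)))"
        by (intro continuous_on_sum cD)
      have r0: "r \<ge> 0" using r by simp
      have "circle_mean p r E = circle_mean p r (\<lambda>z. \<Sum>c\<in>A\<union>B. ln (1 + norm (D c z))) + circle_mean p r (\<lambda>z. ln (1 + norm (LW z)))"
        unfolding E_def by (rule circle_mean_add[OF r0 cS cW])
      also have "circle_mean p r (\<lambda>z. \<Sum>c\<in>A\<union>B. ln (1 + norm (D c z))) = (\<Sum>c\<in>A\<union>B. circle_mean p r (\<lambda>z. ln (1 + norm (D c z))))"
        by (rule circle_mean_sum[OF r0 cD fin])
      also have "\<dots> \<le> (\<Sum>c\<in>A\<union>B. KD c * err h \<tau>)"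
      proof (rule sum_mono)
        fix c assume "c \<in> A \<union> B"
        show "circle_mean p r (\<lambda>z. ln (1 + norm (D c z))) \<le> KD c * err h \<tau>"
          by (rule KD(2)[OF \<open>c \<in> A \<union> B\<close>, unfolded mean_bound2_def, rule_format, OF r h R(1,2) \<tau>]) (use nz T in blast)+
      qed
      also have "circle_mean p r (\<lambda>z. ln (1 + norm (LW z))) \<le> KW * err h \<tau>"
        using KW(2) r h R \<tau> nz0 T0 unfolding mean_bound4_def by blast
      finally show "circle_mean p r E \<le> ((\<Sum>c\<in>A\<union>B. KD c) + KW) * err h \<tau>"
        by (simp add: sum_distrib_right distrib_right)
    qed
  qed
qed

lemma circle_mean_M_ge:
  assumes "\<Phi> p \<noteq> 0" "r > 0" "\<And>z. z \<in> sphere p r \<Longrightarrow> \<Phi> z \<noteq> 0"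
  shows "circle_mean p r (\<lambda>z. ln (M z)) \<ge> ln (norm (f0 p))"
proof -
  have "ln (norm (f0 p)) \<le> circle_mean p r (\<lambda>z. ln (norm (f0 z)))"
    using assms \<Phi>_nzD by (intro ln_le_circle_mean_center(1) f0) blast+
  also have "\<dots> \<le> circle_mean p r (\<lambda>z. ln (M z))"
    using assms \<Phi>_nzD(1)
    by (intro circle_mean_mono M_continuous ln_norm_continuous_on f0 ln_norm_f0_le) auto
  finally show ?thesis .
qed

text \<open>This makes the characteristic unbounded: if the value \<open>a\<close> is taken at
  \<open>w\<close>, the zero of \<open>lin a\<close> contributes \<open>ln (r / dist p w)\<close> to
  Jensen's formula.\<close>

lemma circle_mean_M_ge_ln:
  assumes a: "lin a w = 0" "lin a p \<noteq> 0" and r: "r > dist p w" "\<And>z. z \<in> sphere p r \<Longrightarrow> lin a z \<noteq> 0"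
  shows "circle_mean p r (\<lambda>z. ln (M z)) \<ge> ln (norm (lin a p)) + ln (r / dist p w) - ln (1 + norm a)"
proof -
  have r0: "r > 0" using r(1) zero_le_dist[of p w] by linarith
  have "ln (norm (lin a p)) + ln (r / dist p w) \<le> circle_mean p r (\<lambda>z. ln (norm (lin a z)))"
    by (rule ln_le_circle_mean_center(2)[OF lin_holomorphic a(2) r0 r(2) a(1) r(1)])
  also have "\<dots> \<le> circle_mean p r (\<lambda>z. ln (1 + norm a) + ln (M z))"
    using r0 r(2) by (intro circle_mean_mono continuous_on_add continuous_on_const M_continuous ln_norm_continuous_on lin_holomorphic ln_norm_lin_le) auto
  also have "\<dots> = ln (1 + norm a) + circle_mean p r (\<lambda>z. ln (M z))"
    using r0 by (subst circle_mean_add) (auto intro!: M_continuous)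
  finally show ?thesis by simp
qed

lemma \<Phi>_nz: "\<exists>z. \<Phi> z \<noteq> 0"
proof -
  have "\<exists>z. (\<Prod>c\<in>A\<union>B. lin c z) \<noteq> 0"
    using finA finB by (intro entire_prod_nz lin_holomorphic lin_nz) auto
  moreover have "\<exists>z. f0 z * W z \<noteq> 0" by (intro entire_mult_nz f0 W_holomorphic f0_nz wronskian_nz)
  ultimately show ?thesis unfolding \<Phi>_def
    by (intro entire_mult_nz[of "\<lambda>z. f0 z * W z"] holomorphic_intros f0 W_holomorphic lin_holomorphic)
qed

end

section \<open>The main estimate\<close>

text \<open>\<open>d\<close> is the price of the poles: \<open>ln (norm (f0 z))\<close> is 0 if
  \<open>f0\<close> is the constant 1, and at most \<open>ln (M z)\<close> in general. That an
  entire \<open>X\<close> with this identity exists is what the shared values have to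
  provide.\<close>

locale value_sharing =
  F: entire_pair f0 f1 A B m + G: entire_pair g0 g1 A B m
  for f0 f1 g0 g1 :: "complex \<Rightarrow> complex" and A B :: "complex set" and m :: "complex \<Rightarrow> nat" +
  fixes X :: "complex \<Rightarrow> complex" and d :: nat
  assumes X: "X holomorphic_on UNIV" "\<exists>z. X z \<noteq> 0"
    and X_eq: "F.\<Phi> z \<noteq> 0 \<Longrightarrow> G.\<Phi> z \<noteq> 0 \<Longrightarrow>
      X z * (F.St z * G.St z) = (F.W z * G.W z * (F.lam z - G.lam z) * (F.Bt z * f0 z * (G.Bt z * g0 z)))^2"
    and f0_le: "f0 z \<noteq> 0 \<Longrightarrow> ln (norm (f0 z)) \<le> real d * ln (F.M z)"
    and g0_le: "g0 z \<noteq> 0 \<Longrightarrow> ln (norm (g0 z)) \<le> real d * ln (G.M z)"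
    and card: "card A > 2 * card B + 2 + 4 * d"
begin

text \<open>Write n = \<open>card A\<close> and k = \<open>card B\<close>. Replacing
  \<open>2 * wf\<close> by means of the second main theorem leaves
  \<open>sf + 4 * bf + 4 * lf - 2 * (n + k - 1) * mf\<close>, which is at most
  \<open>(n + 4 * k + 4 * d - 2 * (n + k - 1)) * mf\<close> up to constants; the same holds for
  \<open>g\<close>. The error has weight 2 from the second main theorem and
  \<open>2 * (n + 2)\<close> from \<open>H\<close>.\<close>

lemma pointwise:
  "\<exists>K. \<forall>z. F.\<Phi> z \<noteq> 0 \<longrightarrow> G.\<Phi> z \<noteq> 0 \<longrightarrow> X z \<noteq> 0 \<longrightarrow>
    ln (norm (X z)) + real (card A - 2 * card B - 2 - 4 * d) * (ln (F.M z) + ln (G.M z))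
      \<le> K + (2 * real (card A) + 6) * (F.E z + G.E z)"
proof -
  obtain KF where KF: "\<And>z. F.\<Phi> z \<noteq> 0 \<Longrightarrow>
    ln (norm (F.W z)) + real (card (A \<union> B) - 1) * ln (F.M z) - ln (norm (F.St z)) - ln (norm (F.Bt z)) - ln (norm (f0 z)) \<le> KF + F.E z"
    by (rule F.ln_W_le, rule that)
  obtain KG where KG: "\<And>z. G.\<Phi> z \<noteq> 0 \<Longrightarrow>
    ln (norm (G.W z)) + real (card (A \<union> B) - 1) * ln (G.M z) - ln (norm (G.St z)) - ln (norm (G.Bt z)) - ln (norm (g0 z)) \<le> KG + G.E z"
    by (rule G.ln_W_le, rule that)
  define sA where "sA = (\<Sum>c\<in>A. ln (1 + norm c))"
  define sB where "sB = (\<Sum>c\<in>B. ln (1 + norm c))"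
  show ?thesis
  proof (rule exI[of _ "2 * KF + 2 * KG + 2 * sA + 8 * sB"], intro allI impI)
    fix z assume z: "F.\<Phi> z \<noteq> 0" "G.\<Phi> z \<noteq> 0" "X z \<noteq> 0"
    note nf = F.\<Phi>_nzD[OF z(1)] and ng = G.\<Phi>_nzD[OF z(2)]
    define H where "H = F.lam z - G.lam z"
    have H0: "H \<noteq> 0" using X_eq[OF z(1,2)] z(3) nf ng by (auto simp: H_def)
    define x where "x = ln (norm (X z))"
    define wf where "wf = ln (norm (F.W z))" define wg where "wg = ln (norm (G.W z))"
    define sf where "sf = ln (norm (F.St z))" define sg where "sg = ln (norm (G.St z))"
    define bf where "bf = ln (norm (F.Bt z))" define bg where "bg = ln (norm (G.Bt z))"
    define lf where "lf = ln (norm (f0 z))" define lg where "lg = ln (norm (g0 z))"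
    define mf where "mf = ln (F.M z)" define mg where "mg = ln (G.M z)"
    define \<eta> where "\<eta> = ln (norm H)"
    have "norm (X z) * (norm (F.St z) * norm (G.St z)) = (norm (F.W z) * norm (G.W z) * norm H * (norm (F.Bt z) * norm (f0 z) * (norm (G.Bt z) * norm (g0 z))))^2"
      using arg_cong[OF X_eq[OF z(1,2)], of norm] by (simp add: norm_mult norm_power H_def)
    then have "ln (norm (X z) * (norm (F.St z) * norm (G.St z))) = ln ((norm (F.W z) * norm (G.W z) * norm H * (norm (F.Bt z) * norm (f0 z) * (norm (G.Bt z) * norm (g0 z))))^2)"
      by simp
    then have eq: "x + sf + sg = 2 * (wf + wg + \<eta> + bf + lf + bg + lg)"
      using nf ng H0 z(3) unfolding x_def sf_def sg_def wf_def wg_def \<eta>_def bf_def bg_def lf_def lg_def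
      by (simp add: ln_mult_pos ln_realpow)
    have \<eta>: "\<eta> \<le> (real (card A) + 2) * (F.E z + G.E z)"
    proof -
      have "\<eta> \<le> ln (1 + norm H)" unfolding \<eta>_def using H0 by (subst ln_le_cancel_iff) (auto intro: add_pos_nonneg)
      also have "\<dots> \<le> ln (1 + norm (F.lam z)) + ln (1 + norm (G.lam z))"
        unfolding H_def by (rule ln_one_plus_norm_diff_le)
      also have "\<dots> \<le> (real (card A) + 2) * F.E z + (real (card A) + 2) * G.E z"
        by (intro add_mono F.ln_lam_le G.ln_lam_le z)
      finally show ?thesis by (simp add: algebra_simps)
    qed
    have q: "card (A \<union> B) - 1 = card A + card B - 1" using F.finA F.finB F.disj by (simp add: card_Un_disjoint)
    have A1: "card A \<ge> 1" using card by simp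
    define n where "n = real (card A)" define k where "k = real (card B)"
    have rq: "real (card (A \<union> B) - 1) = n + k - 1" unfolding q n_def k_def using A1 by (simp add: of_nat_diff)
    have rc: "real (card A - 2 * card B - 2 - 4 * d) = n - 2 * k - 2 - 4 * real d"
      unfolding n_def k_def using card by (simp add: of_nat_diff)
    have 1: "wf + (n + k - 1) * mf - sf - bf - lf \<le> KF + F.E z"
      using KF[OF z(1)] unfolding rq wf_def mf_def sf_def bf_def lf_def .
    have 2: "wg + (n + k - 1) * mg - sg - bg - lg \<le> KG + G.E z"
      using KG[OF z(2)] unfolding rq wg_def mg_def sg_def bg_def lg_def .
    have 3: "sf \<le> sA + n * mf" "sg \<le> sA + n * mg"
      unfolding sf_def sg_def sA_def n_def mf_def mg_def F.St_def G.St_def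
      using nf(3) ng(3) by (intro F.ln_prod_lin_le G.ln_prod_lin_le F.finA; blast)+
    have 4: "bf \<le> sB + k * mf" "bg \<le> sB + k * mg"
      unfolding bf_def bg_def sB_def k_def mf_def mg_def F.Bt_def G.Bt_def
      using nf(3) ng(3) by (intro F.ln_prod_lin_le G.ln_prod_lin_le F.finB; blast)+
    have 5: "lf \<le> real d * mf" "lg \<le> real d * mg"
      unfolding lf_def lg_def mf_def mg_def using f0_le g0_le nf(1) ng(1) by auto
    have "x + (n - 2 * k - 2 - 4 * real d) * (mf + mg) \<le> 2 * KF + 2 * KG + 2 * sA + 8 * sB + (2 * n + 6) * (F.E z + G.E z)"
    proof -
      \<comment> \<open>The products are replaced by variables to make the combination linear:
        weight 2 for each second main theorem, 1 for \<open>St\<close>, 4 for \<open>Bt\<close> and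
        for \<open>f0\<close>, 2 for \<open>\<eta>\<close>.\<close>
      have "x + 2 * u + 2 * v \<le> 2 * KF + 2 * ef + 2 * KG + 2 * eg + (sA + y1) + (sA + y2)
          + 4 * (sB + y3) + 4 * (sB + y4) + 4 * y5 + 4 * y6 + 2 * y7"
        if "wf + u - sf - bf - lf \<le> KF + ef" "wg + v - sg - bg - lg \<le> KG + eg" "sf \<le> sA + y1" "sg \<le> sA + y2"
          "bf \<le> sB + y3" "bg \<le> sB + y4" "lf \<le> y5" "lg \<le> y6" "\<eta> \<le> y7" for u v ef eg y1 y2 y3 y4 y5 y6 y7
        using that eq unfolding distrib_left by linarith
      from this[OF 1 2 3 4 5 \<eta>[folded n_def]]
      show ?thesis by (simp add: algebra_simps)
    qed
    then show "ln (norm (X z)) + real (card A - 2 * card B - 2 - 4 * d) * (ln (F.M z) + ln (G.M z))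
      \<le> 2 * KF + 2 * KG + 2 * sA + 8 * sB + (2 * real (card A) + 6) * (F.E z + G.E z)"
      unfolding rc x_def mf_def mg_def n_def by simp
  qed
qed

theorem impossible: False
proof -
  obtain w where w: "f0 w \<noteq> 0" using F.f0_nz by auto
  \<comment> \<open>A value that \<open>f\<close> takes, needed at the end for the unboundedness of
    the characteristic.\<close>
  define a where "a = f1 w / f0 w"
  have aw: "F.lin a w = 0" using w by (simp add: F.lin_def a_def)
  \<comment> \<open>Collects all zeros that the centre and the circles have to avoid.\<close>
  define \<Psi> where "\<Psi> = (\<lambda>z. F.\<Phi> z * G.\<Phi> z * (X z * F.lin a z))"
  have \<Psi>: "\<Psi> holomorphic_on UNIV"
    unfolding \<Psi>_def by (intro holomorphic_intros F.\<Phi>_holomorphic G.\<Phi>_holomorphic X(1) F.lin_holomorphic)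
  have "\<exists>z. \<Psi> z \<noteq> 0" unfolding \<Psi>_def
    by (intro entire_mult_nz holomorphic_intros F.\<Phi>_holomorphic G.\<Phi>_holomorphic X F.lin_holomorphic F.\<Phi>_nz G.\<Phi>_nz F.lin_nz)
  then obtain p where p: "\<Psi> p \<noteq> 0" by auto
  then have p': "F.\<Phi> p \<noteq> 0" "G.\<Phi> p \<noteq> 0" "X p \<noteq> 0" "F.lin a p \<noteq> 0" by (auto simp: \<Psi>_def)
  define good where "good = (\<lambda>\<rho>. \<forall>z\<in>sphere p \<rho>. \<Psi> z \<noteq> 0)"
  have goodD: "F.\<Phi> z \<noteq> 0" "G.\<Phi> z \<noteq> 0" "X z \<noteq> 0" "F.lin a z \<noteq> 0" if "good \<rho>" "dist p z = \<rho>" for \<rho> z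
    using that by (auto simp: good_def \<Psi>_def)
  have good_ex: "\<exists>\<rho>. x < \<rho> \<and> \<rho> < y \<and> good \<rho>" if "x < y" for x y
    using zero_free_circle[OF \<Psi> p that, of p] unfolding good_def by metis
  define TF where "TF = (\<lambda>\<rho>. circle_mean p \<rho> (\<lambda>z. ln (F.M z)))"
  define TG where "TG = (\<lambda>\<rho>. circle_mean p \<rho> (\<lambda>z. ln (G.M z)))"
  \<comment> \<open>On zero-free circles of radius at least 1, adding \<open>s\<close> makes
    \<open>TF \<rho> + TG \<rho>\<close> nonnegative and at least as large as either
    summand.\<close>
  define s where "s = \<bar>ln (norm (f0 p))\<bar> + \<bar>ln (norm (g0 p))\<bar>"
  have TF_ge: "TF \<rho> \<ge> ln (norm (f0 p))" and TG_ge: "TG \<rho> \<ge> ln (norm (g0 p))" if "good \<rho>" "\<rho> \<ge> 1" for \<rho>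
    unfolding TF_def TG_def
    by (rule F.circle_mean_M_ge G.circle_mean_M_ge; use p' goodD[OF that(1)] that(2) in auto)+
  \<comment> \<open>The supremum over zero-free circles is monotone by construction and defined at
    every \<open>x\<close>; the element 0 keeps the set nonempty and the supremum
    nonnegative.\<close>
  define V where "V = (\<lambda>x. insert 0 {TF \<rho> + TG \<rho> + s | \<rho>. good \<rho> \<and> 1 \<le> \<rho> \<and> \<rho> \<le> x})"
  define T where "T = (\<lambda>x. Sup (V x))"
  have bdd: "bdd_above (V x)" for x
  proof -
    have "bounded ((\<lambda>z. ln (F.M z)) ` cball p x)" "bounded ((\<lambda>z. ln (G.M z)) ` cball p x)"
      by (intro compact_imp_bounded compact_continuous_image F.M_continuous G.M_continuous compact_cball)+
    then obtain b1 b2 where b: "\<And>z. z \<in> cball p x \<Longrightarrow> \<bar>ln (F.M z)\<bar> \<le> b1" "\<And>z. z \<in> cball p x \<Longrightarrow> \<bar>ln (G.M z)\<bar> \<le> b2"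
      unfolding bounded_real by blast
    have "TF \<rho> + TG \<rho> + s \<le> b1 + b2 + s" if "1 \<le> \<rho>" "\<rho> \<le> x" for \<rho>
    proof -
      have "TF \<rho> \<le> circle_mean p \<rho> (\<lambda>_. b1)" unfolding TF_def
        by (rule circle_mean_mono[OF _ F.M_continuous continuous_on_const]) (use that b(1) abs_le_D1 in \<open>force+\<close>)
      moreover have "TG \<rho> \<le> circle_mean p \<rho> (\<lambda>_. b2)" unfolding TG_def
        by (rule circle_mean_mono[OF _ G.M_continuous continuous_on_const]) (use that b(2) abs_le_D1 in \<open>force+\<close>)
      ultimately show ?thesis by simp
    qed
    then have "\<forall>y\<in>V x. y \<le> max 0 (b1 + b2 + s)" unfolding V_def by force
    then show ?thesis unfolding bdd_above_def by blast
  qed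
  have T_ge: "TF \<rho> + TG \<rho> + s \<le> T x" if "good \<rho>" "1 \<le> \<rho>" "\<rho> \<le> x" for \<rho> x
    unfolding T_def by (rule cSup_upper[OF _ bdd]) (use that in \<open>auto simp: V_def\<close>)
  have T0: "T x \<ge> 0" for x
    unfolding T_def by (rule cSup_upper[OF _ bdd]) (simp add: V_def)
  have T_mono: "T x \<le> T y" if "x \<le> y" for x y
    unfolding T_def by (rule cSup_subset_mono[OF _ bdd]) (use that in \<open>auto simp: V_def\<close>)
  obtain KF where KF: "KF \<ge> 0" "F.mean_bound4 p F.E KF" using F.circle_mean_E_le[OF p'(1)] by blast
  obtain KG where KG: "KG \<ge> 0" "G.mean_bound4 p G.E KG" using G.circle_mean_E_le[OF p'(2)] by blast
  define c where "c = real (card A - 2 * card B - 2 - 4 * d)"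
  have c1: "c \<ge> 1" using card by (simp add: c_def)
  define e where "e = 2 * real (card A) + 6"
  obtain K where K: "\<And>z. F.\<Phi> z \<noteq> 0 \<Longrightarrow> G.\<Phi> z \<noteq> 0 \<Longrightarrow> X z \<noteq> 0 \<Longrightarrow>
    ln (norm (X z)) + c * (ln (F.M z) + ln (G.M z)) \<le> K + e * (F.E z + G.E z)"
    using pointwise unfolding c_def e_def by blast
  define C where "C = \<bar>K\<bar> + e * (KF + KG) + \<bar>ln (norm (X p))\<bar> + c * s + 1"
  have C: "C > 0"
    unfolding C_def using KF KG c1 by (intro add_nonneg_pos add_nonneg_nonneg mult_nonneg_nonneg) (auto simp: e_def s_def)
  have "\<exists>b. \<forall>r\<ge>1. T r \<le> b"
  proof (rule growth_bounded[OF _ T0 C])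
    fix r h :: real assume r: "1 \<le> r" and h: "0 < h" "h \<le> 1"
    define \<tau> where "\<tau> = T (r * (1 + h) ^ 8)"
    have \<tau>: "\<tau> \<ge> 0" using T0 by (simp add: \<tau>_def)
    have e1: "err h \<tau> \<ge> 1" using h \<tau> by (rule err_ge_1)
    have "v \<le> C * err h \<tau>" if "v \<in> V r" for v
    proof -
      have "v = 0 \<or> (\<exists>\<rho>. v = TF \<rho> + TG \<rho> + s \<and> good \<rho> \<and> 1 \<le> \<rho> \<and> \<rho> \<le> r)" using that by (auto simp: V_def)
      then show ?thesis
      proof (elim disjE exE conjE)
        assume "v = 0"
        then show ?thesis using C e1 by simp
      next
        fix \<rho> assume v: "v = TF \<rho> + TG \<rho> + s" and \<rho>: "good \<rho>" "1 \<le> \<rho>" "\<rho> \<le> r"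
        \<comment> \<open>A circle has to be moved off the zeros, so the next radius is only located
          between \<open>x * (1 + h)\<close> and \<open>x * (1 + h)^2\<close>. Four such moves
          account for the exponent 8.\<close>
        have nxt: "\<exists>y. x * (1 + h) \<le> y \<and> y \<le> x * (1 + h) ^ 2 \<and> good y" if "x \<ge> 1" for x
        proof -
          have "x * (1 + h) * 1 < x * (1 + h) * (1 + h)" using that h by (intro mult_strict_left_mono) auto
          from good_ex[OF this] show ?thesis by (auto simp: power2_eq_square mult.assoc intro: less_imp_le)
        qed
        have ge1: "y \<ge> 1" if "x \<ge> 1" "x * (1 + h) \<le> y" for x y :: real
          using that h mult_mono[of 1 x 1 "1 + h"] by simp
        obtain R1 where R1: "\<rho> * (1 + h) \<le> R1" "R1 \<le> \<rho> * (1 + h) ^ 2" "good R1" using nxt[OF \<rho>(2)] by auto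
        have R1': "R1 \<ge> 1" by (rule ge1[OF \<rho>(2) R1(1)])
        obtain R2 where R2: "R1 * (1 + h) \<le> R2" "R2 \<le> R1 * (1 + h) ^ 2" "good R2" using nxt[OF R1'] by auto
        have R2': "R2 \<ge> 1" by (rule ge1[OF R1' R2(1)])
        obtain R3 where R3: "R2 * (1 + h) \<le> R3" "R3 \<le> R2 * (1 + h) ^ 2" "good R3" using nxt[OF R2'] by auto
        have R3': "R3 \<ge> 1" by (rule ge1[OF R2' R3(1)])
        obtain R4 where R4: "R3 * (1 + h) \<le> R4" "R4 \<le> R3 * (1 + h) ^ 2" "good R4" using nxt[OF R3'] by auto
        have R4': "R4 \<ge> 1" by (rule ge1[OF R3' R4(1)])
        have up: "x \<le> y" if "x * (1 + h) \<le> y" "x \<ge> 1" for x y :: real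
        proof -
          have "x * 1 \<le> x * (1 + h)" using that h by (intro mult_left_mono) auto
          then show ?thesis using that by linarith
        qed
        have "R4 \<le> R3 * (1 + h) ^ 2" by (rule R4)
        also have "\<dots> \<le> (R2 * (1 + h) ^ 2) * (1 + h) ^ 2" using R3 h by (intro mult_right_mono) auto
        also have "\<dots> \<le> ((R1 * (1 + h) ^ 2) * (1 + h) ^ 2) * (1 + h) ^ 2" using R2 h by (intro mult_right_mono) auto
        also have "\<dots> \<le> (((\<rho> * (1 + h) ^ 2) * (1 + h) ^ 2) * (1 + h) ^ 2) * (1 + h) ^ 2" using R1 h by (intro mult_right_mono) auto
        also have "\<dots> = \<rho> * (1 + h) ^ 8" by (simp add: mult.assoc flip: power_add)
        also have "\<dots> \<le> r * (1 + h) ^ 8" using \<rho> h by (intro mult_right_mono) auto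
        finally have R4le: "R4 \<le> r * (1 + h) ^ 8" .
        have Rle: "R3 \<le> r * (1 + h) ^ 8" "R2 \<le> r * (1 + h) ^ 8" "R1 \<le> r * (1 + h) ^ 8"
          using R4le up[OF R4(1) R3'] up[OF R3(1) R2'] up[OF R2(1) R1'] by linarith+
        have TT: "TF x \<le> \<tau> \<and> TG x \<le> \<tau>" if "x \<in> {R1, R2, R3, R4}" for x
        proof -
          have x: "good x" "x \<ge> 1" "x \<le> r * (1 + h) ^ 8" using that R1 R2 R3 R4 R1' R2' R3' R4' R4le Rle by auto
          have "TF x + TG x + s \<le> \<tau>" unfolding \<tau>_def by (rule T_ge[OF x])
          then show ?thesis using TF_ge[OF x(1,2)] TG_ge[OF x(1,2)] unfolding s_def by linarith
        qed
        have gd: "good x" if "x \<in> {\<rho>, R1, R2, R3, R4}" for x using that \<rho> R1 R2 R3 R4 by auto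
        have gdP: "F.\<Phi> z \<noteq> 0" "G.\<Phi> z \<noteq> 0" if "dist p z \<in> {\<rho>, R1, R2, R3, R4}" for z
          using goodD[OF gd[OF that] refl] by auto
        have EF: "circle_mean p \<rho> F.E \<le> KF * err h \<tau>"
          by (rule KF(2)[unfolded F.mean_bound4_def, rule_format, OF \<rho>(2) h R1(1) R2(1) R3(1) R4(1) \<tau>])
            (use TT gdP in \<open>auto simp: TF_def\<close>)
        have EG: "circle_mean p \<rho> G.E \<le> KG * err h \<tau>"
          by (rule KG(2)[unfolded G.mean_bound4_def, rule_format, OF \<rho>(2) h R1(1) R2(1) R3(1) R4(1) \<tau>])
            (use TT gdP in \<open>auto simp: TG_def\<close>)
        have \<rho>0: "\<rho> \<ge> 0" using \<rho> by simp
        have cE: "continuous_on (sphere p \<rho>) F.E" "continuous_on (sphere p \<rho>) G.E"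
          by (intro F.E_continuous_on G.E_continuous_on; use goodD[OF \<rho>(1)] in auto)+
        have cX: "continuous_on (sphere p \<rho>) (\<lambda>z. ln (norm (X z)))"
          by (intro ln_norm_continuous_on X) (use goodD[OF \<rho>(1)] in auto)
        have cM: "continuous_on (sphere p \<rho>) (\<lambda>z. ln (F.M z) + ln (G.M z))"
          by (intro continuous_on_add F.M_continuous G.M_continuous)
        have "circle_mean p \<rho> (\<lambda>z. ln (norm (X z)) + c * (ln (F.M z) + ln (G.M z))) \<le> circle_mean p \<rho> (\<lambda>z. K + e * (F.E z + G.E z))"
        proof (rule circle_mean_mono[OF \<rho>0])
          show "ln (norm (X z)) + c * (ln (F.M z) + ln (G.M z)) \<le> K + e * (F.E z + G.E z)" if "z \<in> sphere p \<rho>" for z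
            by (rule K) (use goodD[OF \<rho>(1)] that in auto)
        qed (intro continuous_on_add continuous_on_mult_left continuous_on_const cE cX F.M_continuous G.M_continuous)+
        also have "\<dots> = K + e * (circle_mean p \<rho> F.E + circle_mean p \<rho> G.E)"
          using \<rho>0 cE by (simp add: circle_mean_add circle_mean_cmult continuous_on_add continuous_on_mult_left)
        also have "\<dots> \<le> K + e * (KF * err h \<tau> + KG * err h \<tau>)"
          using EF EG by (intro add_left_mono mult_left_mono add_mono) (auto simp: e_def)
        also have "circle_mean p \<rho> (\<lambda>z. ln (norm (X z)) + c * (ln (F.M z) + ln (G.M z))) = circle_mean p \<rho> (\<lambda>z. ln (norm (X z))) + c * (TF \<rho> + TG \<rho>)"
          unfolding TF_def TG_def using \<rho>0 cX cM
          by (simp add: circle_mean_add circle_mean_cmult continuous_on_mult_left F.M_continuous G.M_continuous)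
        finally have 1: "circle_mean p \<rho> (\<lambda>z. ln (norm (X z))) + c * (TF \<rho> + TG \<rho>) \<le> K + e * (KF * err h \<tau> + KG * err h \<tau>)" .
        \<comment> \<open>Here it matters that \<open>X\<close> is entire: its mean logarithm is
          bounded below, whereas the pointwise estimate bounds it above.\<close>
        have 2: "ln (norm (X p)) \<le> circle_mean p \<rho> (\<lambda>z. ln (norm (X z)))"
          by (rule ln_le_circle_mean_center(1)) (use X p' \<rho> goodD[OF \<rho>(1)] in auto)
        have v0: "0 \<le> TF \<rho> + TG \<rho> + s" using TF_ge[OF \<rho>(1,2)] TG_ge[OF \<rho>(1,2)] unfolding s_def by linarith
        have "v \<le> c * (TF \<rho> + TG \<rho> + s)" unfolding v using mult_right_mono[OF c1 v0] by simp
        also have "\<dots> = c * (TF \<rho> + TG \<rho>) + c * s" by (simp add: algebra_simps)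
        also have "\<dots> \<le> (\<bar>K\<bar> + \<bar>ln (norm (X p))\<bar> + c * s + 1) * 1 + e * (KF + KG) * err h \<tau>"
          using 1 2 by (simp add: algebra_simps)
        also have "\<dots> \<le> (\<bar>K\<bar> + \<bar>ln (norm (X p))\<bar> + c * s + 1) * err h \<tau> + e * (KF + KG) * err h \<tau>"
          using e1 c1 by (intro add_right_mono mult_left_mono) (auto simp: s_def)
        also have "\<dots> = C * err h \<tau>" by (simp add: C_def algebra_simps)
        finally show ?thesis .
      qed
    qed
    then have "T r \<le> C * err h \<tau>" unfolding T_def by (intro cSup_least) (auto simp: V_def)
    then show "T r \<le> C * (1 + ln (1 / h) + ln (1 + T (r * (1 + h) ^ 8)))" by (simp add: err_def \<tau>_def)
  qed (use T_mono in auto)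
  then obtain b where b: "\<And>r. r \<ge> 1 \<Longrightarrow> T r \<le> b" by blast
  \<comment> \<open>Beyond the radius \<open>dist p w * exp (L + 1)\<close> the contribution of the
    zero \<open>w\<close> exceeds what the bound \<open>b\<close> allows.\<close>
  define L where "L = b - ln (norm (F.lin a p)) + ln (1 + norm a)"
  have pw: "dist p w > 0" using aw p'(4) by auto
  define x where "x = max 1 (dist p w) * (1 + exp (L + 1))"
  have x1: "x \<ge> 1" "x \<ge> dist p w * exp (L + 1)" "x \<ge> dist p w"
  proof -
    have "max 1 (dist p w) * 1 \<le> x" unfolding x_def by (intro mult_left_mono) auto
    then show "x \<ge> 1" "x \<ge> dist p w" by auto
    show "x \<ge> dist p w * exp (L + 1)" unfolding x_def by (intro mult_mono) auto
  qed
  obtain \<rho> where \<rho>: "x < \<rho>" "good \<rho>" using good_ex[of x "x + 1"] by auto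
  have "ln (norm (F.lin a p)) + ln (\<rho> / dist p w) - ln (1 + norm a) \<le> TF \<rho>"
    unfolding TF_def by (rule F.circle_mean_M_ge_ln[OF aw p'(4)]) (use \<rho> x1 goodD[OF \<rho>(2)] in auto)
  moreover have "TF \<rho> \<le> b"
  proof -
    have "TF \<rho> + TG \<rho> + s \<le> b" using T_ge[of \<rho> \<rho>] b[of \<rho>] \<rho> x1 by force
    then show ?thesis using TG_ge[of \<rho>] \<rho> x1 unfolding s_def by force
  qed
  moreover have "ln (\<rho> / dist p w) \<ge> L + 1"
  proof -
    have "exp (L + 1) \<le> \<rho> / dist p w" using \<rho> x1 pw by (simp add: pos_le_divide_eq mult.commute)
    then have "ln (exp (L + 1)) \<le> ln (\<rho> / dist p w)" by (subst ln_le_cancel_iff) (use pw \<rho> x1 in auto)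
    then show ?thesis by simp
  qed
  ultimately show False unfolding L_def by linarith
qed

end

section \<open>Local analysis\<close>

lemma entire_imp_analytic_at: "u holomorphic_on UNIV \<Longrightarrow> u analytic_on {z}"
  by (meson analytic_on_open analytic_on_subset open_UNIV subset_UNIV)

lemma eventually_nz_nhds:
  assumes "g holomorphic_on UNIV" "g z0 \<noteq> 0"
  shows "eventually (\<lambda>z. g z \<noteq> 0) (nhds (z0::complex))"
proof -
  have "open {z. g z \<noteq> 0}"
    by (intro open_Collect_neq holomorphic_on_imp_continuous_on assms continuous_intros)
  from eventually_nhds_in_open[OF this] show ?thesis using assms(2) by simp
qed

lemma eventually_entire_nz:
  assumes "u holomorphic_on UNIV" "u w \<noteq> 0"
  shows "eventually (\<lambda>z. u z \<noteq> 0) (at (z0::complex))"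
proof -
  obtain m g where g: "g holomorphic_on UNIV" "\<And>z. u z = (z - z0) ^ m * g z" "g z0 \<noteq> 0"
    using entire_order_factorization[OF assms] by metis
  have "eventually (\<lambda>z. g z \<noteq> 0) (at z0)"
    using eventually_nz_nhds[OF g(1,3)] by (simp add: eventually_at_filter eventually_mono)
  moreover have "eventually (\<lambda>z. z \<noteq> z0) (at z0)" by (simp add: eventually_at_filter)
  ultimately show ?thesis by eventually_elim (simp add: g(2))
qed

lemma logderiv_analytic_at:
  assumes "u holomorphic_on UNIV" "u z \<noteq> 0"
  shows "logderiv u analytic_on {z}"
  unfolding logderiv_def using assms
  by (intro analytic_intros entire_imp_analytic_at) auto

lemma logderiv_local:
  assumes g: "g holomorphic_on UNIV" "g z \<noteq> 0" and u: "\<And>z. u z = (z - z0) ^ m * g z" and z: "z \<noteq> z0"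
  shows "logderiv u z = of_nat m / (z - z0) + logderiv g z"
proof -
  have ld: "logderiv (\<lambda>z. z - z0) z = 1 / (z - z0)"
  proof -
    have "deriv (\<lambda>z. z - z0) z = 1" by (rule DERIV_imp_deriv) (auto intro!: derivative_eq_intros)
    then show ?thesis by (simp add: logderiv_def)
  qed
  have fd: "(\<lambda>z. z - z0) field_differentiable (at z)" by (intro derivative_intros)
  have "u = (\<lambda>z. (z - z0) ^ m * g z)" using u by auto
  then have "logderiv u z = logderiv (\<lambda>z. (z - z0) ^ m) z + logderiv g z"
    using g z fd by (simp add: logderiv_mult entire_field_differentiable field_differentiable_power)
  also have "logderiv (\<lambda>z. (z - z0) ^ m) z = of_nat m * (1 / (z - z0))"
    using logderiv_power[OF fd, of m] z ld by simp
  finally show ?thesis by simp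
qed

lemma eventually_logderiv_local:
  assumes u: "u holomorphic_on UNIV" "\<exists>w. u w \<noteq> 0"
  shows "\<exists>y. y analytic_on {z0} \<and> eventually (\<lambda>z. logderiv u z = of_nat (nat (zorder u z0)) / (z - z0) + y z) (at z0)"
proof -
  obtain w where "u w \<noteq> 0" using u(2) by auto
  then obtain g where g: "g holomorphic_on UNIV" "\<And>z. u z = (z - z0) ^ nat (zorder u z0) * g z" "g z0 \<noteq> 0"
    using entire_order_factorization[OF u(1)] by metis
  have "eventually (\<lambda>z. g z \<noteq> 0) (at z0)" by (rule eventually_entire_nz[OF g(1,3)])
  moreover have "eventually (\<lambda>z. z \<noteq> z0) (at z0)" by (simp add: eventually_at_filter)
  ultimately have "eventually (\<lambda>z. logderiv u z = of_nat (nat (zorder u z0)) / (z - z0) + logderiv g z) (at z0)"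
    by eventually_elim (rule logderiv_local[OF g(1) _ g(2)])
  then show ?thesis using logderiv_analytic_at[OF g(1,3)] by blast
qed

lemma analytic_factor_zero:
  assumes "y analytic_on {z0}" "y z0 = 0"
  shows "\<exists>\<eta>. \<eta> analytic_on {z0} \<and> eventually (\<lambda>z. y z = (z - z0) * \<eta> z) (at z0)"
proof -
  obtain S where S: "open S" "z0 \<in> S" "y holomorphic_on S" using assms(1) by (auto simp: analytic_at)
  define \<eta> where "\<eta> = (\<lambda>z. if z = z0 then deriv y z0 else (y z - y z0) / (z - z0))"
  have "\<eta> holomorphic_on S" unfolding \<eta>_def using S by (intro pole_lemma_open)
  then have "\<eta> analytic_on {z0}" using S by (auto simp: analytic_at)
  moreover have "eventually (\<lambda>z. y z = (z - z0) * \<eta> z) (at z0)"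
    using assms(2) by (auto simp: eventually_at_filter \<eta>_def)
  ultimately show ?thesis by blast
qed

lemma zorder_eq_power:
  assumes "g holomorphic_on UNIV" "g z0 \<noteq> 0" "\<And>z. u z = (z - z0) ^ m * g z"
  shows "zorder u z0 = int m"
  by (rule zorder_eqI[of UNIV z0 g]) (use assms in \<open>auto simp: mult.commute\<close>)

text \<open>The left side of \<open>poly_deriv\<close> is the derivative of the monic polynomial
  with zero set \<open>A\<close>, by the product rule; the equation thus makes \<open>B\<close> and
  \<open>m\<close> its critical points and their multiplicities.\<close>

locale entire_pair_poly = entire_pair +
  fixes c :: complex
  assumes c: "c \<noteq> 0"
    and poly_deriv: "(\<Sum>a\<in>A. \<Prod>a'\<in>A-{a}. x - a') = c * (\<Prod>b\<in>B. (x - b) ^ m b)"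
begin

text \<open>The multiplicity of \<open>z\<close> as an \<open>A\<close>-point. At most one summand
  is nonzero, as distinct forms \<open>lin a\<close> have no common zero.\<close>

definition mu :: "complex \<Rightarrow> nat" where "mu z = (\<Sum>a\<in>A. nat (zorder (lin a) z))"

text \<open>Outside the \<open>A\<close>-points the poles of \<open>lam\<close> are simple and lie
  at zeros of \<open>Bt\<close>, \<open>W\<close> or \<open>f0\<close>, so this factor removes
  them.\<close>

definition K :: "complex \<Rightarrow> complex" where "K z = Bt z * W z * f0 z"

lemma K_holomorphic: "K holomorphic_on UNIV"
  unfolding K_def Bt_def by (intro holomorphic_intros lin_holomorphic W_holomorphic f0)

lemma St_holomorphic: "St holomorphic_on UNIV"
  unfolding St_def by (intro holomorphic_intros lin_holomorphic)

lemma zorder_lin_nz: "lin a z \<noteq> 0 \<Longrightarrow> zorder (lin a) z = 0"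
  by (intro zorder_eq_0I entire_imp_analytic_at lin_holomorphic)

lemma lin_other:
  assumes "lin a z = 0" "a' \<noteq> a"
  shows "lin a' z \<noteq> 0" "f0 z \<noteq> 0"
proof -
  show "f0 z \<noteq> 0" using assms(1) coprime[of z] by (auto simp: lin_def)
  then show "lin a' z \<noteq> 0" using assms by (auto simp: lin_def)
qed

lemma lin_zero_f0: "lin a z = 0 \<Longrightarrow> f0 z \<noteq> 0"
  using lin_other(2)[of a z "a + 1"] by simp

lemma mu_eq:
  assumes "a \<in> A" "lin a z = 0"
  shows "mu z = nat (zorder (lin a) z)"
proof -
  have "mu z = nat (zorder (lin a) z) + (\<Sum>a'\<in>A-{a}. nat (zorder (lin a') z))"
    unfolding mu_def using finA assms(1) by (rule sum.remove)
  also have "(\<Sum>a'\<in>A-{a}. nat (zorder (lin a') z)) = 0"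
    using lin_other(1)[OF assms(2)] by (intro sum.neutral) (auto simp: zorder_lin_nz)
  finally show ?thesis by simp
qed

lemma lin_factor:
  obtains g where "g holomorphic_on UNIV" "\<And>z. lin a z = (z - z0) ^ nat (zorder (lin a) z0) * g z" "g z0 \<noteq> 0"
  using lin_nz[of a] entire_order_factorization[OF lin_holomorphic[of a]] by metis

lemma mu_pos_iff: "mu z > 0 \<longleftrightarrow> (\<exists>a\<in>A. lin a z = 0)"
proof
  assume "mu z > 0"
  then have "(\<Sum>a\<in>A. nat (zorder (lin a) z)) \<noteq> 0" unfolding mu_def by simp
  then obtain a where "a \<in> A" "nat (zorder (lin a) z) \<noteq> 0"
    by (rule sum.not_neutral_contains_not_neutral)
  then show "\<exists>a\<in>A. lin a z = 0" using zorder_lin_nz[of a z] by (intro bexI[of _ a]) auto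
next
  assume "\<exists>a\<in>A. lin a z = 0"
  then obtain a where a: "a \<in> A" "lin a z = 0" by auto
  obtain g where "g holomorphic_on UNIV" "\<And>w. lin a w = (w - z) ^ nat (zorder (lin a) z) * g w" "g z \<noteq> 0"
    using lin_factor[of a z] by metis
  then have "nat (zorder (lin a) z) \<noteq> 0" using a(2) by (metis mult_eq_0_iff power_0 zero_neq_one)
  then show "mu z > 0" using mu_eq[OF a] by simp
qed

lemma St_factor:
  obtains s where "s holomorphic_on UNIV" "s z0 \<noteq> 0" "\<And>z. St z = (z - z0) ^ mu z0 * s z"
proof -
  have "\<forall>a. \<exists>g. g holomorphic_on UNIV \<and> (\<forall>z. lin a z = (z - z0) ^ nat (zorder (lin a) z0) * g z) \<and> g z0 \<noteq> 0"
    using lin_factor by metis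
  then obtain g where g: "\<And>a. g a holomorphic_on UNIV" "\<And>a z. lin a z = (z - z0) ^ nat (zorder (lin a) z0) * g a z" "\<And>a. g a z0 \<noteq> 0"
    by metis
  show ?thesis
  proof (rule that[of "\<lambda>z. \<Prod>a\<in>A. g a z"])
    show "(\<lambda>z. \<Prod>a\<in>A. g a z) holomorphic_on UNIV" by (intro holomorphic_intros g)
    show "(\<Prod>a\<in>A. g a z0) \<noteq> 0" using g(3) finA by simp
    fix z
    have "St z = (\<Prod>a\<in>A. (z - z0) ^ nat (zorder (lin a) z0) * g a z)" unfolding St_def using g(2) by simp
    also have "\<dots> = (z - z0) ^ mu z0 * (\<Prod>a\<in>A. g a z)" by (simp add: prod.distrib mu_def power_sum)
    finally show "St z = (z - z0) ^ mu z0 * (\<Prod>a\<in>A. g a z)" .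
  qed
qed

text \<open>At an \<open>A\<close>-point \<open>W = deriv (lin a) * f0 - lin a * deriv f0\<close>
  with \<open>f0\<close> nonzero; the order of \<open>lin a\<close> drops by exactly one.\<close>

lemma W_factor:
  assumes "mu z0 > 0"
  obtains w where "w holomorphic_on UNIV" "w z0 \<noteq> 0" "\<And>z. W z = (z - z0) ^ (mu z0 - 1) * w z"
proof -
  obtain a where a: "a \<in> A" "lin a z0 = 0" using assms mu_pos_iff by auto
  obtain g where g: "g holomorphic_on UNIV" "\<And>z. lin a z = (z - z0) ^ mu z0 * g z" "g z0 \<noteq> 0"
    using lin_factor[of a z0] mu_eq[OF a] by metis
  define k where "k = mu z0 - 1"
  have k: "mu z0 = Suc k" using assms by (simp add: k_def)
  define w where "w = (\<lambda>z. (of_nat (Suc k) * g z + (z - z0) * deriv g z) * f0 z - (z - z0) * g z * deriv f0 z)"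
  have "w holomorphic_on UNIV" unfolding w_def by (intro holomorphic_intros g f0) auto
  moreover have "w z0 \<noteq> 0" using g(3) lin_zero_f0[OF a(2)] by (simp add: w_def del: of_nat_Suc)
  moreover have "W z = (z - z0) ^ (mu z0 - 1) * w z" for z
  proof -
    have "(g has_field_derivative deriv g z) (at z)"
      using entire_field_differentiable[OF g(1)] by (rule field_differentiable_derivI)
    moreover have "((\<lambda>z. z - z0) has_field_derivative 1) (at z)" by (auto intro!: derivative_eq_intros)
    then have "((\<lambda>z. (z - z0) ^ Suc k) has_field_derivative (1 + of_nat k) * (1 * (z - z0) ^ k)) (at z)"
      by (rule DERIV_power_Suc)
    ultimately have "((\<lambda>z. (z - z0) ^ Suc k * g z) has_field_derivative (of_nat (Suc k) * (z - z0) ^ k * g z + (z - z0) ^ Suc k * deriv g z)) (at z)"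
      by (intro DERIV_cong[OF DERIV_mult]) (auto simp: algebra_simps)
    moreover have "lin a = (\<lambda>z. (z - z0) ^ Suc k * g z)" using g(2) k by auto
    ultimately have "deriv (lin a) z = of_nat (Suc k) * (z - z0) ^ k * g z + (z - z0) ^ Suc k * deriv g z"
      by (simp only: DERIV_imp_deriv)
    then have "W z = (of_nat (Suc k) * (z - z0) ^ k * g z + (z - z0) ^ Suc k * deriv g z) * f0 z - (z - z0) ^ Suc k * g z * deriv f0 z"
      using W_lin[of z a] g(2)[of z] k by simp
    then show ?thesis unfolding k by (simp add: w_def algebra_simps)
  qed
  ultimately show ?thesis by (rule that)
qed

text \<open>\<open>J\<close> is the order at \<open>z0\<close> of the derivative of
  \<open>1 / P \<circ> f\<close>. At an \<open>A\<close>-point of multiplicity \<mu> only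
  \<open>W\<close> and one \<open>lin a\<close> contribute, namely \<mu> - 1 - 2\<mu>. Elsewhere
  there is no negative term, and \<open>J\<close> is positive only at zeros of \<open>Bt\<close>,
  \<open>W\<close> or \<open>f0\<close>.\<close>

lemma lam_local:
  "\<exists>J y. y analytic_on {z0} \<and> eventually (\<lambda>z. lam z = of_int J / (z - z0) + y z) (at z0) \<and>
    (mu z0 > 0 \<longrightarrow> J = - int (mu z0) - 1) \<and> (mu z0 = 0 \<longrightarrow> J \<ge> 0) \<and> (mu z0 = 0 \<longrightarrow> J > 0 \<longrightarrow> K z0 = 0)"
proof -
  define o' where "o' = (\<lambda>u. nat (zorder u z0))"
  have "\<forall>a. \<exists>y. y analytic_on {z0} \<and> eventually (\<lambda>z. logderiv (lin a) z = of_nat (o' (lin a)) / (z - z0) + y z) (at z0)"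
    unfolding o'_def using eventually_logderiv_local[OF lin_holomorphic lin_nz] by blast
  then obtain yl where yl: "\<And>a. yl a analytic_on {z0}"
    "\<And>a. eventually (\<lambda>z. logderiv (lin a) z = of_nat (o' (lin a)) / (z - z0) + yl a z) (at z0)" by metis
  obtain yW where yW: "yW analytic_on {z0}" "eventually (\<lambda>z. logderiv W z = of_nat (o' W) / (z - z0) + yW z) (at z0)"
    unfolding o'_def using eventually_logderiv_local[OF W_holomorphic wronskian_nz] by blast
  obtain y0 where y0: "y0 analytic_on {z0}" "eventually (\<lambda>z. logderiv f0 z = of_nat (o' f0) / (z - z0) + y0 z) (at z0)"
    unfolding o'_def using eventually_logderiv_local[OF f0 f0_nz] by blast
  define J where "J = (\<Sum>b\<in>B. int (m b) * int (o' (lin b))) + int (o' W) + int (card A - 1) * int (o' f0) - 2 * (\<Sum>a\<in>A. int (o' (lin a)))"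
  define y where "y = (\<lambda>z. (\<Sum>b\<in>B. of_nat (m b) * yl b z) + yW z + of_nat (card A - 1) * y0 z - 2 * (\<Sum>a\<in>A. yl a z))"
  have mu: "(\<Sum>a\<in>A. int (o' (lin a))) = int (mu z0)" by (simp add: mu_def o'_def)
  have oz: "o' u = 0" if "u holomorphic_on UNIV" "u z0 \<noteq> 0" for u
    using that by (simp add: o'_def zorder_eq_0I entire_imp_analytic_at)
  show ?thesis
  proof (intro exI[of _ J] exI[of _ y] conjI impI)
    show "y analytic_on {z0}" unfolding y_def by (intro analytic_intros yl yW y0)
    have "eventually (\<lambda>z. \<forall>a\<in>A\<union>B. logderiv (lin a) z = of_nat (o' (lin a)) / (z - z0) + yl a z) (at z0)"
      using finA finB yl(2) by (intro eventually_ball_finite) auto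
    then show "eventually (\<lambda>z. lam z = of_int J / (z - z0) + y z) (at z0)"
      using yW(2) y0(2)
    proof eventually_elim
      case (elim z)
      have "(\<Sum>b\<in>B. of_nat (m b) * logderiv (lin b) z) = (\<Sum>b\<in>B. of_nat (m b) * (of_nat (o' (lin b)) / (z - z0) + yl b z))"
        using elim(1) by (intro sum.cong) auto
      moreover have "(\<Sum>a\<in>A. logderiv (lin a) z) = (\<Sum>a\<in>A. of_nat (o' (lin a)) / (z - z0) + yl a z)"
        using elim(1) by (intro sum.cong) auto
      ultimately show ?case
        unfolding lam_def J_def y_def elim(2,3)
        by (simp add: sum.distrib distrib_left sum_distrib_left sum_divide_distrib add_divide_distrib diff_divide_distrib algebra_simps)
    qed
    show "J = - int (mu z0) - 1" if pos: "mu z0 > 0"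
    proof -
      obtain a where a: "a \<in> A" "lin a z0 = 0" using pos mu_pos_iff by auto
      obtain w where w: "w holomorphic_on UNIV" "w z0 \<noteq> 0" "\<And>z. W z = (z - z0) ^ (mu z0 - 1) * w z"
        using W_factor[OF pos] by blast
      have "o' W = mu z0 - 1" using zorder_eq_power[OF w] by (simp add: o'_def)
      moreover have "o' f0 = 0" using oz[OF f0] lin_zero_f0[OF a(2)] by simp
      moreover have "o' (lin b) = 0" if "b \<in> B" for b
        using oz[OF lin_holomorphic] lin_other(1)[OF a(2), of b] a(1) that disj by auto
      ultimately show ?thesis unfolding J_def mu using pos by (simp add: of_nat_diff)
    qed
    show "J \<ge> 0" if "mu z0 = 0"
      unfolding J_def mu that by (simp add: sum_nonneg)
    show "K z0 = 0" if "mu z0 = 0" "J > 0"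
    proof (rule ccontr)
      assume "K z0 \<noteq> 0"
      then have nz: "f0 z0 \<noteq> 0" "W z0 \<noteq> 0" "\<And>b. b \<in> B \<Longrightarrow> lin b z0 \<noteq> 0" using finB by (auto simp: K_def Bt_def)
      then have "o' f0 = 0" "o' W = 0" "\<And>b. b \<in> B \<Longrightarrow> o' (lin b) = 0"
        using oz f0 W_holomorphic lin_holomorphic by blast+
      then have "J = 0" unfolding J_def mu that(1) by simp
      then show False using that by simp
    qed
  qed
qed

text \<open>Two forms of the derivative of \<open>P \<circ> f = St / f0 ^ card A\<close>, for monic
  \<open>P\<close> and with denominators cleared: the quotient rule on the left, the chain rule on
  the right.\<close>

lemma St_wronskian:
  assumes "f0 z \<noteq> 0"
  shows "deriv St z * f0 z - of_nat (card A) * St z * deriv f0 z = c * (\<Prod>b\<in>B. lin b z ^ m b) * W z"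
proof -
  have "(lin a has_field_derivative deriv (lin a) z) (at z)" for a
    using entire_field_differentiable[OF lin_holomorphic] by (rule field_differentiable_derivI)
  then have "((\<lambda>z. \<Prod>a\<in>A. lin a z) has_field_derivative (\<Sum>a\<in>A. deriv (lin a) z * (\<Prod>a'\<in>A-{a}. lin a' z))) (at z)"
    by (intro has_field_derivative_prod)
  then have d: "deriv St z = (\<Sum>a\<in>A. deriv (lin a) z * (\<Prod>a'\<in>A-{a}. lin a' z))"
    unfolding St_def[abs_def] by (rule DERIV_imp_deriv)
  have s: "of_nat (card A) * St z = (\<Sum>a\<in>A. lin a z * (\<Prod>a'\<in>A-{a}. lin a' z))"
  proof -
    have "lin a z * (\<Prod>a'\<in>A-{a}. lin a' z) = St z" if "a \<in> A" for a
      unfolding St_def using finA that by (rule prod.remove[symmetric])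
    then show ?thesis by simp
  qed
  have "deriv St z * f0 z - of_nat (card A) * St z * deriv f0 z
     = (\<Sum>a\<in>A. (deriv (lin a) z * f0 z - lin a z * deriv f0 z) * (\<Prod>a'\<in>A-{a}. lin a' z))"
    unfolding d s by (simp add: sum_distrib_left sum_subtractf algebra_simps)
  also have "\<dots> = W z * (\<Sum>a\<in>A. \<Prod>a'\<in>A-{a}. lin a' z)"
    unfolding W_lin[symmetric] by (simp add: sum_distrib_left)
  also have "(\<Sum>a\<in>A. \<Prod>a'\<in>A-{a}. lin a' z) = c * (\<Prod>b\<in>B. lin b z ^ m b)"
  proof -
    define x where "x = f1 z / f0 z"
    have l: "lin a z = f0 z * (x - a)" for a using assms by (simp add: lin_def x_def field_simps)
    have "(\<Sum>a\<in>A. \<Prod>a'\<in>A-{a}. lin a' z) = (\<Sum>a\<in>A. f0 z ^ (card A - 1) * (\<Prod>a'\<in>A-{a}. x - a'))"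
      unfolding l using finA by (intro sum.cong) (auto simp: prod.distrib)
    also have "\<dots> = f0 z ^ (card A - 1) * (c * (\<Prod>b\<in>B. (x - b) ^ m b))"
      using poly_deriv[of x] by (simp flip: sum_distrib_left)
    also have "card A - 1 = (\<Sum>b\<in>B. m b)" using m_sum by simp
    also have "f0 z ^ (\<Sum>b\<in>B. m b) * (c * (\<Prod>b\<in>B. (x - b) ^ m b)) = c * (\<Prod>b\<in>B. lin b z ^ m b)"
      unfolding l by (simp add: power_mult_distrib prod.distrib power_sum)
    finally show ?thesis .
  qed
  finally show ?thesis by simp
qed

text \<open>Writing \<open>lam\<close> in terms of \<open>St\<close> and its derivative, instead of
  the zeros of $P'$, exposes the cancellation at simple \<open>A\<close>-points.\<close>

lemma lam_eq_St:
  assumes z: "\<Phi> z \<noteq> 0"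
  defines "N \<equiv> \<lambda>z. deriv St z * f0 z - of_nat (card A) * St z * deriv f0 z"
  shows "lam z = logderiv N z + of_nat (card A - 1) * logderiv f0 z - 2 * logderiv St z"
proof -
  note nz = \<Phi>_nzD[OF z]
  have fdl: "lin a field_differentiable (at z)" for a by (rule entire_field_differentiable[OF lin_holomorphic])
  have logprod: "logderiv (\<lambda>z. \<Prod>i\<in>I. u i z) z = (\<Sum>i\<in>I. logderiv (u i) z)"
    if "finite I" "\<And>i. i \<in> I \<Longrightarrow> u i holomorphic_on UNIV" "\<And>i. i \<in> I \<Longrightarrow> u i z \<noteq> 0" for I :: "complex set" and u
    using that
  proof (induction I rule: finite_induct)
    case empty then show ?case by (simp add: logderiv_def)
  next
    case (insert i I)
    have "(\<lambda>z. \<Prod>i\<in>I. u i z) holomorphic_on UNIV" using insert by (intro holomorphic_intros) auto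
    then have "(\<lambda>z. \<Prod>i\<in>I. u i z) field_differentiable (at z)" by (rule entire_field_differentiable)
    then show ?case using insert by (simp add: logderiv_mult entire_field_differentiable)
  qed
  have 1: "logderiv St z = (\<Sum>a\<in>A. logderiv (lin a) z)"
    unfolding St_def[abs_def] using nz(3) by (intro logprod finA lin_holomorphic) auto
  define Q where "Q = (\<lambda>z. \<Prod>b\<in>B. lin b z ^ m b)"
  have Qh: "Q holomorphic_on UNIV" unfolding Q_def by (intro holomorphic_intros lin_holomorphic)
  have Qz: "Q z \<noteq> 0" unfolding Q_def using nz(3) finB by simp
  have 2: "logderiv Q z = (\<Sum>b\<in>B. of_nat (m b) * logderiv (lin b) z)"
    unfolding Q_def using nz(3) by (subst logprod) (auto intro!: finB holomorphic_intros lin_holomorphic sum.cong logderiv_power fdl)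
  have "eventually (\<lambda>w. f0 w \<noteq> 0) (nhds z)" by (rule eventually_nz_nhds[OF f0 nz(1)])
  then have "eventually (\<lambda>w. N w = c * (Q w * W w)) (nhds z)"
  proof eventually_elim
    case (elim w)
    show ?case unfolding N_def Q_def St_wronskian[OF elim] by (simp only: mult.assoc)
  qed
  then have "logderiv N z = logderiv (\<lambda>w. c * (Q w * W w)) z" by (rule logderiv_cong)
  also have "\<dots> = logderiv (\<lambda>w. c) z + logderiv (\<lambda>w. Q w * W w) z"
    using c Qz nz(2) by (intro logderiv_mult entire_field_differentiable holomorphic_intros Qh W_holomorphic) auto
  also have "logderiv (\<lambda>w. Q w * W w) z = logderiv Q z + logderiv W z"
    using Qz nz(2) by (intro logderiv_mult entire_field_differentiable Qh W_holomorphic)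
  also have "logderiv (\<lambda>w. c) z = 0" by (simp add: logderiv_def)
  finally show ?thesis unfolding lam_def 1 2 by simp
qed

text \<open>At a simple \<open>A\<close>-point the constant term of \<open>lam\<close> vanishes: writing \<open>P \<circ> f = (z - z0) s\<close>, the
  derivative of \<open>1 / P \<circ> f\<close> is $(z-z_0)^{-2}$ times a function with vanishing derivative at \<open>z0\<close>.\<close>

lemma lam_local_simple:
  assumes mu: "mu z0 = 1"
  obtains y where "y analytic_on {z0}" "y z0 = 0" "eventually (\<lambda>z. lam z = - 2 / (z - z0) + y z) (at z0)"
proof -
  obtain a where a: "a \<in> A" "lin a z0 = 0" using mu mu_pos_iff[of z0] by auto
  have f00: "f0 z0 \<noteq> 0" by (rule lin_zero_f0[OF a(2)])
  obtain s where s: "s holomorphic_on UNIV" "s z0 \<noteq> 0" "\<And>z. St z = (z - z0) ^ 1 * s z"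
    using St_factor[of z0] mu by metis
  have ds: "deriv St z = s z + (z - z0) * deriv s z" for z
  proof -
    have "(s has_field_derivative deriv s z) (at z)"
      using entire_field_differentiable[OF s(1)] by (rule field_differentiable_derivI)
    then have "((\<lambda>z. (z - z0) * s z) has_field_derivative (s z + (z - z0) * deriv s z)) (at z)"
      by (auto intro!: derivative_eq_intros)
    moreover have "St = (\<lambda>z. (z - z0) * s z)" using s(3) by auto
    ultimately show ?thesis by (simp only: DERIV_imp_deriv)
  qed
  define n where "n = (of_nat (card A) :: complex)"
  define N where "N = (\<lambda>z. deriv St z * f0 z - of_nat (card A) * St z * deriv f0 z)"
  have N: "N = (\<lambda>z. (s z + (z - z0) * deriv s z) * f0 z - n * ((z - z0) * s z) * deriv f0 z)"
    unfolding N_def n_def using ds s(3) by auto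
  have Nh: "N holomorphic_on UNIV" unfolding N by (intro holomorphic_intros s f0) auto
  have Nz0: "N z0 = s z0 * f0 z0" by (simp add: N)
  have dN: "deriv N z0 = 2 * deriv s z0 * f0 z0 + s z0 * deriv f0 z0 - n * s z0 * deriv f0 z0"
  proof (rule DERIV_imp_deriv)
    have 1: "(s has_field_derivative deriv s z0) (at z0)" "(f0 has_field_derivative deriv f0 z0) (at z0)"
      using entire_field_differentiable[OF s(1)] entire_field_differentiable[OF f0] by (auto intro: field_differentiable_derivI)
    have 2: "(deriv s has_field_derivative deriv (deriv s) z0) (at z0)" "(deriv f0 has_field_derivative deriv (deriv f0) z0) (at z0)"
      using entire_field_differentiable[OF holomorphic_deriv[OF s(1) open_UNIV]] entire_field_differentiable[OF holomorphic_deriv[OF f0 open_UNIV]]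
      by (auto intro: field_differentiable_derivI)
    show "(N has_field_derivative 2 * deriv s z0 * f0 z0 + s z0 * deriv f0 z0 - n * s z0 * deriv f0 z0) (at z0)"
      unfolding N by (rule derivative_eq_intros 1 2 refl)+ (simp add: algebra_simps)
  qed
  define y where "y = (\<lambda>z. logderiv N z + of_nat (card A - 1) * logderiv f0 z - 2 * logderiv s z)"
  have "card A \<ge> 1" using m_sum by simp
  then have n1: "of_nat (card A - 1) = n - 1" by (simp add: n_def of_nat_diff)
  show ?thesis
  proof (rule that[of y])
    show "y analytic_on {z0}"
      unfolding y_def using Nz0 s f00 by (intro analytic_intros logderiv_analytic_at Nh f0 s) auto
    \<comment> \<open>\<open>deriv s z0 / s z0\<close> occurs with 2 from \<open>N\<close> and -2
      from \<open>s\<close>, and \<open>deriv f0 z0 / f0 z0\<close> with \<open>1 - n\<close> from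
      \<open>N\<close> and \<open>n - 1\<close> from \<open>f0\<close>.\<close>
    show "y z0 = 0" unfolding y_def logderiv_def dN Nz0 n1 using s(2) f00 by (simp add: field_simps)
    obtain w where "\<Phi> w \<noteq> 0" using \<Phi>_nz by auto
    then have "eventually (\<lambda>z. \<Phi> z \<noteq> 0) (at z0)" by (rule eventually_entire_nz[OF \<Phi>_holomorphic])
    moreover have "eventually (\<lambda>z. s z \<noteq> 0) (at z0)" by (rule eventually_entire_nz[OF s(1,2)])
    moreover have "eventually (\<lambda>z. z \<noteq> z0) (at z0)" by (simp add: eventually_at_filter)
    ultimately show "eventually (\<lambda>z. lam z = - 2 / (z - z0) + y z) (at z0)"
    proof eventually_elim
      case (elim z)
      have "lam z = logderiv N z + of_nat (card A - 1) * logderiv f0 z - 2 * logderiv St z"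
        unfolding N_def by (rule lam_eq_St[OF elim(1)])
      also have "logderiv St z = of_nat 1 / (z - z0) + logderiv s z"
        by (rule logderiv_local[OF s(1) elim(2) s(3) elim(3)])
      finally show ?case by (simp add: y_def)
    qed
  qed
qed

lemma K_factor:
  assumes "mu z0 > 0"
  obtains \<kappa> where "\<kappa> holomorphic_on UNIV" "\<And>z. K z = (z - z0) ^ (mu z0 - 1) * \<kappa> z"
proof -
  obtain w where w: "w holomorphic_on UNIV" "w z0 \<noteq> 0" "\<And>z. W z = (z - z0) ^ (mu z0 - 1) * w z"
    using W_factor[OF assms] by blast
  show ?thesis
  proof (rule that[of "\<lambda>z. Bt z * w z * f0 z"])
    show "(\<lambda>z. Bt z * w z * f0 z) holomorphic_on UNIV"
      unfolding Bt_def by (intro holomorphic_intros lin_holomorphic w f0)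
  qed (simp add: K_def w(3) mult_ac)
qed

text \<open>If the residue of \<open>lam\<close> at \<open>z0\<close> is not 0, then
  \<open>K\<close> vanishes at \<open>z0\<close> and cancels the simple pole.\<close>

lemma K_lam_nonpole:
  assumes "mu z0 = 0"
  shows "\<exists>k. k analytic_on {z0} \<and> eventually (\<lambda>z. K z * lam z = k z) (at z0)"
proof -
  obtain J y where y: "y analytic_on {z0}" and ev: "eventually (\<lambda>z. lam z = of_int J / (z - z0) + y z) (at z0)"
    and J: "J \<ge> 0" "J > 0 \<Longrightarrow> K z0 = 0"
    using lam_local[of z0] assms by metis
  have K: "K analytic_on {z0}" by (rule entire_imp_analytic_at[OF K_holomorphic])
  have "(\<lambda>z. of_int J * K z) analytic_on {z0}" by (intro analytic_intros K)
  moreover have "of_int J * K z0 = 0" using J by (cases "J = 0") auto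
  ultimately obtain \<kappa> where \<kappa>: "\<kappa> analytic_on {z0}" "eventually (\<lambda>z. of_int J * K z = (z - z0) * \<kappa> z) (at z0)"
    using analytic_factor_zero[of "\<lambda>z. of_int J * K z" z0] by blast
  have "eventually (\<lambda>z. z \<noteq> z0) (at z0)" by (simp add: eventually_at_filter)
  with ev \<kappa>(2) have "eventually (\<lambda>z. K z * lam z = \<kappa> z + K z * y z) (at z0)"
  proof eventually_elim
    case (elim z)
    have "K z * lam z = of_int J * K z / (z - z0) + K z * y z" unfolding elim(1) by (simp add: algebra_simps)
    then show ?case unfolding elim(2) using elim(3) by simp
  qed
  moreover have "(\<lambda>z. \<kappa> z + K z * y z) analytic_on {z0}" by (intro analytic_intros \<kappa> K y)
  ultimately show ?thesis by (intro exI[of _ "\<lambda>z. \<kappa> z + K z * y z"]) simp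
qed

text \<open>Through \<open>W\<close> the factor \<open>K\<close> vanishes at least to order
  \<open>mu z0 - 1\<close>; the simple pole of \<open>lam\<close> costs one.\<close>

lemma K_lam_pole:
  assumes "mu z0 \<ge> 2"
  shows "\<exists>\<kappa> k. \<kappa> analytic_on {z0} \<and> k analytic_on {z0} \<and>
    eventually (\<lambda>z. K z = (z - z0) ^ (mu z0 - 1) * \<kappa> z \<and> K z * lam z = (z - z0) ^ (mu z0 - 2) * k z) (at z0)"
proof -
  obtain J y where y: "y analytic_on {z0}" and ev: "eventually (\<lambda>z. lam z = of_int J / (z - z0) + y z) (at z0)"
    using lam_local[of z0] by metis
  have "mu z0 > 0" using assms by simp
  then obtain \<kappa> where \<kappa>: "\<kappa> holomorphic_on UNIV" "\<And>z. K z = (z - z0) ^ (mu z0 - 1) * \<kappa> z"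
    using K_factor by blast
  have \<kappa>': "\<kappa> analytic_on {z0}" by (rule entire_imp_analytic_at[OF \<kappa>(1)])
  have e: "mu z0 - 1 = Suc (mu z0 - 2)" using assms by simp
  define k where "k = (\<lambda>z. of_int J * \<kappa> z + (z - z0) * \<kappa> z * y z)"
  have "eventually (\<lambda>z. z \<noteq> z0) (at z0)" by (simp add: eventually_at_filter)
  with ev have "eventually (\<lambda>z. K z = (z - z0) ^ (mu z0 - 1) * \<kappa> z \<and> K z * lam z = (z - z0) ^ (mu z0 - 2) * k z) (at z0)"
  proof eventually_elim
    case (elim z)
    have "(z - z0) * (of_int J / (z - z0) + y z) = of_int J + (z - z0) * y z" using elim(2) by (simp add: field_simps)
    moreover have "K z * lam z = (z - z0) ^ (mu z0 - 2) * \<kappa> z * ((z - z0) * (of_int J / (z - z0) + y z))"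
      unfolding \<kappa>(2) elim(1) e by simp
    ultimately have "K z * lam z = (z - z0) ^ (mu z0 - 2) * k z" by (simp add: k_def algebra_simps)
    then show ?case using \<kappa>(2) by simp
  qed
  moreover have "k analytic_on {z0}" unfolding k_def by (intro analytic_intros \<kappa>' y)
  ultimately show ?thesis using \<kappa>' by blast
qed

lemma lam_analytic_at: "\<Phi> z \<noteq> 0 \<Longrightarrow> lam analytic_on {z}"
  unfolding lam_def[abs_def] using \<Phi>_nzD[of z]
  by (intro analytic_intros logderiv_analytic_at lin_holomorphic W_holomorphic f0) auto

end

text \<open>All singularities are removed at once. Values at points of analyticity are kept;
  elsewhere \<open>u\<close> may have arbitrary values, such as those of a division by 0.\<close>

lemma entire_extension:
  assumes "\<And>z0. \<exists>x. x analytic_on {z0} \<and> eventually (\<lambda>z. u z = x z) (at z0)"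
  shows "\<exists>X. X holomorphic_on UNIV \<and> (\<forall>z. u analytic_on {z} \<longrightarrow> X z = u z)"
proof (intro exI conjI allI impI)
  have "remove_sings u analytic_on {z0}" for z0
  proof -
    obtain x where x: "x analytic_on {z0}" "eventually (\<lambda>z. u z = x z) (at z0)" using assms by blast
    have "isolated_singularity_at x z0" using x(1) by (rule isolated_singularity_at_analytic)
    then have "isolated_singularity_at u z0" using x(2) isolated_singularity_at_cong by fastforce
    moreover have "x \<midarrow>z0\<rightarrow> x z0" using x(1) analytic_at_imp_isCont isContD by blast
    then have "u \<midarrow>z0\<rightarrow> x z0" using tendsto_cong[OF x(2)] by simp
    ultimately show ?thesis by (rule remove_sings_analytic_at)
  qed
  then have "remove_sings u analytic_on UNIV" using analytic_on_analytic_at by blast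
  then show "remove_sings u holomorphic_on UNIV" by (rule analytic_imp_holomorphic)
  show "remove_sings u z = u z" if "u analytic_on {z}" for z using that by (rule remove_sings_at_analytic)
qed

text \<open>Multiply by \<open>z - z0\<close> and let \<open>z\<close> tend to
  \<open>z0\<close>.\<close>

lemma principal_part_unique:
  assumes "y analytic_on {z0}" "y' analytic_on {z0}"
    and "eventually (\<lambda>z. of_int J / (z - z0) + y z = of_int J' / (z - z0) + y' z) (at (z0::complex))"
  shows "J = J'"
proof -
  have "eventually (\<lambda>z. z \<noteq> z0) (at z0)" by (simp add: eventually_at_filter)
  with assms(3) have "eventually (\<lambda>z. (z - z0) * (y' z - y z) = of_int (J - J')) (at z0)"
  proof eventually_elim
    case (elim z)
    have "y' z - y z = of_int (J - J') / (z - z0)" using elim(1) by (simp add: algebra_simps diff_divide_distrib)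
    then show ?case using elim(2) by simp
  qed
  moreover have "((\<lambda>z. (z - z0) * (y' z - y z)) \<longlongrightarrow> (z0 - z0) * (y' z0 - y z0)) (at z0)"
    using assms(1,2) by (intro tendsto_intros) (auto dest!: analytic_at_imp_isCont isContD)
  ultimately have "((\<lambda>z. of_int (J - J')) \<longlongrightarrow> (0::complex)) (at z0)"
    using tendsto_cong[of "\<lambda>z. (z - z0) * (y' z - y z)" "\<lambda>z. of_int (J - J')" "at z0"] by simp
  then have "of_int (J - J') = (0::complex)" by (simp add: tendsto_const_iff)
  then show ?thesis by simp
qed

section \<open>Truncated sharing makes the auxiliary function \<open>X\<close> entire\<close>

locale truncated_sharing =
  F: entire_pair_poly f0 f1 A B m c + G: entire_pair_poly g0 g1 A B m c
  for f0 f1 g0 g1 :: "complex \<Rightarrow> complex" and A B :: "complex set" and m :: "complex \<Rightarrow> nat" and c :: complex +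
  fixes d :: nat
  assumes share: "(if F.mu z \<le> 3 then F.mu z else 0) = (if G.mu z \<le> 3 then G.mu z else 0)"
    and f0_le: "f0 z \<noteq> 0 \<Longrightarrow> ln (norm (f0 z)) \<le> real d * ln (F.M z)"
    and g0_le: "g0 z \<noteq> 0 \<Longrightarrow> ln (norm (g0 z)) \<le> real d * ln (G.M z)"
    and card: "card A > 2 * card B + 2 + 4 * d"
begin

text \<open>\<open>X\<close> will be \<open>Y^2 / (F.St * G.St)\<close>.\<close>

definition Y :: "complex \<Rightarrow> complex" where "Y z = F.K z * G.K z * (F.lam z - G.lam z)"

lemma Y_eq: "Y z = F.K z * F.lam z * G.K z - F.K z * (G.K z * G.lam z)"
  by (simp add: Y_def algebra_simps)

text \<open>Multiplicities up to 3 are shared, so an \<open>A\<close>-point of only one function has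
  multiplicity at least 4. Multiplicity 3 on both sides falls under the large ones, as its sum is
  6.\<close>

lemma mu_cases:
  obtains (none) "F.mu z = 0" "G.mu z = 0" | (left) "F.mu z \<ge> 4" "G.mu z = 0" | (right) "F.mu z = 0" "G.mu z \<ge> 4"
    | (big) "F.mu z \<ge> 2" "G.mu z \<ge> 2" "F.mu z + G.mu z \<ge> 6"
    | (simple) "F.mu z = 1" "G.mu z = 1" | (double) "F.mu z = 2" "G.mu z = 2"
proof -
  have "(F.mu z = 0 \<and> G.mu z = 0) \<or> (F.mu z \<ge> 4 \<and> G.mu z = 0) \<or> (F.mu z = 0 \<and> G.mu z \<ge> 4) \<or>
    (F.mu z \<ge> 2 \<and> G.mu z \<ge> 2 \<and> F.mu z + G.mu z \<ge> 6) \<or> (F.mu z = 1 \<and> G.mu z = 1) \<or> (F.mu z = 2 \<and> G.mu z = 2)"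
    using share[of z] by (auto split: if_splits)
  then show ?thesis using that by blast
qed

text \<open>\<open>Y\<close> is squared in \<open>X\<close>, so it has to vanish at least to half
  the order of \<open>F.St * G.St\<close>, which is \<open>F.mu z0 + G.mu z0\<close>.\<close>

lemma Y_local:
  "\<exists>e q. q analytic_on {z0} \<and> F.mu z0 + G.mu z0 \<le> 2 * e \<and> eventually (\<lambda>z. Y z = (z - z0) ^ e * q z) (at z0)"
proof (cases rule: mu_cases[of z0])
  case none
  obtain kf where kf: "kf analytic_on {z0}" "eventually (\<lambda>z. F.K z * F.lam z = kf z) (at z0)"
    using F.K_lam_nonpole[OF none(1)] by blast
  obtain kg where kg: "kg analytic_on {z0}" "eventually (\<lambda>z. G.K z * G.lam z = kg z) (at z0)"
    using G.K_lam_nonpole[OF none(2)] by blast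
  have "(\<lambda>z. kf z * G.K z - F.K z * kg z) analytic_on {z0}"
    by (intro analytic_intros kf kg entire_imp_analytic_at F.K_holomorphic G.K_holomorphic)
  moreover have "eventually (\<lambda>z. Y z = (z - z0) ^ 0 * (kf z * G.K z - F.K z * kg z)) (at z0)"
    using kf(2) kg(2) by eventually_elim (simp add: Y_eq)
  moreover have "F.mu z0 + G.mu z0 \<le> 2 * 0" using none by simp
  ultimately show ?thesis by blast
next
  \<comment> \<open>The order \<open>F.mu z0 - 2\<close> must be at least
    \<open>F.mu z0 / 2\<close>. This needs multiplicity at least 4, which truncation at level 3
    guarantees.\<close>
  case left
  then have "F.mu z0 \<ge> 2" by simp
  then obtain \<kappa> k where k: "\<kappa> analytic_on {z0}" "k analytic_on {z0}"
    "eventually (\<lambda>z. F.K z = (z - z0) ^ (F.mu z0 - 1) * \<kappa> z \<and> F.K z * F.lam z = (z - z0) ^ (F.mu z0 - 2) * k z) (at z0)"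
    using F.K_lam_pole by blast
  obtain kg where kg: "kg analytic_on {z0}" "eventually (\<lambda>z. G.K z * G.lam z = kg z) (at z0)"
    using G.K_lam_nonpole[OF left(2)] by blast
  have e: "F.mu z0 - 1 = Suc (F.mu z0 - 2)" using left by simp
  have "(\<lambda>z. k z * G.K z - (z - z0) * \<kappa> z * kg z) analytic_on {z0}"
    by (intro analytic_intros k kg entire_imp_analytic_at G.K_holomorphic)
  moreover have "eventually (\<lambda>z. Y z = (z - z0) ^ (F.mu z0 - 2) * (k z * G.K z - (z - z0) * \<kappa> z * kg z)) (at z0)"
    using k(3) kg(2)
  proof eventually_elim
    case (elim z)
    have "Y z = (z - z0) ^ (F.mu z0 - 2) * k z * G.K z - (z - z0) ^ (F.mu z0 - 1) * \<kappa> z * kg z"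
      unfolding Y_eq conjunct2[OF elim(1)] elim(2) unfolding conjunct1[OF elim(1)] by simp
    then show ?case unfolding e by (simp add: algebra_simps)
  qed
  moreover have "F.mu z0 + G.mu z0 \<le> 2 * (F.mu z0 - 2)" using left by simp
  ultimately show ?thesis by blast
next
  case right
  then have "G.mu z0 \<ge> 2" by simp
  then obtain \<kappa> k where k: "\<kappa> analytic_on {z0}" "k analytic_on {z0}"
    "eventually (\<lambda>z. G.K z = (z - z0) ^ (G.mu z0 - 1) * \<kappa> z \<and> G.K z * G.lam z = (z - z0) ^ (G.mu z0 - 2) * k z) (at z0)"
    using G.K_lam_pole by blast
  obtain kf where kf: "kf analytic_on {z0}" "eventually (\<lambda>z. F.K z * F.lam z = kf z) (at z0)"
    using F.K_lam_nonpole[OF right(1)] by blast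
  have e: "G.mu z0 - 1 = Suc (G.mu z0 - 2)" using right by simp
  have "(\<lambda>z. (z - z0) * \<kappa> z * kf z - F.K z * k z) analytic_on {z0}"
    by (intro analytic_intros k kf entire_imp_analytic_at F.K_holomorphic)
  moreover have "eventually (\<lambda>z. Y z = (z - z0) ^ (G.mu z0 - 2) * ((z - z0) * \<kappa> z * kf z - F.K z * k z)) (at z0)"
    using k(3) kf(2)
  proof eventually_elim
    case (elim z)
    have "Y z = kf z * ((z - z0) ^ (G.mu z0 - 1) * \<kappa> z) - F.K z * ((z - z0) ^ (G.mu z0 - 2) * k z)"
      unfolding Y_eq conjunct2[OF elim(1)] elim(2) unfolding conjunct1[OF elim(1)] by simp
    then show ?case unfolding e by (simp add: algebra_simps)
  qed
  moreover have "F.mu z0 + G.mu z0 \<le> 2 * (G.mu z0 - 2)" using right by simp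
  ultimately show ?thesis by blast
next
  \<comment> \<open>The orders \<open>mu - 1\<close> of \<open>F.K\<close> and \<open>G.K\<close>
    add up, and the simple pole costs one: sum - 3 is at least half the sum because the sum is at
    least 6.\<close>
  case big
  obtain \<kappa> k where k: "\<kappa> analytic_on {z0}" "k analytic_on {z0}"
    "eventually (\<lambda>z. F.K z = (z - z0) ^ (F.mu z0 - 1) * \<kappa> z \<and> F.K z * F.lam z = (z - z0) ^ (F.mu z0 - 2) * k z) (at z0)"
    using F.K_lam_pole[OF big(1)] by blast
  obtain \<kappa>' k' where k': "\<kappa>' analytic_on {z0}" "k' analytic_on {z0}"
    "eventually (\<lambda>z. G.K z = (z - z0) ^ (G.mu z0 - 1) * \<kappa>' z \<and> G.K z * G.lam z = (z - z0) ^ (G.mu z0 - 2) * k' z) (at z0)"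
    using G.K_lam_pole[OF big(2)] by blast
  have e: "F.mu z0 - 1 = Suc (F.mu z0 - 2)" "G.mu z0 - 1 = Suc (G.mu z0 - 2)" using big by simp_all
  define a where "a = F.mu z0 - 2" define b where "b = G.mu z0 - 2"
  have "(\<lambda>z. k z * \<kappa>' z - \<kappa> z * k' z) analytic_on {z0}" by (intro analytic_intros k k')
  moreover have "eventually (\<lambda>z. Y z = (z - z0) ^ (Suc (a + b)) * (k z * \<kappa>' z - \<kappa> z * k' z)) (at z0)"
    using k(3) k'(3)
  proof eventually_elim
    case (elim z)
    have "Y z = ((z - z0) ^ a * k z) * ((z - z0) ^ Suc b * \<kappa>' z) - ((z - z0) ^ Suc a * \<kappa> z) * ((z - z0) ^ b * k' z)"
      unfolding Y_eq conjunct2[OF elim(1)] conjunct2[OF elim(2)] unfolding conjunct1[OF elim(1)] conjunct1[OF elim(2)]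
      unfolding e a_def b_def by simp
    then show ?case by (simp add: algebra_simps power_add)
  qed
  moreover have "F.mu z0 + G.mu z0 \<le> 2 * Suc (a + b)" using big by (simp add: a_def b_def)
  ultimately show ?thesis by blast
next
  \<comment> \<open>\<open>F.K\<close> and \<open>G.K\<close> need not vanish here. The required
    order 1 comes from \<open>F.lam - G.lam\<close>, in which principal parts and constant terms
    cancel.\<close>
  case simple
  obtain y where y: "y analytic_on {z0}" "y z0 = 0" "eventually (\<lambda>z. F.lam z = - 2 / (z - z0) + y z) (at z0)"
    by (rule F.lam_local_simple[OF simple(1)], rule that)
  obtain y' where y': "y' analytic_on {z0}" "y' z0 = 0" "eventually (\<lambda>z. G.lam z = - 2 / (z - z0) + y' z) (at z0)"
    by (rule G.lam_local_simple[OF simple(2)], rule that)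
  have "(\<lambda>z. y z - y' z) analytic_on {z0}" by (intro analytic_intros y y')
  then obtain \<eta> where \<eta>: "\<eta> analytic_on {z0}" "eventually (\<lambda>z. y z - y' z = (z - z0) * \<eta> z) (at z0)"
    using analytic_factor_zero[of "\<lambda>z. y z - y' z" z0] y(2) y'(2) by auto
  have "(\<lambda>z. F.K z * G.K z * \<eta> z) analytic_on {z0}"
    by (intro analytic_intros \<eta> entire_imp_analytic_at F.K_holomorphic G.K_holomorphic)
  moreover have "eventually (\<lambda>z. Y z = (z - z0) ^ 1 * (F.K z * G.K z * \<eta> z)) (at z0)"
    using y(3) y'(3) \<eta>(2)
  proof eventually_elim
    case (elim z)
    have "F.lam z - G.lam z = (z - z0) * \<eta> z" using elim by simp
    then show ?case by (simp add: Y_def)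
  qed
  moreover have "F.mu z0 + G.mu z0 \<le> 2 * 1" using simple by simp
  ultimately show ?thesis by blast
next
  \<comment> \<open>The residues are equal and cancel, and the zeros of \<open>F.K\<close> and
    \<open>G.K\<close> give the required order 2.\<close>
  case double
  obtain J y where y: "y analytic_on {z0}" "eventually (\<lambda>z. F.lam z = of_int J / (z - z0) + y z) (at z0)"
    "F.mu z0 > 0 \<longrightarrow> J = - int (F.mu z0) - 1"
    using F.lam_local[of z0] by (elim exE conjE) (rule that)
  obtain J' y' where y': "y' analytic_on {z0}" "eventually (\<lambda>z. G.lam z = of_int J' / (z - z0) + y' z) (at z0)"
    "G.mu z0 > 0 \<longrightarrow> J' = - int (G.mu z0) - 1"
    using G.lam_local[of z0] by (elim exE conjE) (rule that)
  have J: "J = J'" using y(3) y'(3) double by simp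
  obtain \<kappa> where \<kappa>: "\<kappa> holomorphic_on UNIV" "\<And>z. F.K z = (z - z0) ^ (F.mu z0 - 1) * \<kappa> z"
    using F.K_factor[of z0] double by auto
  obtain \<kappa>' where \<kappa>': "\<kappa>' holomorphic_on UNIV" "\<And>z. G.K z = (z - z0) ^ (G.mu z0 - 1) * \<kappa>' z"
    using G.K_factor[of z0] double by auto
  have "(\<lambda>z. \<kappa> z * \<kappa>' z * (y z - y' z)) analytic_on {z0}"
    by (intro analytic_intros entire_imp_analytic_at \<kappa> \<kappa>' y y')
  moreover have "eventually (\<lambda>z. Y z = (z - z0) ^ 2 * (\<kappa> z * \<kappa>' z * (y z - y' z))) (at z0)"
    using y(2) y'(2)
  proof eventually_elim
    case (elim z)
    have "F.lam z - G.lam z = y z - y' z" using elim J by simp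
    then show ?case unfolding Y_def \<kappa>(2) \<kappa>'(2) using double by (simp add: power2_eq_square)
  qed
  moreover have "F.mu z0 + G.mu z0 \<le> 2 * 2" using double by simp
  ultimately show ?thesis by blast
qed

lemma quotient_local:
  "\<exists>x. x analytic_on {z0} \<and> eventually (\<lambda>z. Y z ^ 2 / (F.St z * G.St z) = x z) (at z0)"
proof -
  obtain e q where q: "q analytic_on {z0}" "F.mu z0 + G.mu z0 \<le> 2 * e" "eventually (\<lambda>z. Y z = (z - z0) ^ e * q z) (at z0)"
    using Y_local by blast
  obtain s where s: "s holomorphic_on UNIV" "s z0 \<noteq> 0" "\<And>z. F.St z = (z - z0) ^ F.mu z0 * s z"
    using F.St_factor[of z0] by blast
  obtain t where t: "t holomorphic_on UNIV" "t z0 \<noteq> 0" "\<And>z. G.St z = (z - z0) ^ G.mu z0 * t z"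
    using G.St_factor[of z0] by blast
  obtain l where l: "2 * e = (F.mu z0 + G.mu z0) + l" using q(2) le_Suc_ex by blast
  have "(\<lambda>z. (z - z0) ^ l * q z ^ 2 / (s z * t z)) analytic_on {z0}"
    using s t by (intro analytic_intros q entire_imp_analytic_at) auto
  moreover have "eventually (\<lambda>z. z \<noteq> z0) (at z0)" by (simp add: eventually_at_filter)
  with q(3) have "eventually (\<lambda>z. Y z ^ 2 / (F.St z * G.St z) = (z - z0) ^ l * q z ^ 2 / (s z * t z)) (at z0)"
  proof eventually_elim
    case (elim z)
    have "Y z ^ 2 = (z - z0) ^ (2 * e) * q z ^ 2" unfolding elim(1) by (simp add: power_mult_distrib power_mult[symmetric] mult.commute)
    also have "\<dots> = (z - z0) ^ (F.mu z0 + G.mu z0) * ((z - z0) ^ l * q z ^ 2)" unfolding l by (simp add: power_add)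
    finally show ?case using elim(2) unfolding s(3) t(3) by (simp add: power_add)
  qed
  ultimately show ?thesis by blast
qed

text \<open>A single point where the two sides differ makes \<open>X\<close> not identically zero;
  then all assumptions of the main estimate hold, and these are contradictory.\<close>

lemma lam_eq: "F.\<Phi> z \<noteq> 0 \<Longrightarrow> G.\<Phi> z \<noteq> 0 \<Longrightarrow> F.lam z = G.lam z"
proof (rule ccontr)
  assume z: "F.\<Phi> z \<noteq> 0" "G.\<Phi> z \<noteq> 0" and ne: "F.lam z \<noteq> G.lam z"
  obtain X where X: "X holomorphic_on UNIV"
    "\<And>z. (\<lambda>z. Y z ^ 2 / (F.St z * G.St z)) analytic_on {z} \<Longrightarrow> X z = Y z ^ 2 / (F.St z * G.St z)"
    using entire_extension[of "\<lambda>z. Y z ^ 2 / (F.St z * G.St z)"] quotient_local by blast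
  have X_good: "X z = Y z ^ 2 / (F.St z * G.St z)" if "F.\<Phi> z \<noteq> 0" "G.\<Phi> z \<noteq> 0" for z
  proof (rule X(2))
    show "(\<lambda>z. Y z ^ 2 / (F.St z * G.St z)) analytic_on {z}"
      unfolding Y_def using F.\<Phi>_nzD(4)[OF that(1)] G.\<Phi>_nzD(4)[OF that(2)]
      by (intro analytic_intros F.lam_analytic_at G.lam_analytic_at that entire_imp_analytic_at
          F.K_holomorphic G.K_holomorphic F.St_holomorphic G.St_holomorphic) auto
  qed
  note nf = F.\<Phi>_nzD[OF z(1)] and ng = G.\<Phi>_nzD[OF z(2)]
  have "X z \<noteq> 0"
    unfolding X_good[OF z] Y_def F.K_def G.K_def using nf ng ne by simp
  interpret value_sharing f0 f1 g0 g1 A B m X d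
  proof
    show "X holomorphic_on UNIV" by fact
    show "\<exists>z. X z \<noteq> 0" using \<open>X z \<noteq> 0\<close> by blast
    fix z
    assume z: "F.\<Phi> z \<noteq> 0" "G.\<Phi> z \<noteq> 0"
    have "X z * (F.St z * G.St z) = Y z ^ 2"
      unfolding X_good[OF z] using F.\<Phi>_nzD(4)[OF z(1)] G.\<Phi>_nzD(4)[OF z(2)] by simp
    then show "X z * (F.St z * G.St z) = (F.W z * G.W z * (F.lam z - G.lam z) * (F.Bt z * f0 z * (G.Bt z * g0 z)))^2"
      by (simp add: Y_def F.K_def G.K_def mult_ac)
  qed (use f0_le g0_le card in auto)
  show False by (rule impossible)
qed

text \<open>\<open>lam\<close> determines its residues. A residue is negative exactly at an
  \<open>A\<close>-point, and there it determines the multiplicity.\<close>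

theorem mu_eq: "F.mu z0 = G.mu z0"
proof -
  obtain J y where y: "y analytic_on {z0}" "eventually (\<lambda>z. F.lam z = of_int J / (z - z0) + y z) (at z0)"
    "F.mu z0 > 0 \<longrightarrow> J = - int (F.mu z0) - 1" "F.mu z0 = 0 \<longrightarrow> J \<ge> 0"
    using F.lam_local[of z0] by (elim exE conjE) (rule that)
  obtain J' y' where y': "y' analytic_on {z0}" "eventually (\<lambda>z. G.lam z = of_int J' / (z - z0) + y' z) (at z0)"
    "G.mu z0 > 0 \<longrightarrow> J' = - int (G.mu z0) - 1" "G.mu z0 = 0 \<longrightarrow> J' \<ge> 0"
    using G.lam_local[of z0] by (elim exE conjE) (rule that)
  obtain w w' where "F.\<Phi> w \<noteq> 0" "G.\<Phi> w' \<noteq> 0" using F.\<Phi>_nz G.\<Phi>_nz by auto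
  then have "eventually (\<lambda>z. F.\<Phi> z \<noteq> 0) (at z0)" "eventually (\<lambda>z. G.\<Phi> z \<noteq> 0) (at z0)"
    using eventually_entire_nz F.\<Phi>_holomorphic G.\<Phi>_holomorphic by blast+
  with y(2) y'(2) have "eventually (\<lambda>z. of_int J / (z - z0) + y z = of_int J' / (z - z0) + y' z) (at z0)"
  proof eventually_elim
    case (elim z)
    show ?case using lam_eq[OF elim(3,4)] unfolding elim(1,2) .
  qed
  then have "J = J'" by (rule principal_part_unique[OF y(1) y'(1)])
  then show ?thesis using y(3,4) y'(3,4) by (cases "F.mu z0 = 0"; cases "G.mu z0 = 0") auto
qed

end

section \<open>The theorem\<close>

text \<open>At \<open>z\<close> only the value \<open>a = f z\<close> can contribute, so truncating
  the summands is the same as truncating the sum.\<close>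

lemma preimage_mset_upto_eq:
  "preimage_mset_upto l S f z = (if enat (preimage_mset S f z) \<le> l then preimage_mset S f z else 0)"
proof (cases "f z \<in> S")
  case True
  then have "{a. a \<in> S \<and> f z = a} = {f z}" by auto
  then show ?thesis by (simp add: preimage_mset_upto_def preimage_mset_def points_upto_def)
next
  case False
  then have "{a. a \<in> S \<and> f z = a} = {}" by auto
  then show ?thesis by (simp only: preimage_mset_upto_def preimage_mset_def sum.empty if_cancel)
qed

text \<open>At a pole \<open>f1 z / f0 z\<close> is a division by 0 with value 0, in accordance with
  the normal form of \<open>f\<close>; the last clause keeps poles apart from zeros.\<close>

definition entire_quotient :: "(complex \<Rightarrow> complex) \<Rightarrow> (complex \<Rightarrow> complex) \<Rightarrow> (complex \<Rightarrow> complex) \<Rightarrow> bool" where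
  "entire_quotient f f0 f1 \<longleftrightarrow> f0 holomorphic_on UNIV \<and> f1 holomorphic_on UNIV \<and> (\<forall>z. f0 z \<noteq> 0 \<or> f1 z \<noteq> 0) \<and>
     (\<forall>z. f z = f1 z / f0 z) \<and> (\<forall>z. f0 z = 0 \<longleftrightarrow> is_pole f z)"

text \<open>Weierstrass factorization, with the zero-free factor put into the numerator.\<close>

lemma meromorphic_entire_quotient:
  assumes "nonconst_meromorphic f"
  shows "\<exists>f0 f1. entire_quotient f f0 f1"
proof -
  have "f nicely_meromorphic_on UNIV" using assms by (simp add: nonconst_meromorphic_def)
  then obtain h f1 f2 where f: "h holomorphic_on UNIV" "f1 holomorphic_on UNIV" "f2 holomorphic_on UNIV"
    "\<forall>z. f1 z = 0 \<longleftrightarrow> \<not>is_pole f z \<and> f z = 0" "\<forall>z. f2 z = 0 \<longleftrightarrow> is_pole f z"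
    "\<forall>z. h z \<noteq> 0" "\<forall>z. f z = h z * f1 z / f2 z"
    by (rule weierstrass_factorization_meromorphic_UNIV) blast
  have "entire_quotient f f2 (\<lambda>z. h z * f1 z)"
    unfolding entire_quotient_def using f by (auto intro!: holomorphic_intros)
  then show ?thesis by blast
qed

lemma entire_entire_quotient:
  assumes "nonconst_entire f"
  shows "entire_quotient f (\<lambda>_. 1) f"
proof -
  have f: "f holomorphic_on UNIV" using assms by (simp add: nonconst_entire_def)
  then have "\<not> is_pole f z" for z
    using not_is_pole_holomorphic[OF open_UNIV UNIV_I] by blast
  then show ?thesis using f by (simp add: entire_quotient_def)
qed

text \<open>If the Wronskian vanished, \<open>f1 / f0\<close> would be constant on a small disc and
  \<open>f1 = a * f0\<close> everywhere by the identity theorem. Without common zeros this forces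
  \<open>f0\<close> to be zero-free, hence \<open>f\<close> to be constant.\<close>

lemma nonconstant_wronskian:
  assumes f: "entire_quotient f f0 f1" and nc: "\<not> f constant_on UNIV"
  shows "\<exists>z. wronskian f0 f1 z \<noteq> 0"
proof (rule ccontr)
  assume "\<not> ?thesis"
  then have W: "wronskian f0 f1 z = 0" for z by blast
  have h: "f0 holomorphic_on UNIV" "f1 holomorphic_on UNIV" and cop: "\<And>z. f0 z \<noteq> 0 \<or> f1 z \<noteq> 0"
    and fe: "\<And>z. f z = f1 z / f0 z" using f by (auto simp: entire_quotient_def)
  have "\<exists>w. f0 w \<noteq> 0"
  proof (rule ccontr)
    assume "\<not> ?thesis"
    then have "f z = 0" for z using fe by simp
    then show False using nc by (auto simp: constant_on_def)
  qed
  then obtain w where w: "f0 w \<noteq> 0" by blast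
  have "open {z. f0 z \<noteq> 0}"
    by (intro open_Collect_neq holomorphic_on_imp_continuous_on h continuous_intros)
  then obtain r where r: "r > 0" "ball w r \<subseteq> {z. f0 z \<noteq> 0}" using w by (auto elim: openE)
  have "\<exists>a. \<forall>z\<in>ball w r. f1 z / f0 z = a"
  proof (rule has_field_derivative_zero_constant)
    fix z assume "z \<in> ball w r"
    then have z: "f0 z \<noteq> 0" using r by auto
    have "(f0 has_field_derivative deriv f0 z) (at z)" "(f1 has_field_derivative deriv f1 z) (at z)"
      using h entire_field_differentiable field_differentiable_derivI by blast+
    from DERIV_divide[OF this(2,1) z]
    have "((\<lambda>z. f1 z / f0 z) has_field_derivative wronskian f0 f1 z / (f0 z * f0 z)) (at z)"
      by (simp add: wronskian_def)
    then show "((\<lambda>z. f1 z / f0 z) has_field_derivative 0) (at z within ball w r)"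
      using W by (simp add: has_field_derivative_at_within)
  qed simp
  then obtain a where a: "\<And>z. z \<in> ball w r \<Longrightarrow> f1 z / f0 z = a" by blast
  have "f1 z - a * f0 z = 0" for z
  proof (rule analytic_continuation[of "\<lambda>z. f1 z - a * f0 z" UNIV "ball w r" w])
    show "w islimpt ball w r" using r by (simp add: islimpt_ball)
    show "f1 z - a * f0 z = 0" if "z \<in> ball w r" for z using a[OF that] r(2) that by (auto simp: field_simps)
  qed (auto intro!: holomorphic_intros h)
  then have "f1 z = a * f0 z" for z by simp
  moreover from this have "f0 z \<noteq> 0" for z using cop[of z] by auto
  ultimately have "f z = a" for z using fe by simp
  then show False using nc by (auto simp: constant_on_def)
qed

context entire_pair_poly
begin

text \<open>Near an \<open>A\<close>-point \<open>f0\<close> has no zeros, so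
  \<open>f - a = lin a / f0\<close> has the order of \<open>lin a\<close>. At a pole no
  \<open>lin a\<close> vanishes, and both sides are 0.\<close>

lemma preimage_mset_eq_mu:
  assumes f: "entire_quotient f f0 f1"
  shows "preimage_mset A f z = mu z"
proof -
  have fe: "\<And>z. f z = f1 z / f0 z" and pole: "\<And>z. f0 z = 0 \<longleftrightarrow> is_pole f z" using f by (auto simp: entire_quotient_def)
  have lin_iff: "lin a z = 0 \<longleftrightarrow> \<not> is_pole f z \<and> f z = a" for a
  proof (cases "f0 z = 0")
    case True
    then show ?thesis using lin_zero_f0[of a z] pole by auto
  next
    case False
    then show ?thesis using pole[of z] fe[of z] by (auto simp: lin_def field_simps)
  qed
  show ?thesis
  proof (cases "\<not> is_pole f z \<and> f z \<in> A")
    case True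
    define a where "a = f z"
    have a: "a \<in> A" "lin a z = 0" using True lin_iff by (auto simp: a_def)
    have z0: "f0 z \<noteq> 0" by (rule lin_zero_f0[OF a(2)])
    obtain g where g: "g holomorphic_on UNIV" "\<And>w. lin a w = (w - z) ^ nat (zorder (lin a) z) * g w" "g z \<noteq> 0"
      using lin_factor[of a z] by metis
    have "open {z. f0 z \<noteq> 0}"
      by (intro open_Collect_neq holomorphic_on_imp_continuous_on f0 continuous_intros)
    then have "zorder (\<lambda>w. f w - a) z = int (nat (zorder (lin a) z))"
    proof (rule zorder_eqI[where g = "\<lambda>w. g w / f0 w"])
      show "z \<in> {z. f0 z \<noteq> 0}" using z0 by simp
      show "(\<lambda>w. g w / f0 w) holomorphic_on {z. f0 z \<noteq> 0}"
        by (intro holomorphic_intros holomorphic_on_subset[OF g(1)] holomorphic_on_subset[OF f0]) auto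
      show "g z / f0 z \<noteq> 0" using g z0 by simp
      fix w assume w: "w \<in> {z. f0 z \<noteq> 0}" "w \<noteq> z"
      have "f w - a = lin a w / f0 w" using w fe[of w] by (simp add: lin_def diff_divide_distrib)
      also have "\<dots> = g w / f0 w * (w - z) ^ nat (zorder (lin a) z)"
        using g(2)[of w] by (simp only: times_divide_eq_left mult.commute)
      finally show "f w - a = g w / f0 w * (w - z) powi int (nat (zorder (lin a) z))"
        by (simp only: power_int_of_nat)
    qed
    then have "point_mult a f z = mu z" using True mu_eq[OF a] by (simp add: point_mult_def a_def)
    moreover have "{b. b \<in> A \<and> f z = b} = {a}" using a by (auto simp: a_def)
    ultimately show ?thesis by (simp add: preimage_mset_def)
  next
    case False
    then have "mu z = 0" using mu_pos_iff[of z] lin_iff by auto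
    moreover have "preimage_mset A f z = 0"
      unfolding preimage_mset_def using False by (intro sum.neutral) (auto simp: point_mult_def)
    ultimately show ?thesis by simp
  qed
qed

end

text \<open>With the roots of the derivative of \<open>Q\<close> and their orders as
  \<open>B\<close> and \<open>m\<close>, \<open>m_sum\<close> compares degrees and
  \<open>poly_deriv\<close> is the factorization into linear factors.\<close>

lemma entire_pair_poly_of_set:
  fixes S :: "complex set"
  defines "Q \<equiv> \<Prod>a\<in>S. [:- a, 1:]"
  assumes S: "finite S" "S \<noteq> {}" and f: "entire_quotient f f0 f1" "\<not> f constant_on UNIV"
  shows "entire_pair_poly f0 f1 S {z. poly (pderiv Q) z = 0} (\<lambda>b. order b (pderiv Q)) (lead_coeff (pderiv Q))"
proof -
  define B where "B = {z. poly (pderiv Q) z = 0}"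
  have pQ: "poly (pderiv Q) x = (\<Sum>a\<in>S. \<Prod>a'\<in>S-{a}. x - a')" for x
    unfolding Q_def pderiv_prod by (simp add: poly_sum poly_prod pderiv_pCons)
  have degQ: "degree Q = card S"
    unfolding Q_def by (subst degree_prod_eq_sum_degree) auto
  have Sp: "card S > 0" using S by (simp add: card_gt_0_iff)
  have deg: "degree (pderiv Q) = card S - 1" by (simp add: degree_pderiv degQ)
  have nz: "pderiv Q \<noteq> 0" using Sp by (simp add: pderiv_eq_0_iff degQ)
  have finB: "finite B" unfolding B_def using nz by (rule poly_roots_finite)
  have dec: "smult (lead_coeff (pderiv Q)) (\<Prod>b\<in>B. [:- b, 1:] ^ order b (pderiv Q)) = pderiv Q"
    unfolding B_def by (rule complex_poly_decompose)
  have "degree (pderiv Q) = degree (smult (lead_coeff (pderiv Q)) (\<Prod>b\<in>B. [:- b, 1:] ^ order b (pderiv Q)))"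
    unfolding dec ..
  also have "\<dots> = (\<Sum>b\<in>B. order b (pderiv Q))"
    using nz by (simp add: degree_prod_eq_sum_degree degree_linear_power)
  finally have sum: "(\<Sum>b\<in>B. order b (pderiv Q)) + 1 = card S" using deg Sp by simp
  have disj: "S \<inter> B = {}"
  proof -
    have "poly (pderiv Q) a \<noteq> 0" if a: "a \<in> S" for a
    proof -
      \<comment> \<open>At \<open>a\<close> only the summand that omits the factor of
        \<open>a\<close> survives, and its factors are nonzero.\<close>
      have "(\<Sum>a''\<in>S-{a}. \<Prod>a'\<in>S-{a''}. a - a') = 0"
      proof (rule sum.neutral, rule ballI)
        fix a'' assume "a'' \<in> S - {a}"
        then have "a \<in> S - {a''}" using a by auto
        then show "(\<Prod>a'\<in>S-{a''}. a - a') = 0" using S(1) by (intro prod_zero bexI[of _ a]) auto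
      qed
      then have "poly (pderiv Q) a = (\<Prod>a'\<in>S-{a}. a - a')"
        unfolding pQ using sum.remove[OF S(1) a, of "\<lambda>a''. \<Prod>a'\<in>S-{a''}. a - a'"] by simp
      then show ?thesis using S(1) by auto
    qed
    then show ?thesis by (auto simp: B_def)
  qed
  show ?thesis
    unfolding B_def[symmetric]
  proof
    show "f0 holomorphic_on UNIV" "f1 holomorphic_on UNIV" "\<And>z. f0 z \<noteq> 0 \<or> f1 z \<noteq> 0"
      using f(1) by (auto simp: entire_quotient_def)
    show "\<exists>z. wronskian f0 f1 z \<noteq> 0" by (rule nonconstant_wronskian[OF f])
    show "lead_coeff (pderiv Q) \<noteq> 0" using nz by simp
    fix x
    have "poly (pderiv Q) x = poly (smult (lead_coeff (pderiv Q)) (\<Prod>b\<in>B. [:- b, 1:] ^ order b (pderiv Q))) x"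
      unfolding dec ..
    then show "(\<Sum>a\<in>S. \<Prod>a'\<in>S-{a}. x - a') = lead_coeff (pderiv Q) * (\<Prod>b\<in>B. (x - b) ^ order b (pderiv Q))"
      unfolding pQ by (simp add: poly_prod)
  qed (use S finB disj sum in auto)
qed

text \<open>With n = \<open>card S\<close> and k critical points the assumption reads n \<ge> 2k + 7
  for \<open>d = 1\<close> and n \<ge> 2k + 3 for \<open>d = 0\<close>, the case of constant
  denominators.\<close>

lemma preimage_mset_eq_of_upto_3:
  fixes S :: "complex set" and d :: nat
  assumes S: "finite S" "S \<noteq> {}" and f: "entire_quotient f f0 f1" "\<not> f constant_on UNIV"
    and g: "entire_quotient g g0 g1" "\<not> g constant_on UNIV"
    and d: "d = 1 \<or> (d = 0 \<and> f0 = (\<lambda>_. 1) \<and> g0 = (\<lambda>_. 1))"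
    and card: "card S \<ge> 2 * card {z. poly (pderiv (\<Prod>a\<in>S. [:- a, 1:])) z = 0} + 3 + 4 * d"
    and eq: "preimage_mset_upto 3 S f = preimage_mset_upto 3 S g"
  shows "preimage_mset S f = preimage_mset S g"
proof -
  define Q where "Q = (\<Prod>a\<in>S. [:- a, 1:])"
  define B where "B = {z. poly (pderiv Q) z = 0}"
  define m where "m = (\<lambda>b. order b (pderiv Q))"
  define c where "c = lead_coeff (pderiv Q)"
  interpret F: entire_pair_poly f0 f1 S B m c
    unfolding B_def m_def c_def Q_def by (rule entire_pair_poly_of_set[OF S f])
  interpret G: entire_pair_poly g0 g1 S B m c
    unfolding B_def m_def c_def Q_def by (rule entire_pair_poly_of_set[OF S g])
  note muF = F.preimage_mset_eq_mu[OF f(1)] and muG = G.preimage_mset_eq_mu[OF g(1)]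
  interpret truncated_sharing f0 f1 g0 g1 S B m c d
  proof
    fix z
    have "(if enat (F.mu z) \<le> 3 then F.mu z else 0) = (if enat (G.mu z) \<le> 3 then G.mu z else 0)"
      using fun_cong[OF eq, of z] by (simp add: preimage_mset_upto_eq muF muG cong: if_cong)
    then show "(if F.mu z \<le> 3 then F.mu z else 0) = (if G.mu z \<le> 3 then G.mu z else 0)"
      by (simp add: numeral_eq_enat)
    show "ln (norm (f0 z)) \<le> real d * ln (F.M z)" if "f0 z \<noteq> 0"
      using d F.ln_norm_f0_le[OF that] by auto
    show "ln (norm (g0 z)) \<le> real d * ln (G.M z)" if "g0 z \<noteq> 0"
      using d G.ln_norm_f0_le[OF that] by auto
    show "card S > 2 * card B + 2 + 4 * d" using card by (simp add: B_def Q_def)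
  qed
  show ?thesis using mu_eq by (auto simp: muF muG)
qed

theorem corollary3p1:
  fixes P :: "complex poly" and a0 :: complex and \<alpha> :: "nat \<Rightarrow> complex"
    and S :: "complex set" and n k :: nat
  assumes P: "P = smult a0 (\<Prod>i=1..n. [:- \<alpha> i, 1:])"
    and a0: "a0 \<noteq> 0"
    and distinct: "\<And>i j. i \<in> {1..n} \<Longrightarrow> j \<in> {1..n} \<Longrightarrow> i \<noteq> j \<Longrightarrow> \<alpha> i \<noteq> \<alpha> j"
    and S: "S = \<alpha> ` {1..n}"
    and k: "k = card {z. poly (pderiv P) z = 0}"
  shows "(n \<ge> 2 * k + 7 \<longrightarrow> (URSM_upto 3 S \<longleftrightarrow> URSM S)) \<and>
         (n \<ge> 2 * k + 3 \<longrightarrow> (URSE_upto 3 S \<longleftrightarrow> URSE S))"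
proof -
  have inj: "inj_on \<alpha> {1..n}" using distinct by (intro inj_onI) metis
  have cS: "card S = n" unfolding S using inj by (simp add: card_image)
  have finS: "finite S" unfolding S by simp
  \<comment> \<open>The factor \<open>a0\<close> affects neither the zeros of \<open>P\<close> nor
    those of its derivative, so the monic polynomial can be used.\<close>
  have "P = smult a0 (\<Prod>a\<in>S. [:- a, 1:])" unfolding P S using inj by (simp add: prod.reindex)
  then have k': "k = card {z. poly (pderiv (\<Prod>a\<in>S. [:- a, 1:])) z = 0}"
    unfolding k using a0 by (simp add: pderiv_smult)
  \<comment> \<open>The truncated multiset is determined by the full one, which gives the easy
    direction.\<close>
  have upto: "preimage_mset_upto 3 S f = preimage_mset_upto 3 S g" if "preimage_mset S f = preimage_mset S g" for f g
    using that by (auto simp: preimage_mset_upto_eq)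
  show ?thesis
  proof (intro conjI impI iffI)
    show "URSM S" if "URSM_upto 3 S" using that upto unfolding URSM_def URSM_upto_def by blast
    show "URSE S" if "URSE_upto 3 S" using that upto unfolding URSE_def URSE_upto_def by blast
  next
    assume n: "n \<ge> 2 * k + 7" and U: "URSM S"
    have ne: "S \<noteq> {}" using n cS by auto
    show "URSM_upto 3 S" unfolding URSM_upto_def
    proof (intro allI impI)
      fix f g assume fg: "nonconst_meromorphic f" "nonconst_meromorphic g"
        and eq: "preimage_mset_upto 3 S f = preimage_mset_upto 3 S g"
      obtain f0 f1 g0 g1 where q: "entire_quotient f f0 f1" "entire_quotient g g0 g1"
        using fg meromorphic_entire_quotient by meson
      have "preimage_mset S f = preimage_mset S g"
        by (rule preimage_mset_eq_of_upto_3[OF finS ne q(1) _ q(2) _ _ _ eq, of 1])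
          (use fg n cS k' in \<open>auto simp: nonconst_meromorphic_def\<close>)
      then show "f = g" using U fg unfolding URSM_def by blast
    qed
  next
    assume n: "n \<ge> 2 * k + 3" and U: "URSE S"
    have ne: "S \<noteq> {}" using n cS by auto
    show "URSE_upto 3 S" unfolding URSE_upto_def
    proof (intro allI impI)
      fix f g assume fg: "nonconst_entire f" "nonconst_entire g"
        and eq: "preimage_mset_upto 3 S f = preimage_mset_upto 3 S g"
      have "preimage_mset S f = preimage_mset S g"
        by (rule preimage_mset_eq_of_upto_3[OF finS ne entire_entire_quotient[OF fg(1)] _ entire_entire_quotient[OF fg(2)] _ _ _ eq, of 0])
          (use fg n cS k' in \<open>auto simp: nonconst_entire_def\<close>)
      then show "f = g" using U fg unfolding URSE_def by blast
    qed
  qed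
qed

end
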